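(* Irreducible representations (comodules) of $SL_h(2)$ on the quantum $h$-plane are obtained as follows. For $j\in\{0,\tfrac12,1,\dots\}$ and $m\in\{-j,\dots,j\}$ let $\tilde\Phi_{jm}=\Phi_{jm}e^{m\sigma}$. In terms of $\xi_h,\eta_h$, $$\tilde\Phi_{jm}(\xi_h,\eta_h)=c_{jm}\,\xi_h^{j+m}(\eta_h-h(j+m)\xi_h)(\eta_h-h(j+m-1)\xi_h)\cdots(\eta_h-h(2m+1)\xi_h)$$ $$\phantom{\tilde\Phi_{jm}(\xi_h,\eta_h)}=c_{jm}\,\eta_h(\eta_h+h\xi_h)\cdots(\eta_h+(j-m-1)h\xi_h)\,\xi_h^{j+m},\qquad c_{jm}=\frac1{\sqrt{(j+m)!\,(j-m)!}},$$ (each product has $j-m$ factors involving $\eta_h$). With $(\xi_h',\eta_h')=(\xi_h,\eta_h)\begin{pmatrix}x & u \\ v & y\end{pmatrix}$, i.e. $\xi_h'=\xi_hx+\eta_hv$, $\eta_h'=\xi_hu+\eta_hy$, there are elements $\tilde d^{\,j}_{km}\in SL_h(2)$ such that $$\tilde\Phi_{jm}(\xi_h',\eta_h')=\sum_{k=-j}^{j}\tilde\Phi_{jk}(\xi_h,\eta_h)\,\tilde d^{\,j}_{km},$$ and these are the $d$-functions of an irreducible representation of $SL_h(2)$: $\Delta(\tilde d^{\,j}_{km})=\sum_n\tilde d^{\,j}_{kn}\otimes\tilde d^{\,j}_{nm}$, $\epsilon(\tilde d^{\,j}_{km})=\delta_{km}$, with $\{\tilde\Phi_{jm}\}_{m=-j}^{j}$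 a basis of the corresponding irreducible right comodule.
   Context: Let $h$ be a complex parameter. $SL_h(2)$ is the algebra generated by $x,y,u,v$ with relations $$[v,x]=hv^2,\quad[u,x]=h(1-x^2),\quad[v,y]=hv^2,\quad[u,y]=h(1-y^2),$$ $$[x,y]=h(xv-yv),\quad[v,u]=h(xv+vy),\qquad xy-uv-hxv=1,$$ and with coproduct and counit given on $T=\begin{pmatrix}x & u \\ v & y\end{pmatrix}$ by $\Delta(T_{ik})=\sum_lT_{il}\otimes T_{lk}$, $\epsilon(T_{ik})=\delta_{ik}$. Let $\xi,\eta$ be commuting variables acting by multiplication on polynomials in $\xi,\eta$, and put $\sigma=-\ln(1-2h\xi\frac{d}{d\eta})$ (well defined on polynomials since $\xi\frac{d}{d\eta}$ is locally nilpotent), and $\Phi_{jm}(\xi,\eta)=\dfrac{\xi^{j+m}\eta^{j-m}}{\sqrt{(j+m)!(j-m)!}}$. Define the operators $\xi_h=\xi e^{\sigma/2}$, $\eta_h=\eta e^{-\sigma/2}$; they satisfy the quantum $h$-plane relation $[\xi_h,\eta_h]=h\xi_h^2$. The entries $x,y,u,v$ are taken to commute with $\xi_h,\eta_h$ (i.e. products such as $\xi_hx$ live in the tensor product of the algebra generated by $\xi_h,\eta_h$ with $SL_h(2)$). The relation $[\xi_h,\eta_h]=h\xi_h^2$ is preserved under $(\xi_h,\eta_h)\mapsto(\xi_h',\eta_h')$. A right $SL_h(2)$-comodule is a vector space $M$ with a map $\rho:M\to M\otimes SL_h(2)$ satisfying $(\rho\otimes\mathrm{id})\rho=(\mathrm{id}\otimes\Delta)\rho$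 and $(\mathrm{id}\otimes\epsilon)\rho=\mathrm{id}$; here $\rho(\tilde\Phi_{jm})=\sum_k\tilde\Phi_{jk}\otimes\tilde d^{\,j}_{km}$. *)

theory Defs
  imports
    Complex_Main
    "HOL-Library.Poly_Mapping"
    "HOL-Computational_Algebra.Polynomial"
    "HOL-Algebra.Module"
    "HOL-Algebra.QuotRing"
    "HOL-Algebra.Subrings"
begin

section \<open>Complex vector spaces and algebras as records\<close>

text \<open>
  A complex vector space is a record of type \<open>(complex, 'a) module\<close>, a complex algebra is the same
  record with its ring multiplication taken into account. Where only the vector space structure
  matters (e.g. for a comodule), the fields \<open>mult\<close> and \<open>one\<close> are ignored.
\<close>

definition complex_alg :: "(complex, complex) module" where
  "complex_alg = \<lparr>carrier = UNIV, monoid.mult = (*), one = 1, ring.zero = 0, add = (+),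
     smult = (*)\<rparr>"

definition linear_map ::
    "(complex, 'a) module \<Rightarrow> (complex, 'b) module \<Rightarrow> ('a \<Rightarrow> 'b) \<Rightarrow> bool" where
  "linear_map V W f \<longleftrightarrow> f \<in> carrier V \<rightarrow> carrier W \<and>
     (\<forall>a\<in>carrier V. \<forall>b\<in>carrier V. f (a \<oplus>\<^bsub>V\<^esub> b) = f a \<oplus>\<^bsub>W\<^esub> f b) \<and>
     (\<forall>c. \<forall>a\<in>carrier V. f (c \<odot>\<^bsub>V\<^esub> a) = c \<odot>\<^bsub>W\<^esub> f a)"

definition lin_span :: "(complex, 'a) module \<Rightarrow> 'a set \<Rightarrow> 'a set" where
  "lin_span V S = \<Inter>{N. submodule N complex_alg V \<and> S \<subseteq> N}"

definition alg_span :: "(complex, 'a) module \<Rightarrow> 'a set \<Rightarrow> 'a set" where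
  "alg_span A S = \<Inter>{B. subring B A \<and> submodule B complex_alg A \<and> S \<subseteq> B}"

definition is_basis :: "(complex, 'a) module \<Rightarrow> 'i set \<Rightarrow> ('i \<Rightarrow> 'a) \<Rightarrow> bool" where
  "is_basis V I b \<longleftrightarrow> finite I \<and> b \<in> I \<rightarrow> carrier V \<and>
     (\<forall>v\<in>carrier V. \<exists>!c. c \<in> extensional I \<and> v = (\<Oplus>\<^bsub>V\<^esub>i\<in>I. c i \<odot>\<^bsub>V\<^esub> b i))"

definition quot_alg :: "(complex, 'a) module \<Rightarrow> 'a set \<Rightarrow> (complex, 'a set) module" where
  "quot_alg A I = \<lparr>carrier = carrier (A Quot I), monoid.mult = monoid.mult (A Quot I),
     one = one (A Quot I), ring.zero = ring.zero (A Quot I), add = add (A Quot I),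
     smult = (\<lambda>c X. \<Union>a\<in>X. I +>\<^bsub>A\<^esub> (c \<odot>\<^bsub>A\<^esub> a))\<rparr>"

section \<open>Tensor products\<close>

definition pm_scale :: "complex \<Rightarrow> ('a \<Rightarrow>\<^sub>0 complex) \<Rightarrow> 'a \<Rightarrow>\<^sub>0 complex" where
  "pm_scale c = Poly_Mapping.map ((*) c)"

text \<open>The free vector space on \<open>carrier V \<times> carrier W\<close>, with the multiplication
  \<open>(a, b) (a', b') = (a a', b b')\<close> of basis elements.\<close>

definition pair_alg :: "(complex, 'a) module \<Rightarrow> (complex, 'b) module \<Rightarrow>
    (complex, ('a \<times> 'b) \<Rightarrow>\<^sub>0 complex) module" where
  "pair_alg V W = \<lparr>carrier = {f. Poly_Mapping.keys f \<subseteq> carrier V \<times> carrier W},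
     monoid.mult = (\<lambda>f g. \<Sum>p\<in>Poly_Mapping.keys f. \<Sum>q\<in>Poly_Mapping.keys g.
        Poly_Mapping.single (fst p \<otimes>\<^bsub>V\<^esub> fst q, snd p \<otimes>\<^bsub>W\<^esub> snd q)
          (Poly_Mapping.lookup f p * Poly_Mapping.lookup g q)),
     one = Poly_Mapping.single (\<one>\<^bsub>V\<^esub>, \<one>\<^bsub>W\<^esub>) 1,
     ring.zero = 0, add = (+), smult = pm_scale\<rparr>"

abbreviation basis_pair :: "'a \<Rightarrow> 'b \<Rightarrow> ('a \<times> 'b) \<Rightarrow>\<^sub>0 complex" where
  "basis_pair a b \<equiv> Poly_Mapping.single (a, b) 1"

definition tensor_null ::
    "(complex, 'a) module \<Rightarrow> (complex, 'b) module \<Rightarrow> (('a \<times> 'b) \<Rightarrow>\<^sub>0 complex) set" where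
  "tensor_null V W = lin_span (pair_alg V W)
     ({basis_pair (a \<oplus>\<^bsub>V\<^esub> a') b - basis_pair a b - basis_pair a' b | a a' b.
         a \<in> carrier V \<and> a' \<in> carrier V \<and> b \<in> carrier W} \<union>
      {basis_pair a (b \<oplus>\<^bsub>W\<^esub> b') - basis_pair a b - basis_pair a b' | a b b'.
         a \<in> carrier V \<and> b \<in> carrier W \<and> b' \<in> carrier W} \<union>
      {basis_pair (c \<odot>\<^bsub>V\<^esub> a) b - pm_scale c (basis_pair a b) | c a b.
         a \<in> carrier V \<and> b \<in> carrier W} \<union>
      {basis_pair a (c \<odot>\<^bsub>W\<^esub> b) - pm_scale c (basis_pair a b) | c a b.
         a \<in> carrier V \<and> b \<in> carrier W})"

definition tensor :: "(complex, 'a) module \<Rightarrow> (complex, 'b) module \<Rightarrow>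
    (complex, (('a \<times> 'b) \<Rightarrow>\<^sub>0 complex) set) module" where
  "tensor V W = quot_alg (pair_alg V W) (tensor_null V W)"

definition ten :: "(complex, 'a) module \<Rightarrow> (complex, 'b) module \<Rightarrow> 'a \<Rightarrow> 'b \<Rightarrow>
    (('a \<times> 'b) \<Rightarrow>\<^sub>0 complex) set" where
  "ten V W a b = tensor_null V W +>\<^bsub>pair_alg V W\<^esub> basis_pair a b"

text \<open>The linear map into \<open>U\<close> induced by a bilinear map \<open>\<beta>\<close>, computed on some representative
  (bilinearity makes the choice irrelevant).\<close>

definition tensor_lift :: "(complex, 'u) module \<Rightarrow> ('a \<Rightarrow> 'b \<Rightarrow> 'u) \<Rightarrow>
    (('a \<times> 'b) \<Rightarrow>\<^sub>0 complex) set \<Rightarrow> 'u" where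
  "tensor_lift U \<beta> X = (let f = (SOME f. f \<in> X) in
     \<Oplus>\<^bsub>U\<^esub>p\<in>Poly_Mapping.keys f. Poly_Mapping.lookup f p \<odot>\<^bsub>U\<^esub> \<beta> (fst p) (snd p))"

definition tensor_map :: "(complex, 'c) module \<Rightarrow> (complex, 'd) module \<Rightarrow> ('a \<Rightarrow> 'c) \<Rightarrow>
    ('b \<Rightarrow> 'd) \<Rightarrow> (('a \<times> 'b) \<Rightarrow>\<^sub>0 complex) set \<Rightarrow> (('c \<times> 'd) \<Rightarrow>\<^sub>0 complex) set" where
  "tensor_map V' W' f g = tensor_lift (tensor V' W') (\<lambda>a b. ten V' W' (f a) (g b))"

text \<open>The canonical map \<open>(A \<otimes> B) \<otimes> C \<rightarrow> A \<otimes> (B \<otimes> C)\<close>.\<close>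

definition tensor_assoc where
  "tensor_assoc A B C =
     tensor_lift (tensor A (tensor B C)) (\<lambda>t c.
       tensor_lift (tensor A (tensor B C)) (\<lambda>a b. ten A (tensor B C) a (ten B C b c)) t)"

section \<open>Right comodules\<close>

definition right_comodule ::
    "(complex, 'a) module \<Rightarrow> ('a \<Rightarrow> (('a \<times> 'a) \<Rightarrow>\<^sub>0 complex) set) \<Rightarrow> ('a \<Rightarrow> complex) \<Rightarrow>
     (complex, 'm) module \<Rightarrow> ('m \<Rightarrow> (('m \<times> 'a) \<Rightarrow>\<^sub>0 complex) set) \<Rightarrow> bool" where
  "right_comodule H \<Delta> \<epsilon> M \<rho> \<longleftrightarrow>
     Module.module complex_alg M \<and> linear_map M (tensor M H) \<rho> \<and>
     (\<forall>v\<in>carrier M.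
        tensor_assoc M H H (tensor_map (tensor M H) H \<rho> id (\<rho> v)) =
        tensor_map M (tensor H H) id \<Delta> (\<rho> v)) \<and>
     (\<forall>v\<in>carrier M. tensor_lift M (\<lambda>m a. \<epsilon> a \<odot>\<^bsub>M\<^esub> m) (\<rho> v) = v)"

text \<open>In a subcomodule \<open>N\<close>, \<open>\<rho>\<close> maps \<open>N\<close> into the image of \<open>N \<otimes> H\<close> in \<open>M \<otimes> H\<close>.\<close>

definition subcomodule ::
    "(complex, 'a) module \<Rightarrow> (complex, 'm) module \<Rightarrow> ('m \<Rightarrow> (('m \<times> 'a) \<Rightarrow>\<^sub>0 complex) set) \<Rightarrow>
     'm set \<Rightarrow> bool" where
  "subcomodule H M \<rho> N \<longleftrightarrow> submodule N complex_alg M \<and>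
     (\<forall>v\<in>N. \<rho> v \<in> lin_span (tensor M H) {ten M H n a | n a. n \<in> N \<and> a \<in> carrier H})"

definition irreducible_right_comodule where
  "irreducible_right_comodule H \<Delta> \<epsilon> M \<rho> \<longleftrightarrow>
     right_comodule H \<Delta> \<epsilon> M \<rho> \<and> carrier M \<noteq> {\<zero>\<^bsub>M\<^esub>} \<and>
     (\<forall>N. subcomodule H M \<rho> N \<longrightarrow> N = {\<zero>\<^bsub>M\<^esub>} \<or> N = carrier M)"

section \<open>The quantum group \<open>SL\<^sub>h(2)\<close>\<close>

datatype sl_gen = Gx | Gy | Gu | Gv

datatype gen_word = Word "sl_gen list"

instantiation gen_word :: monoid_add
begin

fun plus_gen_word :: "gen_word \<Rightarrow> gen_word \<Rightarrow> gen_word" where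
  "Word a + Word b = Word (a @ b)"

definition zero_gen_word :: gen_word where
  "0 = Word []"

instance
proof
  fix a b c :: gen_word
  show "a + b + c = a + (b + c)"
    by (cases a; cases b; cases c) simp
  show "0 + a = a" "a + 0 = a"
    by (cases a; simp add: zero_gen_word_def)+
qed

end

text \<open>With the convolution product of the type \<open>_ \<Rightarrow>\<^sub>0 _\<close>, this is the free algebra on the
  four generators.\<close>

type_synonym free_poly = "gen_word \<Rightarrow>\<^sub>0 complex"

definition gen :: "sl_gen \<Rightarrow> free_poly" where
  "gen a = Poly_Mapping.single (Word [a]) 1"

definition const :: "complex \<Rightarrow> free_poly" where
  "const c = Poly_Mapping.single 0 c"

definition free_alg :: "(complex, free_poly) module" where
  "free_alg = \<lparr>carrier = UNIV, monoid.mult = (*), one = 1, ring.zero = 0, add = (+),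
     smult = pm_scale\<rparr>"

definition sl_rels :: "complex \<Rightarrow> free_poly set" where
  "sl_rels h = (let x = gen Gx; y = gen Gy; u = gen Gu; v = gen Gv in
     {(v * x - x * v) - const h * v\<^sup>2,
      (u * x - x * u) - const h * (1 - x\<^sup>2),
      (v * y - y * v) - const h * v\<^sup>2,
      (u * y - y * u) - const h * (1 - y\<^sup>2),
      (x * y - y * x) - const h * (x * v - y * v),
      (v * u - u * v) - const h * (x * v + v * y),
      (x * y - u * v - const h * x * v) - 1})"

definition sl_ideal :: "complex \<Rightarrow> free_poly set" where
  "sl_ideal h = Idl\<^bsub>free_alg\<^esub> (sl_rels h)"

definition SLh :: "complex \<Rightarrow> (complex, free_poly set) module" where
  "SLh h = quot_alg free_alg (sl_ideal h)"

definition sl :: "complex \<Rightarrow> sl_gen \<Rightarrow> free_poly set" where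
  "sl h a = sl_ideal h +>\<^bsub>free_alg\<^esub> gen a"

definition word_eval :: "(complex, 'b) module \<Rightarrow> (sl_gen \<Rightarrow> 'b) \<Rightarrow> gen_word \<Rightarrow> 'b" where
  "word_eval B g w = (case w of Word as \<Rightarrow> foldr (\<lambda>a r. g a \<otimes>\<^bsub>B\<^esub> r) as \<one>\<^bsub>B\<^esub>)"

definition free_eval :: "(complex, 'b) module \<Rightarrow> (sl_gen \<Rightarrow> 'b) \<Rightarrow> free_poly \<Rightarrow> 'b" where
  "free_eval B g p =
     (\<Oplus>\<^bsub>B\<^esub>w\<in>Poly_Mapping.keys p. Poly_Mapping.lookup p w \<odot>\<^bsub>B\<^esub> word_eval B g w)"

text \<open>The algebra homomorphism out of a quotient of the free algebra that is given by \<open>g\<close> on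
  generators. It is computed on a representative; the choice is irrelevant as soon as the values
  of \<open>g\<close> satisfy the defining relations in \<open>B\<close>.\<close>

definition gen_hom :: "(complex, 'b) module \<Rightarrow> (sl_gen \<Rightarrow> 'b) \<Rightarrow> free_poly set \<Rightarrow> 'b" where
  "gen_hom B g X = free_eval B g (SOME p. p \<in> X)"

text \<open>\<open>T = (x u; v y)\<close>, with row and column indices \<open>1, 2\<close>.\<close>

definition T_entry :: "nat \<Rightarrow> nat \<Rightarrow> sl_gen" where
  "T_entry i k = (if i = 1 then (if k = 1 then Gx else Gu) else (if k = 1 then Gv else Gy))"

fun T_row :: "sl_gen \<Rightarrow> nat" where
  "T_row Gx = 1" | "T_row Gu = 1" | "T_row Gv = 2" | "T_row Gy = 2"

fun T_col :: "sl_gen \<Rightarrow> nat" where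
  "T_col Gx = 1" | "T_col Gu = 2" | "T_col Gv = 1" | "T_col Gy = 2"

definition sl_comult :: "complex \<Rightarrow> free_poly set \<Rightarrow> ((free_poly set \<times> free_poly set) \<Rightarrow>\<^sub>0 complex) set"
  where "sl_comult h = gen_hom (tensor (SLh h) (SLh h))
     (\<lambda>a. \<Oplus>\<^bsub>tensor (SLh h) (SLh h)\<^esub>l\<in>{1, 2}.
        ten (SLh h) (SLh h) (sl h (T_entry (T_row a) l)) (sl h (T_entry l (T_col a))))"

definition sl_counit :: "free_poly set \<Rightarrow> complex" where
  "sl_counit = gen_hom complex_alg (\<lambda>a. if T_row a = T_col a then 1 else 0)"

section \<open>Operators on polynomials in two commuting variables\<close>

text \<open>The inner variable is \<open>\<xi>\<close>, the outer one \<open>\<eta>\<close>; hence \<open>pderiv\<close> is \<open>d/d\<eta>\<close>.\<close>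

type_synonym poly2 = "complex poly poly"

definition var_xi :: poly2 where "var_xi = [:[:0, 1:]:]"
definition var_eta :: poly2 where "var_eta = [:0, 1:]"

definition scale2 :: "complex \<Rightarrow> poly2 \<Rightarrow> poly2" where
  "scale2 c = Polynomial.smult [:c:]"

definition End2 :: "(complex, poly2 \<Rightarrow> poly2) module" where
  "End2 = \<lparr>carrier = {f. Vector_Spaces.linear scale2 scale2 f}, monoid.mult = (\<circ>), one = id,
     ring.zero = (\<lambda>_. 0), add = (\<lambda>f g p. f p + g p), smult = (\<lambda>c f p. scale2 c (f p))\<rparr>"

text \<open>\<open>\<Sum>k. a k N\<^sup>k\<close> for a locally nilpotent operator \<open>N\<close>: the sum is finite at every argument.\<close>

definition nil_series :: "(nat \<Rightarrow> complex) \<Rightarrow> (poly2 \<Rightarrow> poly2) \<Rightarrow> poly2 \<Rightarrow> poly2" where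
  "nil_series a N p = (\<Sum>k | (N ^^ k) p \<noteq> 0. scale2 (a k) ((N ^^ k) p))"

definition op_exp :: "(poly2 \<Rightarrow> poly2) \<Rightarrow> poly2 \<Rightarrow> poly2" where
  "op_exp = nil_series (\<lambda>k. 1 / fact k)"

definition op_neg_ln_one_minus :: "(poly2 \<Rightarrow> poly2) \<Rightarrow> poly2 \<Rightarrow> poly2" where
  "op_neg_ln_one_minus = nil_series (\<lambda>k. if k = 0 then 0 else 1 / of_nat k)"

definition \<sigma>_op :: "complex \<Rightarrow> poly2 \<Rightarrow> poly2" where
  "\<sigma>_op h = op_neg_ln_one_minus (\<lambda>p. scale2 (2 * h) (var_xi * pderiv p))"

definition exp_\<sigma> :: "complex \<Rightarrow> real \<Rightarrow> poly2 \<Rightarrow> poly2" where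
  "exp_\<sigma> h t = op_exp (\<lambda>p. scale2 (of_real t) (\<sigma>_op h p))"

definition \<xi>h :: "complex \<Rightarrow> poly2 \<Rightarrow> poly2" where
  "\<xi>h h p = var_xi * exp_\<sigma> h (1/2) p"

definition \<eta>h :: "complex \<Rightarrow> poly2 \<Rightarrow> poly2" where
  "\<eta>h h p = var_eta * exp_\<sigma> h (- 1/2) p"

definition plane :: "complex \<Rightarrow> (complex, poly2 \<Rightarrow> poly2) module" where
  "plane h = End2\<lparr>carrier := alg_span End2 {\<xi>h h, \<eta>h h}\<rparr>"

section \<open>The elements \<open>\<Phi>\<^sub>j\<^sub>m\<close> and their deformations\<close>

definition spins :: "real set" where
  "spins = {real n / 2 | n. True}"

definition weights :: "real \<Rightarrow> real set" where
  "weights j = {- j + real i | i. - j + real i \<le> j}"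

text \<open>On the spins and weights above, \<open>j + m\<close> and \<open>j - m\<close> are natural numbers.\<close>

abbreviation nat_of :: "real \<Rightarrow> nat" where
  "nat_of r \<equiv> nat \<lfloor>r\<rfloor>"

definition c_coeff :: "real \<Rightarrow> real \<Rightarrow> complex" where
  "c_coeff j m = of_real (1 / sqrt (fact (nat_of (j + m)) * fact (nat_of (j - m))))"

definition \<Phi> :: "real \<Rightarrow> real \<Rightarrow> poly2" where
  "\<Phi> j m = scale2 (c_coeff j m) (var_xi ^ nat_of (j + m) * var_eta ^ nat_of (j - m))"

definition \<Phi>t :: "complex \<Rightarrow> real \<Rightarrow> real \<Rightarrow> poly2 \<Rightarrow> poly2" where
  "\<Phi>t h j m p = \<Phi> j m * exp_\<sigma> h m p"

definition list_prod :: "(complex, 'b) module \<Rightarrow> 'b list \<Rightarrow> 'b" where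
  "list_prod B bs = foldr (\<lambda>a r. a \<otimes>\<^bsub>B\<^esub> r) bs \<one>\<^bsub>B\<^esub>"

text \<open>The two ordered expressions for \<open>\<Phi>t j m\<close>, as noncommutative polynomials in elements
  \<open>X\<close>, \<open>Y\<close> of an arbitrary algebra \<open>B\<close>. The factors in the first one run from
  \<open>Y - h (j + m) X\<close> down to \<open>Y - h (2 m + 1) X\<close>.\<close>

definition \<Phi>t_left :: "complex \<Rightarrow> real \<Rightarrow> real \<Rightarrow> (complex, 'b) module \<Rightarrow> 'b \<Rightarrow> 'b \<Rightarrow> 'b" where
  "\<Phi>t_left h j m B X Y = c_coeff j m \<odot>\<^bsub>B\<^esub>
     (X [^]\<^bsub>B\<^esub> nat_of (j + m) \<otimes>\<^bsub>B\<^esub>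
      list_prod B (map (\<lambda>i. Y \<oplus>\<^bsub>B\<^esub> (- (h * of_real (j + m - real i))) \<odot>\<^bsub>B\<^esub> X)
                       [0..<nat_of (j - m)]))"

definition \<Phi>t_right :: "complex \<Rightarrow> real \<Rightarrow> real \<Rightarrow> (complex, 'b) module \<Rightarrow> 'b \<Rightarrow> 'b \<Rightarrow> 'b" where
  "\<Phi>t_right h j m B X Y = c_coeff j m \<odot>\<^bsub>B\<^esub>
     (list_prod B (map (\<lambda>i. Y \<oplus>\<^bsub>B\<^esub> (of_nat i * h) \<odot>\<^bsub>B\<^esub> X) [0..<nat_of (j - m)])
      \<otimes>\<^bsub>B\<^esub> X [^]\<^bsub>B\<^esub> nat_of (j + m))"

definition plane_SLh where
  "plane_SLh h = tensor (plane h) (SLh h)"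

definition \<xi>h' where
  "\<xi>h' h = ten (plane h) (SLh h) (\<xi>h h) (sl h Gx) \<oplus>\<^bsub>plane_SLh h\<^esub>
           ten (plane h) (SLh h) (\<eta>h h) (sl h Gv)"

definition \<eta>h' where
  "\<eta>h' h = ten (plane h) (SLh h) (\<xi>h h) (sl h Gu) \<oplus>\<^bsub>plane_SLh h\<^esub>
           ten (plane h) (SLh h) (\<eta>h h) (sl h Gy)"

text \<open>The vector space underlying the comodule of spin \<open>j\<close>; only its linear structure is used.\<close>

definition \<Phi>t_space :: "complex \<Rightarrow> real \<Rightarrow> (complex, poly2 \<Rightarrow> poly2) module" where
  "\<Phi>t_space h j = (plane h)\<lparr>carrier := lin_span (plane h) (\<Phi>t h j ` weights j)\<rparr>"

end

theory Submission
  imports Defs "HOL-Computational_Algebra.Formal_Power_Series"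
begin

text \<open>
  With \<open>F = (-h 1; -1 0)\<close> and \<open>E = (0 1; -1 h)\<close> the relations of \<open>SL\<^sub>h(2)\<close> read \<open>T F T\<^sup>t = F\<close> and
  \<open>T\<^sup>t E T = E\<close>, so they are preserved by \<open>\<Delta>\<close>. In an algebra with \<open>X Y - Y X = h X\<^sup>2\<close> the ordered
  monomials \<open>Z n k = Y (Y + hX) \<cdots> (Y + (k-1)hX) X\<^sup>n\<^sup>-\<^sup>k\<close> satisfy \<open>Z n k X = Z (n+1) k\<close> and
  \<open>Z n k Y = Z (n+1) (k+1) + (n-2k)h Z (n+1) k\<close>. Applied to \<open>(X, Y)\<close> and to \<open>(X, Y) T\<close>, these rules
  give a recursion in \<open>n\<close> for the matrix coefficients, from which the expansion of the transformed
  monomials and the values of \<open>\<Delta>\<close> and \<open>\<epsilon>\<close> follow by induction.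

  On polynomials \<open>e\<^bsup>t\<sigma>\<^esup> = (1 - 2h \<xi> d/d\<eta>)\<^sup>-\<^sup>t\<close> commutes with \<open>\<xi>\<close>, while
  \<open>e\<^bsup>t\<sigma>\<^esup> \<eta> = \<eta> e\<^bsup>t\<sigma>\<^esup> + 2ht \<xi> e\<^bsup>(t+1)\<sigma>\<^esup>\<close>; hence \<open>\<xi>\<^sup>n\<^sup>-\<^sup>k \<eta>\<^sup>k e\<^bsup>(n-2k)\<sigma>/2\<^esup>\<close> obeys the same two rules as \<open>Z n k\<close> and
  equals it.

  For irreducibility, two functionals \<open>q\<close> on \<open>SL\<^sub>h(2)\<close> with \<open>q (a b) = \<epsilon> a q b + q a \<chi> b\<close> for a character
  \<open>\<chi>\<close> act on the comodule as a raising and a lowering operator.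
\<close>

subsection \<open>Complex vector spaces\<close>

text \<open>No basis of \<open>SLh h\<close> is at hand. An equation there is proved by exhibiting a
  difference as an element of \<open>sl_ideal h\<close>, and a map out of it is obtained by checking
  the relations. The matrix coefficients are therefore defined as free polynomials. A transformed
  monomial of degree \<open>n + 1\<close> with index \<open>1 \<le> a \<le> n\<close> can be reached
  by a last factor \<open>X'\<close> as well as by a last factor \<open>Y'\<close>. The recursion
  takes the second route; agreement of the two modulo the ideal is the point where
  \<open>T F T\<^sup>t = F\<close> enters the expansion, and the plane relation for the transformed
  pair is a consequence of it.

  Irreducibility likewise has to do without linear independence of the matrix coefficients.
  Functionals on \<open>SLh h\<close> are produced as corner entries of homomorphisms into
  triangular matrices, which again only asks for a check of the relations. For
  \<open>h \<noteq> 0\<close> every derivation at the counit vanishes on \<open>v\<close>, so the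
  lowering functional has to be twisted by a nontrivial character.\<close>

locale cvs = abelian_group V for V :: "(complex, 'a) module" (structure) +
  assumes smult_closed [simp, intro]: "x \<in> carrier V \<Longrightarrow> c \<odot> x \<in> carrier V"
    and smult_l_distr: "x \<in> carrier V \<Longrightarrow> (a + b) \<odot> x = a \<odot> x \<oplus> b \<odot> x"
    and smult_r_distr: "x \<in> carrier V \<Longrightarrow> y \<in> carrier V \<Longrightarrow> a \<odot> (x \<oplus> y) = a \<odot> x \<oplus> a \<odot> y"
    and smult_assoc1: "x \<in> carrier V \<Longrightarrow> (a * b) \<odot> x = a \<odot> (b \<odot> x)"
    and smult_one [simp]: "x \<in> carrier V \<Longrightarrow> 1 \<odot> x = x"
begin

lemma smult_zero_left [simp]: "x \<in> carrier V \<Longrightarrow> 0 \<odot> x = \<zero>"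
  using smult_l_distr[of x 0 0] by (simp add: add.l_cancel_one)

lemma smult_zero_right [simp]: "c \<odot> \<zero> = \<zero>"
  using smult_r_distr[of \<zero> \<zero> c] by (simp add: add.l_cancel_one)

lemma smult_minus_left: "x \<in> carrier V \<Longrightarrow> (- c) \<odot> x = \<ominus> (c \<odot> x)"
  using smult_l_distr[of x "- c" c] by (simp add: minus_equality)

lemma smult_minus_one: "x \<in> carrier V \<Longrightarrow> (- 1) \<odot> x = \<ominus> x"
  by (simp add: smult_minus_left)

lemma smult_finsum:
  "g \<in> I \<rightarrow> carrier V \<Longrightarrow> c \<odot> (\<Oplus>i\<in>I. g i) = (\<Oplus>i\<in>I. c \<odot> g i)"
proof (induct I rule: infinite_finite_induct)
  case (insert x F)
  then show ?case by (simp add: Pi_def smult_r_distr)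
qed auto

lemma finsum_neutral_superset:
  assumes "finite B" "A \<subseteq> B" "\<And>i. i \<in> B - A \<Longrightarrow> f i = \<zero>" "f \<in> B \<rightarrow> carrier V"
  shows "finsum V f A = finsum V f B"
  using add.finprod_mono_neutral_cong_left[of B A f f] assms by (auto simp: Pi_def)

lemma finsum_single_index:
  assumes "finite A" "i \<in> A" "f i \<in> carrier V" "\<And>k. k \<in> A \<Longrightarrow> k \<noteq> i \<Longrightarrow> f k = \<zero>"
  shows "finsum V f A = f i"
proof -
  have "finsum V f {i} = finsum V f A"
    using assms by (intro finsum_neutral_superset) (auto simp: Pi_def, metis zero_closed)
  then show ?thesis using assms by simp
qed

lemma finsum_commute:
  assumes "finite A" "finite B" "\<And>i k. i \<in> A \<Longrightarrow> k \<in> B \<Longrightarrow> f i k \<in> carrier V"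
  shows "(\<Oplus>i\<in>A. \<Oplus>k\<in>B. f i k) = (\<Oplus>k\<in>B. \<Oplus>i\<in>A. f i k)"
  using assms(1,3)
proof (induct A)
  case (insert x F)
  have "(\<Oplus>k\<in>B. \<Oplus>i\<in>insert x F. f i k) = (\<Oplus>k\<in>B. f x k \<oplus> (\<Oplus>i\<in>F. f i k))"
    using insert(1,2,4) by (intro finsum_cong') (auto simp: Pi_def)
  also have "\<dots> = (\<Oplus>k\<in>B. f x k) \<oplus> (\<Oplus>k\<in>B. \<Oplus>i\<in>F. f i k)"
    using insert(4) by (intro finsum_addf) (auto simp: Pi_def)
  also have "(\<Oplus>k\<in>B. \<Oplus>i\<in>F. f i k) = (\<Oplus>i\<in>F. \<Oplus>k\<in>B. f i k)"
    using insert(3,4) by simp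
  finally show ?case
    using insert(1,2,4) by (simp add: Pi_def)
next
  case empty
  then show ?case by (simp add: finsum_zero)
qed

text \<open>Closure under negatives, which a subgroup needs, is supplied by the scalar
  \<open>- 1\<close>.\<close>

lemma submodule_iff:
  "submodule N complex_alg V \<longleftrightarrow> N \<subseteq> carrier V \<and> \<zero> \<in> N \<and>
     (\<forall>a\<in>N. \<forall>b\<in>N. a \<oplus> b \<in> N) \<and> (\<forall>c. \<forall>a\<in>N. c \<odot> a \<in> N)"
proof -
  have inv: "inv\<^bsub>add_monoid V\<^esub> x = (- 1) \<odot> x" if "x \<in> carrier V" for x
    using that by (simp add: smult_minus_one a_inv_def)
  show ?thesis
  proof
    assume "submodule N complex_alg V"
    then interpret submodule N complex_alg V .
    show "N \<subseteq> carrier V \<and> \<zero> \<in> N \<and>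
     (\<forall>a\<in>N. \<forall>b\<in>N. a \<oplus> b \<in> N) \<and> (\<forall>c. \<forall>a\<in>N. c \<odot> a \<in> N)"
      using subset one_closed m_closed smult_closed by (auto simp: complex_alg_def)
  next
    assume a: "N \<subseteq> carrier V \<and> \<zero> \<in> N \<and>
     (\<forall>a\<in>N. \<forall>b\<in>N. a \<oplus> b \<in> N) \<and> (\<forall>c. \<forall>a\<in>N. c \<odot> a \<in> N)"
    show "submodule N complex_alg V"
      by unfold_locales (use a inv in \<open>auto simp: subset_iff\<close>)
  qed
qed

lemma submodule_carrier: "submodule (carrier V) complex_alg V"
  by (simp add: submodule_iff)

lemma submodule_cvs:
  assumes "submodule N complex_alg V"
  shows "cvs (V\<lparr>carrier := N\<rparr>)"
proof -
  have N: "N \<subseteq> carrier V" "\<zero> \<in> N" "\<And>a b. a \<in> N \<Longrightarrow> b \<in> N \<Longrightarrow> a \<oplus> b \<in> N"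
    "\<And>c a. a \<in> N \<Longrightarrow> c \<odot> a \<in> N"
    using assms by (auto simp: submodule_iff)
  note N1 = N(1)[THEN subsetD]
  have "abelian_group (V\<lparr>carrier := N\<rparr>)"
  proof (rule abelian_groupI)
    fix x assume "x \<in> carrier (V\<lparr>carrier := N\<rparr>)"
    then have x: "x \<in> N" "x \<in> carrier V" using N1 by auto
    show "\<exists>y\<in>carrier (V\<lparr>carrier := N\<rparr>). y \<oplus>\<^bsub>V\<lparr>carrier := N\<rparr>\<^esub> x = \<zero>\<^bsub>V\<lparr>carrier := N\<rparr>\<^esub>"
      by (rule bexI[of _ "(- 1) \<odot> x"])
        (use N(4)[of x "- 1"] x smult_minus_one[OF x(2)] l_neg[OF x(2)] in simp_all)
  qed (use N N1 in \<open>auto simp: a_assoc intro: a_comm\<close>)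
  then show ?thesis
    unfolding cvs_def cvs_axioms_def using N N1
    by (auto simp: smult_l_distr smult_r_distr smult_assoc1)
qed

lemma lin_span_submodule: "S \<subseteq> carrier V \<Longrightarrow> submodule (lin_span V S) complex_alg V"
  unfolding lin_span_def submodule_iff by blast

lemma lin_span_minimal:
  "submodule N complex_alg V \<Longrightarrow> S \<subseteq> N \<Longrightarrow> lin_span V S \<subseteq> N"
  by (auto simp: lin_span_def)

lemma submodule_finsum:
  assumes "submodule N complex_alg V" "f \<in> I \<rightarrow> N"
  shows "finsum V f I \<in> N"
  using assms(2)
proof (induct I rule: infinite_finite_induct)
  case (insert x F)
  then show ?case
    using assms by (subst finsum_insert) (auto simp: submodule_iff Pi_def)
qed (use assms in \<open>auto simp: submodule_iff\<close>)

end

lemma lin_span_superset: "S \<subseteq> lin_span V S"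
  by (auto simp: lin_span_def)

lemma complex_alg_simps [simp]:
  "carrier complex_alg = UNIV" "monoid.mult complex_alg = (*)" "one complex_alg = 1"
  "ring.zero complex_alg = 0" "add complex_alg = (+)" "smult complex_alg = (*)"
  by (simp_all add: complex_alg_def)

lemma cring_complex_alg: "cring complex_alg"
proof (rule cringI)
  show "abelian_group complex_alg"
    by (rule abelian_groupI) (auto intro: exI[of _ "- x" for x])
  show "Group.comm_monoid complex_alg"
    by (rule comm_monoidI) auto
qed (auto simp: algebra_simps)

lemma module_complex_alg_iff: "Module.module complex_alg V \<longleftrightarrow> cvs V"
proof
  assume "Module.module complex_alg V"
  then interpret Module.module complex_alg V .
  show "cvs V"
    by unfold_locales
      (use smult_closed smult_l_distr smult_r_distr smult_assoc1 smult_one in auto)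
next
  assume "cvs V"
  then interpret cvs V .
  show "Module.module complex_alg V"
    by (rule moduleI[OF cring_complex_alg])
      (auto simp: smult_l_distr smult_r_distr smult_assoc1 abelian_group_axioms)
qed

lemma finsum_cong_simp:
  assumes "cvs V" "A = B" "\<And>i. i \<in> B \<Longrightarrow> g i \<in> carrier V" "\<And>i. i \<in> B \<Longrightarrow> f i = g i"
  shows "finsum V f A = finsum V g B"
proof -
  interpret cvs V by fact
  show ?thesis using assms by (intro finsum_cong') auto
qed

section \<open>Linear and bilinear maps\<close>

lemma linear_mapD:
  assumes "linear_map V W f"
  shows "x \<in> carrier V \<Longrightarrow> f x \<in> carrier W"
    "x \<in> carrier V \<Longrightarrow> y \<in> carrier V \<Longrightarrow> f (x \<oplus>\<^bsub>V\<^esub> y) = f x \<oplus>\<^bsub>W\<^esub> f y"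
    "x \<in> carrier V \<Longrightarrow> f (c \<odot>\<^bsub>V\<^esub> x) = c \<odot>\<^bsub>W\<^esub> f x"
  using assms by (auto simp: linear_map_def)

lemma linear_mapI:
  assumes "\<And>x. x \<in> carrier V \<Longrightarrow> f x \<in> carrier W"
    "\<And>x y. x \<in> carrier V \<Longrightarrow> y \<in> carrier V \<Longrightarrow> f (x \<oplus>\<^bsub>V\<^esub> y) = f x \<oplus>\<^bsub>W\<^esub> f y"
    "\<And>c x. x \<in> carrier V \<Longrightarrow> f (c \<odot>\<^bsub>V\<^esub> x) = c \<odot>\<^bsub>W\<^esub> f x"
  shows "linear_map V W f"
  using assms by (auto simp: linear_map_def)

lemma linear_map_compose:
  "linear_map V W f \<Longrightarrow> linear_map W U g \<Longrightarrow> linear_map V U (\<lambda>x. g (f x))"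
  by (auto simp: linear_map_def Pi_def)

lemma linear_map_zero:
  assumes "cvs V" "cvs W" "linear_map V W f"
  shows "f \<zero>\<^bsub>V\<^esub> = \<zero>\<^bsub>W\<^esub>"
proof -
  interpret V: cvs V by fact
  interpret W: cvs W by fact
  show ?thesis
    using linear_mapD(3)[OF assms(3), of "\<zero>\<^bsub>V\<^esub>" 0] linear_mapD(1)[OF assms(3)] by simp
qed

lemma linear_map_finsum:
  assumes "cvs V" "cvs W" "linear_map V W f" "g \<in> I \<rightarrow> carrier V"
  shows "f (\<Oplus>\<^bsub>V\<^esub>i\<in>I. g i) = (\<Oplus>\<^bsub>W\<^esub>i\<in>I. f (g i))"
proof -
  interpret V: cvs V by fact
  interpret W: cvs W by fact
  show ?thesis using assms(4)
  proof (induct I rule: infinite_finite_induct)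
    case (insert x F)
    then show ?case
      by (simp add: Pi_def linear_mapD[OF assms(3)])
  qed (auto simp: linear_map_zero[OF assms(1-3)])
qed

lemma linear_map_preimage:
  assumes "cvs V" "cvs W" "linear_map V W f" "submodule N complex_alg W"
  shows "submodule {v \<in> carrier V. f v \<in> N} complex_alg V"
proof -
  interpret V: cvs V by fact
  interpret W: cvs W by fact
  show ?thesis
    using assms(4) linear_map_zero[OF assms(1-3)]
    by (auto simp: V.submodule_iff W.submodule_iff linear_mapD[OF assms(3)])
qed

text \<open>A span is an intersection of submodules, so membership is transferred by minimality: the
  preimage of \<open>N\<close> is a submodule that contains \<open>S\<close>.\<close>

lemma linear_map_lin_span:
  assumes "cvs V" "cvs W" "linear_map V W f" "submodule N complex_alg W"
    "S \<subseteq> carrier V" "\<And>s. s \<in> S \<Longrightarrow> f s \<in> N" "v \<in> lin_span V S"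
  shows "f v \<in> N"
  using cvs.lin_span_minimal[OF assms(1) linear_map_preimage[OF assms(1-4)], of S] assms by auto

lemma linear_map_eq_on_span:
  assumes "cvs V" "cvs W" "linear_map V W f" "linear_map V W g"
    "S \<subseteq> carrier V" "\<And>s. s \<in> S \<Longrightarrow> f s = g s" "v \<in> lin_span V S"
  shows "f v = g v"
proof -
  interpret V: cvs V by fact
  interpret W: cvs W by fact
  have "submodule {v \<in> carrier V. f v = g v} complex_alg V"
    by (auto simp: V.submodule_iff linear_mapD[OF assms(3)] linear_mapD[OF assms(4)]
        linear_map_zero[OF assms(1-3)] linear_map_zero[OF assms(1,2,4)])
  from V.lin_span_minimal[OF this, of S] show ?thesis using assms by auto
qed

definition bilinear_map ::
    "(complex, 'a) module \<Rightarrow> (complex, 'b) module \<Rightarrow> (complex, 'c) module \<Rightarrow>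
     ('a \<Rightarrow> 'b \<Rightarrow> 'c) \<Rightarrow> bool" where
  "bilinear_map V W U \<beta> \<longleftrightarrow> (\<forall>a\<in>carrier V. linear_map W U (\<beta> a)) \<and>
     (\<forall>b\<in>carrier W. linear_map V U (\<lambda>a. \<beta> a b))"

lemma bilinear_mapD:
  assumes "bilinear_map V W U \<beta>"
  shows "b \<in> carrier W \<Longrightarrow> linear_map V U (\<lambda>a. \<beta> a b)"
    "a \<in> carrier V \<Longrightarrow> linear_map W U (\<beta> a)"
  using assms by (auto simp: bilinear_map_def)

subsection \<open>Quotients\<close>

context cvs
begin

lemma quot_alg_simps [simp]:
  "add (quot_alg V I) = set_add V" "ring.zero (quot_alg V I) = I"
  "carrier (quot_alg V I) = a_rcosets I"
  by (simp_all add: quot_alg_def FactRing_def)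

lemma submodule_abelian_subgroup:
  assumes "submodule I complex_alg V"
  shows "abelian_subgroup I V"
proof -
  interpret submodule I complex_alg V by fact
  show ?thesis by (intro abelian_subgroupI3 additive_subgroup.intro subgroup_axioms abelian_group_axioms)
qed

text \<open>The scalar action of \<open>quot_alg\<close> is a union over all representatives; it is
  a single coset because every representative contributes the same one.\<close>

lemma quot_smult:
  assumes "submodule I complex_alg V" "a \<in> carrier V"
  shows "c \<odot>\<^bsub>quot_alg V I\<^esub> (I +> a) = I +> c \<odot> a"
proof -
  interpret abelian_subgroup I V by (rule submodule_abelian_subgroup[OF assms(1)])
  have "I +> c \<odot> b = I +> c \<odot> a" if b: "b \<in> I +> a" for b
  proof -
    obtain i where i: "i \<in> I" "b = i \<oplus> a" using b unfolding a_r_coset_def' by blast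
    have "c \<odot> b = c \<odot> i \<oplus> c \<odot> a" using i assms(2) a_subset by (simp add: smult_r_distr subset_iff)
    moreover have "c \<odot> i \<in> I" using assms(1) i by (simp add: submodule_iff)
    ultimately have "c \<odot> b \<in> I +> c \<odot> a" unfolding a_r_coset_def' by blast
    then show ?thesis
      using a_repr_independence'[of "c \<odot> b" "c \<odot> a"] assms(2) by simp
  qed
  then have "(\<Union>b\<in>I +> a. I +> c \<odot> b) = (\<Union>b\<in>I +> a. I +> c \<odot> a)"
    by (rule SUP_cong[OF refl])
  moreover have "a \<in> I +> a" using a_rcos_self assms by auto
  ultimately show ?thesis unfolding quot_alg_def by auto
qed

lemma quot_add:
  assumes "submodule I complex_alg V" "a \<in> carrier V" "b \<in> carrier V"
  shows "(I +> a) \<oplus>\<^bsub>quot_alg V I\<^esub> (I +> b) = I +> (a \<oplus> b)"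
proof -
  interpret abelian_subgroup I V by (rule submodule_abelian_subgroup[OF assms(1)])
  show ?thesis using a_rcos_sum assms by simp
qed

lemma quot_zero:
  assumes "submodule I complex_alg V"
  shows "\<zero>\<^bsub>quot_alg V I\<^esub> = I +> \<zero>"
proof -
  interpret abelian_subgroup I V by (rule submodule_abelian_subgroup[OF assms(1)])
  show ?thesis using a_subset by simp
qed

lemma quot_carrier: "carrier (quot_alg V I) = (\<lambda>a. I +> a) ` carrier V"
  by (auto simp: A_RCOSETS_def')

lemma quot_cvs:
  assumes "submodule I complex_alg V"
  shows "cvs (quot_alg V I)"
proof -
  note s = quot_add[OF assms] quot_smult[OF assms]
  have z: "\<zero>\<^bsub>quot_alg V I\<^esub> = I +> \<zero>" by (rule quot_zero[OF assms])
  have "abelian_group (quot_alg V I)"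
  proof (rule abelian_groupI)
    fix x assume "x \<in> carrier (quot_alg V I)"
    then obtain a where "a \<in> carrier V" "x = I +> a" by (auto simp: quot_carrier simp del: quot_alg_simps)
    then show "\<exists>y\<in>carrier (quot_alg V I). y \<oplus>\<^bsub>quot_alg V I\<^esub> x = \<zero>\<^bsub>quot_alg V I\<^esub>"
      by (auto simp: quot_carrier z s l_neg simp del: quot_alg_simps intro!: bexI[of _ "\<ominus> a"])
    next
    fix x y assume "x \<in> carrier (quot_alg V I)" "y \<in> carrier (quot_alg V I)"
    then show "x \<oplus>\<^bsub>quot_alg V I\<^esub> y = y \<oplus>\<^bsub>quot_alg V I\<^esub> x"
    proof -
      assume "x \<in> carrier (quot_alg V I)" "y \<in> carrier (quot_alg V I)"
      then obtain a b where "a \<in> carrier V" "x = I +> a" "b \<in> carrier V" "y = I +> b"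
        unfolding quot_carrier by blast
      then show ?thesis using s(1)[of a b] s(1)[of b a] a_comm[of a b] by (simp del: quot_alg_simps)
    qed
  qed (auto simp: quot_carrier z s a_assoc simp del: quot_alg_simps)
  then show ?thesis
    unfolding cvs_def cvs_axioms_def
    by (auto simp: quot_carrier z s smult_r_distr smult_l_distr smult_assoc1 simp del: quot_alg_simps)
qed

lemma quot_linear_map: "submodule I complex_alg V \<Longrightarrow> linear_map V (quot_alg V I) (\<lambda>a. I +> a)"
  by (rule linear_mapI) (auto simp: quot_carrier quot_add quot_smult simp del: quot_alg_simps)

lemma quot_eq_iff:
  assumes "submodule I complex_alg V" "a \<in> carrier V" "b \<in> carrier V"
  shows "I +> a = I +> b \<longleftrightarrow> a \<ominus> b \<in> I"
proof -
  interpret abelian_subgroup I V by (rule submodule_abelian_subgroup[OF assms(1)])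
  have "a \<in> I +> b \<longleftrightarrow> I +> a = I +> b"
    using a_rcos_self[OF assms(2)] a_repr_independence'[of a b] assms by (metis (no_types))
  moreover have "a \<in> I +> b \<longleftrightarrow> a \<ominus> b \<in> I"
    using a_rcos_module_minus[of b a] a_rcos_module[of b a] assms abelian_group_axioms
    by (simp add: a_minus_def)
  ultimately show ?thesis by simp
qed

text \<open>For the maps \<open>tensor_lift\<close> and \<open>gen_hom\<close>, which are computed
  on a representative picked by \<open>SOME\<close>.\<close>

lemma quot_some:
  assumes "submodule I complex_alg V" "a \<in> carrier V"
  shows "(SOME x. x \<in> I +> a) \<in> carrier V" "I +> (SOME x. x \<in> I +> a) = I +> a"
proof -
  interpret abelian_subgroup I V by (rule submodule_abelian_subgroup[OF assms(1)])
  have s: "(SOME x. x \<in> I +> a) \<in> I +> a"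
    by (rule someI[of _ a]) (use a_rcos_self[OF assms(2)] in auto)
  then show c: "(SOME x. x \<in> I +> a) \<in> carrier V"
    using a_elemrcos_carrier assms by blast
  show "I +> (SOME x. x \<in> I +> a) = I +> a"
    using a_repr_independence'[OF s assms(2)] by simp
qed

end

subsection \<open>Tensor products of vector spaces\<close>

abbreviation keys :: "('a \<Rightarrow>\<^sub>0 'b::zero) \<Rightarrow> 'a set" where
  "keys \<equiv> Poly_Mapping.keys"

abbreviation lookup :: "('a \<Rightarrow>\<^sub>0 'b::zero) \<Rightarrow> 'a \<Rightarrow> 'b" where
  "lookup \<equiv> Poly_Mapping.lookup"

lemma lookup_pm_scale [simp]: "lookup (pm_scale c f) k = c * lookup f k"
  unfolding pm_scale_def by (transfer) (auto simp: when_def)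

lemma pm_scale_add: "pm_scale c (f + g) = pm_scale c f + pm_scale c g"
  "pm_scale (a + b) f = pm_scale a f + pm_scale b f"
  "pm_scale (a * b) f = pm_scale a (pm_scale b f)" "pm_scale 1 f = f"
  by (rule poly_mapping_eqI; simp add: lookup_add algebra_simps)+

lemma pm_scale_single [simp]: "pm_scale c (Poly_Mapping.single k d) = Poly_Mapping.single k (c * d)"
  by (rule poly_mapping_eqI) (simp add: lookup_single when_def)

lemma keys_pm_scale: "keys (pm_scale c f) \<subseteq> keys f"
  by (auto simp: in_keys_iff)

lemma pm_scale_minus_one: "pm_scale (- 1) f = - f"
  by (rule poly_mapping_eqI) simp

lemma pair_alg_simps [simp]:
  "carrier (pair_alg V W) = {f. keys f \<subseteq> carrier V \<times> carrier W}"
  "add (pair_alg V W) = (+)" "ring.zero (pair_alg V W) = 0" "smult (pair_alg V W) = pm_scale"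
  "one (pair_alg V W) = basis_pair (one V) (one W)"
  by (simp_all add: pair_alg_def)

lemma pair_alg_cvs: "cvs (pair_alg V W)"
proof -
  have "abelian_group (pair_alg V W)"
  proof (rule abelian_groupI)
    fix f assume "f \<in> carrier (pair_alg V W)"
    then show "\<exists>g\<in>carrier (pair_alg V W). g \<oplus>\<^bsub>pair_alg V W\<^esub> f = \<zero>\<^bsub>pair_alg V W\<^esub>"
      by (auto intro!: exI[of _ "- f"])
  next
    fix f g assume "f \<in> carrier (pair_alg V W)" "g \<in> carrier (pair_alg V W)"
    then show "f \<oplus>\<^bsub>pair_alg V W\<^esub> g \<in> carrier (pair_alg V W)"
      using keys_add[of f g] by auto
  qed (auto simp: algebra_simps)
  then show ?thesis
    unfolding cvs_def cvs_axioms_def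
    by (auto simp: pm_scale_add dest!: keys_pm_scale[THEN subsetD])
qed

lemma pair_alg_minus:
  assumes "f \<in> carrier (pair_alg V W)" "g \<in> carrier (pair_alg V W)"
  shows "f \<ominus>\<^bsub>pair_alg V W\<^esub> g = f - g"
proof -
  interpret cvs "pair_alg V W" by (rule pair_alg_cvs)
  have "\<ominus>\<^bsub>pair_alg V W\<^esub> g = - g"
    using smult_minus_one[of g] assms(2) by (simp add: pm_scale_minus_one)
  then show ?thesis by (simp add: a_minus_def)
qed

lemma poly_mapping_sum_singles: "f = (\<Sum>p\<in>keys f. Poly_Mapping.single p (lookup f p))"
  by (rule poly_mapping_eqI)
    (simp add: lookup_sum lookup_single when_def in_keys_iff sum.delta)


text \<open>The generating set spelled out in \<open>tensor_null\<close>, named so that its four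
  kinds of elements can be treated case by case.\<close>

definition tensor_gens ::
    "(complex, 'a) module \<Rightarrow> (complex, 'b) module \<Rightarrow> (('a \<times> 'b) \<Rightarrow>\<^sub>0 complex) set" where
  "tensor_gens V W =
     ({basis_pair (a \<oplus>\<^bsub>V\<^esub> a') b - basis_pair a b - basis_pair a' b | a a' b.
         a \<in> carrier V \<and> a' \<in> carrier V \<and> b \<in> carrier W} \<union>
      {basis_pair a (b \<oplus>\<^bsub>W\<^esub> b') - basis_pair a b - basis_pair a b' | a b b'.
         a \<in> carrier V \<and> b \<in> carrier W \<and> b' \<in> carrier W} \<union>
      {basis_pair (c \<odot>\<^bsub>V\<^esub> a) b - pm_scale c (basis_pair a b) | c a b.
         a \<in> carrier V \<and> b \<in> carrier W} \<union>
      {basis_pair a (c \<odot>\<^bsub>W\<^esub> b) - pm_scale c (basis_pair a b) | c a b.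
         a \<in> carrier V \<and> b \<in> carrier W})"

lemma tensor_gens_cases:
  assumes "g \<in> tensor_gens V W"
  obtains a a' b where "a \<in> carrier V" "a' \<in> carrier V" "b \<in> carrier W"
        "g = basis_pair (a \<oplus>\<^bsub>V\<^esub> a') b - basis_pair a b - basis_pair a' b"
      | a b b' where "a \<in> carrier V" "b \<in> carrier W" "b' \<in> carrier W"
        "g = basis_pair a (b \<oplus>\<^bsub>W\<^esub> b') - basis_pair a b - basis_pair a b'"
      | a b c where "a \<in> carrier V" "b \<in> carrier W"
        "g = basis_pair (c \<odot>\<^bsub>V\<^esub> a) b - pm_scale c (basis_pair a b)"
      | a b c where "a \<in> carrier V" "b \<in> carrier W"
        "g = basis_pair a (c \<odot>\<^bsub>W\<^esub> b) - pm_scale c (basis_pair a b)"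
  using assms unfolding tensor_gens_def Un_iff mem_Collect_eq by (elim disjE exE conjE) metis+

lemma tensor_null_eq: "tensor_null V W = lin_span (pair_alg V W) (tensor_gens V W)"
  unfolding tensor_null_def tensor_gens_def ..

text \<open>Serves for pairs, where it induces maps out of tensor products, and for words, where it
  is evaluation of free polynomials.\<close>

definition lin_ext :: "(complex, 'u) module \<Rightarrow> ('i \<Rightarrow> 'u) \<Rightarrow> ('i \<Rightarrow>\<^sub>0 complex) \<Rightarrow> 'u" where
  "lin_ext U \<phi> f = (\<Oplus>\<^bsub>U\<^esub>p\<in>keys f. lookup f p \<odot>\<^bsub>U\<^esub> \<phi> p)"

lemma lin_ext_superset:
  assumes "cvs U" "finite A" "keys f \<subseteq> A" "\<phi> \<in> A \<rightarrow> carrier U"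
  shows "lin_ext U \<phi> f = (\<Oplus>\<^bsub>U\<^esub>p\<in>A. lookup f p \<odot>\<^bsub>U\<^esub> \<phi> p)"
proof -
  interpret cvs U by fact
  show ?thesis
    unfolding lin_ext_def by (rule finsum_neutral_superset) (use assms in \<open>auto simp: in_keys_iff Pi_iff\<close>)
qed

lemma lin_ext_closed:
  assumes "cvs U" "\<phi> \<in> keys f \<rightarrow> carrier U"
  shows "lin_ext U \<phi> f \<in> carrier U"
proof -
  interpret cvs U by fact
  show ?thesis unfolding lin_ext_def using assms(2) by (intro finsum_closed) auto
qed

lemma lin_ext_pm_scale:
  assumes "cvs U" "\<phi> \<in> keys f \<rightarrow> carrier U"
  shows "lin_ext U \<phi> (pm_scale c f) = c \<odot>\<^bsub>U\<^esub> lin_ext U \<phi> f"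
proof -
  interpret cvs U by fact
  have "lin_ext U \<phi> (pm_scale c f) = (\<Oplus>\<^bsub>U\<^esub>p\<in>keys f. (c * lookup f p) \<odot>\<^bsub>U\<^esub> \<phi> p)"
    by (subst lin_ext_superset[OF assms(1), of "keys f"])
      (use assms(2) keys_pm_scale[THEN subsetD] in auto)
  also have "\<dots> = (\<Oplus>\<^bsub>U\<^esub>p\<in>keys f. c \<odot>\<^bsub>U\<^esub> (lookup f p \<odot>\<^bsub>U\<^esub> \<phi> p))"
    by (intro finsum_cong') (use assms(2) in \<open>auto simp: smult_assoc1 Pi_iff\<close>)
  finally show ?thesis
    unfolding lin_ext_def using assms(2) by (subst smult_finsum) auto
qed

lemma lin_ext_add:
  assumes "cvs U" "\<phi> \<in> keys f \<union> keys g \<rightarrow> carrier U"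
  shows "lin_ext U \<phi> (f + g) = lin_ext U \<phi> f \<oplus>\<^bsub>U\<^esub> lin_ext U \<phi> g"
proof -
  interpret cvs U by fact
  have "lin_ext U \<phi> (f + g) =
     (\<Oplus>\<^bsub>U\<^esub>p\<in>keys f \<union> keys g. (lookup f p + lookup g p) \<odot>\<^bsub>U\<^esub> \<phi> p)"
    by (subst lin_ext_superset[OF assms(1), of "keys f \<union> keys g"])
      (use assms(2) keys_add[of f g] in \<open>auto simp: lookup_add\<close>)
  also have "\<dots> = (\<Oplus>\<^bsub>U\<^esub>p\<in>keys f \<union> keys g. lookup f p \<odot>\<^bsub>U\<^esub> \<phi> p \<oplus>\<^bsub>U\<^esub> lookup g p \<odot>\<^bsub>U\<^esub> \<phi> p)"
    by (intro finsum_cong') (use assms(2) in \<open>auto simp: smult_l_distr Pi_iff\<close>)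
  also have "\<dots> = lin_ext U \<phi> f \<oplus>\<^bsub>U\<^esub> lin_ext U \<phi> g"
    using assms(2) lin_ext_superset[OF assms(1), of "keys f \<union> keys g" f \<phi>]
      lin_ext_superset[OF assms(1), of "keys f \<union> keys g" g \<phi>]
    by (subst finsum_addf) auto
  finally show ?thesis .
qed

lemma lin_ext_single:
  assumes "cvs U" "\<phi> p \<in> carrier U"
  shows "lin_ext U \<phi> (Poly_Mapping.single p c) = c \<odot>\<^bsub>U\<^esub> \<phi> p"
proof -
  interpret cvs U by fact
  show ?thesis using assms by (simp add: lin_ext_def)
qed

abbreviation pair_ext :: "(complex, 'u) module \<Rightarrow> ('a \<Rightarrow> 'b \<Rightarrow> 'u) \<Rightarrow> (('a \<times> 'b) \<Rightarrow>\<^sub>0 complex) \<Rightarrow> 'u" where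
  "pair_ext U \<beta> \<equiv> lin_ext U (\<lambda>p. \<beta> (fst p) (snd p))"

lemma pair_ext_linear:
  assumes "cvs U" "\<And>a b. a \<in> carrier V \<Longrightarrow> b \<in> carrier W \<Longrightarrow> \<beta> a b \<in> carrier U"
  shows "linear_map (pair_alg V W) U (pair_ext U \<beta>)"
proof -
  have b: "(\<lambda>p. \<beta> (fst p) (snd p)) \<in> keys f \<rightarrow> carrier U" if "f \<in> carrier (pair_alg V W)" for f
    using that assms(2) by (auto simp: subset_iff)
  show ?thesis
    by (rule linear_mapI, unfold pair_alg_simps(2,4); intro lin_ext_closed lin_ext_pm_scale lin_ext_add assms(1))
      (use b in \<open>auto simp: Pi_iff\<close>)
qed

lemma pair_ext_basis [simp]:
  assumes "cvs U" "\<beta> a b \<in> carrier U"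
  shows "pair_ext U \<beta> (basis_pair a b) = \<beta> a b"
proof -
  interpret cvs U by fact
  show ?thesis using assms by (simp add: lin_ext_single)
qed

lemma pair_alg_span:
  "lin_span (pair_alg V W) {basis_pair a b | a b. a \<in> carrier V \<and> b \<in> carrier W} =
   carrier (pair_alg V W)" (is "lin_span ?P ?S = _")
proof -
  interpret cvs ?P by (rule pair_alg_cvs)
  have S: "?S \<subseteq> carrier ?P" by auto
  have sub: "submodule (lin_span ?P ?S) complex_alg ?P" by (rule lin_span_submodule[OF S])
  have "f \<in> lin_span ?P ?S" if f: "f \<in> carrier ?P" for f
  proof -
    have s: "Poly_Mapping.single p c \<in> lin_span ?P ?S" if p: "p \<in> carrier V \<times> carrier W" for p c
    proof -
      have "basis_pair (fst p) (snd p) \<in> lin_span ?P ?S"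
        using lin_span_superset[of ?S ?P] p by force
      then have "pm_scale c (basis_pair (fst p) (snd p)) \<in> lin_span ?P ?S"
        using sub unfolding submodule_iff pair_alg_simps by meson
      then show ?thesis by (simp only: pm_scale_single prod.collapse mult_1_right)
    qed
    have "(\<Sum>p\<in>A. Poly_Mapping.single p (lookup f p)) \<in> lin_span ?P ?S"
      if "finite A" "A \<subseteq> keys f" for A
      using that
    proof (induct A)
      case empty
      then show ?case using sub by (auto simp: submodule_iff)
    next
      case (insert p A)
      then show ?case using sub s[of p] f by (auto simp: submodule_iff)
    qed
    from this[of "keys f"] show ?thesis by (simp flip: poly_mapping_sum_singles)
  qed
  then show ?thesis using lin_span_minimal[OF submodule_carrier S] by auto
qed

section \<open>Bilinearity and universal property of the tensor product\<close>

locale tensor_pair = V: cvs V + W: cvs W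
  for V :: "(complex, 'a) module" and W :: "(complex, 'b) module"
begin

sublocale P: cvs "pair_alg V W"
  by (rule pair_alg_cvs)

lemma gens_carrier: "tensor_gens V W \<subseteq> carrier (pair_alg V W)"
proof -
  note P.a_closed P.minus_closed
  have m: "f - g \<in> carrier (pair_alg V W)" if "f \<in> carrier (pair_alg V W)" "g \<in> carrier (pair_alg V W)" for f g
    using that by (metis P.minus_closed pair_alg_minus)
  have s: "Poly_Mapping.single (a, b) c \<in> carrier (pair_alg V W)" if "a \<in> carrier V" "b \<in> carrier W" for a b c
    using that by auto
  show ?thesis
  proof
    fix g assume "g \<in> tensor_gens V W"
    then show "g \<in> carrier (pair_alg V W)"
    proof (cases rule: tensor_gens_cases)
      case 1
      then show ?thesis by (simp only: m s V.a_closed)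
    next
      case 2
      then show ?thesis by (simp only: m s W.a_closed)
    next
      case 3
      then show ?thesis by (simp only: pm_scale_single m s V.smult_closed)
    next
      case 4
      then show ?thesis by (simp only: pm_scale_single m s W.smult_closed)
    qed
  qed
qed

lemma null_submodule: "submodule (tensor_null V W) complex_alg (pair_alg V W)"
  unfolding tensor_null_eq by (rule P.lin_span_submodule[OF gens_carrier])

sublocale T: cvs "tensor V W"
  unfolding tensor_def by (rule P.quot_cvs[OF null_submodule])

lemma ten_closed [simp]: "a \<in> carrier V \<Longrightarrow> b \<in> carrier W \<Longrightarrow> ten V W a b \<in> carrier (tensor V W)"
  unfolding tensor_def ten_def by (rule linear_mapD(1)[OF P.quot_linear_map[OF null_submodule]]) auto

lemma ten_relI:
  assumes "f - g \<in> tensor_gens V W" "f \<in> carrier (pair_alg V W)" "g \<in> carrier (pair_alg V W)"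
  shows "tensor_null V W +>\<^bsub>pair_alg V W\<^esub> f = tensor_null V W +>\<^bsub>pair_alg V W\<^esub> g"
proof -
  have "f - g \<in> tensor_null V W"
    unfolding tensor_null_eq using assms(1) lin_span_superset[THEN subsetD] by metis
  then show ?thesis
    using P.quot_eq_iff[OF null_submodule assms(2,3)] pair_alg_minus[OF assms(2,3)] by simp
qed

lemma single_closed: "a \<in> carrier V \<Longrightarrow> b \<in> carrier W \<Longrightarrow> Poly_Mapping.single (a, b) c \<in> carrier (pair_alg V W)"
  by auto

lemma ten_add_left:
  assumes "a \<in> carrier V" "a' \<in> carrier V" "b \<in> carrier W"
  shows "ten V W (a \<oplus>\<^bsub>V\<^esub> a') b = ten V W a b \<oplus>\<^bsub>tensor V W\<^esub> ten V W a' b"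
proof -
  have "basis_pair (a \<oplus>\<^bsub>V\<^esub> a') b - (basis_pair a b + basis_pair a' b) \<in> tensor_gens V W"
    unfolding tensor_gens_def diff_diff_add[symmetric] using assms by blast
  then show ?thesis
    unfolding ten_def tensor_def
    using ten_relI[of "basis_pair (a \<oplus>\<^bsub>V\<^esub> a') b" "basis_pair a b + basis_pair a' b"] assms
      P.a_closed[of "basis_pair a b" "basis_pair a' b"]
    by (subst P.quot_add[OF null_submodule]) auto
qed

lemma ten_add_right:
  assumes "a \<in> carrier V" "b \<in> carrier W" "b' \<in> carrier W"
  shows "ten V W a (b \<oplus>\<^bsub>W\<^esub> b') = ten V W a b \<oplus>\<^bsub>tensor V W\<^esub> ten V W a b'"
proof -
  have "basis_pair a (b \<oplus>\<^bsub>W\<^esub> b') - (basis_pair a b + basis_pair a b') \<in> tensor_gens V W"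
    unfolding tensor_gens_def diff_diff_add[symmetric] using assms by blast
  then show ?thesis
    unfolding ten_def tensor_def
    using ten_relI[of "basis_pair a (b \<oplus>\<^bsub>W\<^esub> b')" "basis_pair a b + basis_pair a b'"] assms
      P.a_closed[of "basis_pair a b" "basis_pair a b'"]
    by (subst P.quot_add[OF null_submodule]) auto
qed

lemma ten_smult_left:
  assumes "a \<in> carrier V" "b \<in> carrier W"
  shows "ten V W (c \<odot>\<^bsub>V\<^esub> a) b = c \<odot>\<^bsub>tensor V W\<^esub> ten V W a b"
proof -
  have "basis_pair (c \<odot>\<^bsub>V\<^esub> a) b - pm_scale c (basis_pair a b) \<in> tensor_gens V W"
    unfolding tensor_gens_def using assms by blast
  then show ?thesis
    unfolding ten_def tensor_def
    using ten_relI[of "basis_pair (c \<odot>\<^bsub>V\<^esub> a) b" "pm_scale c (basis_pair a b)"] assms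
    by (subst P.quot_smult[OF null_submodule]) auto
qed

lemma ten_smult_right:
  assumes "a \<in> carrier V" "b \<in> carrier W"
  shows "ten V W a (c \<odot>\<^bsub>W\<^esub> b) = c \<odot>\<^bsub>tensor V W\<^esub> ten V W a b"
proof -
  have "basis_pair a (c \<odot>\<^bsub>W\<^esub> b) - pm_scale c (basis_pair a b) \<in> tensor_gens V W"
    unfolding tensor_gens_def using assms by blast
  then show ?thesis
    unfolding ten_def tensor_def
    using ten_relI[of "basis_pair a (c \<odot>\<^bsub>W\<^esub> b)" "pm_scale c (basis_pair a b)"] assms
    by (subst P.quot_smult[OF null_submodule]) auto
qed

lemma ten_bilinear: "bilinear_map V W (tensor V W) (ten V W)"
  unfolding bilinear_map_def
  by (auto intro!: linear_mapI simp: ten_add_left ten_add_right ten_smult_left ten_smult_right)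

lemma tensor_carrier:
  "carrier (tensor V W) = (\<lambda>f. tensor_null V W +>\<^bsub>pair_alg V W\<^esub> f) ` carrier (pair_alg V W)"
  unfolding tensor_def by (rule P.quot_carrier)

lemma cls_linear: "linear_map (pair_alg V W) (tensor V W) (\<lambda>f. tensor_null V W +>\<^bsub>pair_alg V W\<^esub> f)"
  unfolding tensor_def by (rule P.quot_linear_map[OF null_submodule])

lemma tensor_span:
  "lin_span (tensor V W) {ten V W a b | a b. a \<in> carrier V \<and> b \<in> carrier W} = carrier (tensor V W)"
  (is "lin_span _ ?S = _")
proof
  have S: "?S \<subseteq> carrier (tensor V W)" by auto
  then show "lin_span (tensor V W) ?S \<subseteq> carrier (tensor V W)"
    by (rule T.lin_span_minimal[OF T.submodule_carrier])
  show "carrier (tensor V W) \<subseteq> lin_span (tensor V W) ?S"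
  proof
    fix x assume "x \<in> carrier (tensor V W)"
    then obtain f where f: "f \<in> carrier (pair_alg V W)" "x = tensor_null V W +>\<^bsub>pair_alg V W\<^esub> f"
      unfolding tensor_carrier by auto
    show "x \<in> lin_span (tensor V W) ?S"
      unfolding f(2)
    proof (rule linear_map_lin_span[OF P.cvs_axioms T.cvs_axioms cls_linear])
      show "f \<in> lin_span (pair_alg V W) {basis_pair a b | a b. a \<in> carrier V \<and> b \<in> carrier W}"
        using f pair_alg_span by metis
    next
      show "submodule (lin_span (tensor V W) ?S) complex_alg (tensor V W)"
        by (rule T.lin_span_submodule[OF S])
    next
      fix s assume "s \<in> {basis_pair a b | a b. a \<in> carrier V \<and> b \<in> carrier W}"
      then have "tensor_null V W +>\<^bsub>pair_alg V W\<^esub> s \<in> ?S" by (auto simp: ten_def)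
      then show "tensor_null V W +>\<^bsub>pair_alg V W\<^esub> s \<in> lin_span (tensor V W) ?S"
        by (rule lin_span_superset[THEN subsetD])
    qed auto
  qed
qed

text \<open>The uniqueness half of the universal property: pure tensors span.\<close>

lemma tensor_linear_eq:
  assumes "cvs U" "linear_map (tensor V W) U f" "linear_map (tensor V W) U g"
    "\<And>a b. a \<in> carrier V \<Longrightarrow> b \<in> carrier W \<Longrightarrow> f (ten V W a b) = g (ten V W a b)"
    "t \<in> carrier (tensor V W)"
  shows "f t = g t"
  by (rule linear_map_eq_on_span[OF T.cvs_axioms assms(1-3),
        of "{ten V W a b | a b. a \<in> carrier V \<and> b \<in> carrier W}"])
    (use assms(4,5) tensor_span in auto)

context
  fixes U :: "(complex, 'u) module" and \<beta> :: "'a \<Rightarrow> 'b \<Rightarrow> 'u"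
  assumes U: "cvs U" and \<beta>: "bilinear_map V W U \<beta>"
begin

interpretation U: cvs U by (rule U)

lemma beta_closed: "a \<in> carrier V \<Longrightarrow> b \<in> carrier W \<Longrightarrow> \<beta> a b \<in> carrier U"
  by (rule linear_mapD(1)[OF bilinear_mapD(2)[OF \<beta>]])

lemma pair_ext_lin: "linear_map (pair_alg V W) U (pair_ext U \<beta>)"
  by (rule pair_ext_linear[OF U beta_closed])

text \<open>Each kind of generator encodes one instance of additivity or homogeneity of
  \<open>\<beta>\<close> in one argument, so bilinearity kills the generators, and linearity kills
  their span.\<close>

lemma pair_ext_null:
  assumes "f \<in> tensor_null V W"
  shows "pair_ext U \<beta> f = \<zero>\<^bsub>U\<^esub>"
proof -
  note L = linear_mapD[OF pair_ext_lin]
  have diff: "pair_ext U \<beta> (f - g) = pair_ext U \<beta> f \<ominus>\<^bsub>U\<^esub> pair_ext U \<beta> g"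
    if "f \<in> carrier (pair_alg V W)" "g \<in> carrier (pair_alg V W)" for f g
  proof -
    have "f - g = f \<oplus>\<^bsub>pair_alg V W\<^esub> ((-1) \<odot>\<^bsub>pair_alg V W\<^esub> g)"
      by (simp add: pm_scale_minus_one)
    moreover have "(-1) \<odot>\<^bsub>pair_alg V W\<^esub> g \<in> carrier (pair_alg V W)"
      using that by (intro P.smult_closed)
    ultimately show ?thesis
      using that by (simp only: L U.smult_minus_one) (simp add: a_minus_def)
  qed
  have e: "pair_ext U \<beta> (basis_pair a b) = \<beta> a b" if "a \<in> carrier V" "b \<in> carrier W" for a b
    using that U beta_closed by simp
  note S = linear_mapD[OF bilinear_mapD(1)[OF \<beta>]] linear_mapD[OF bilinear_mapD(2)[OF \<beta>]]
  have z: "x \<ominus>\<^bsub>U\<^esub> y \<ominus>\<^bsub>U\<^esub> z = \<zero>\<^bsub>U\<^esub>" if "x = y \<oplus>\<^bsub>U\<^esub> z" "y \<in> carrier U" "z \<in> carrier U" for x y z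
    using that by (simp add: a_minus_def U.a_assoc[of "y \<oplus>\<^bsub>U\<^esub> z"] U.minus_add[symmetric] U.r_neg)
  have z2: "x \<ominus>\<^bsub>U\<^esub> x = \<zero>\<^bsub>U\<^esub>" if "x \<in> carrier U" for x
    using that by (simp add: a_minus_def U.r_neg)
  have m: "f - g \<in> carrier (pair_alg V W)" if "f \<in> carrier (pair_alg V W)" "g \<in> carrier (pair_alg V W)" for f g
    using that by (metis P.minus_closed pair_alg_minus)
  have sm: "pair_ext U \<beta> (pm_scale c f) = c \<odot>\<^bsub>U\<^esub> pair_ext U \<beta> f" if "f \<in> carrier (pair_alg V W)" for c f
    using L(3)[of f c] that by simp
  have sc: "pm_scale c f \<in> carrier (pair_alg V W)" if "f \<in> carrier (pair_alg V W)" for c f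
    using P.smult_closed[of f c] that by simp
  note R = diff e m single_closed sm sc S beta_closed
  have "pair_ext U \<beta> g = \<zero>\<^bsub>U\<^esub>" if "g \<in> tensor_gens V W" for g
    using that
  proof (cases rule: tensor_gens_cases)
    case (1 a a' b)
    then show ?thesis by (simp only: R V.a_closed) (rule z; simp only: R)
  next
    case (2 a b b')
    then show ?thesis by (simp only: R W.a_closed) (rule z; simp only: R)
  next
    case (3 a b c)
    then show ?thesis by (simp only: R V.smult_closed) (rule z2; simp only: R U.smult_closed)
  next
    case (4 a b c)
    then show ?thesis by (simp only: R W.smult_closed) (rule z2; simp only: R U.smult_closed)
  qed
  moreover have "submodule {\<zero>\<^bsub>U\<^esub>} complex_alg U"
    by (simp add: U.submodule_iff)
  ultimately have "pair_ext U \<beta> f \<in> {\<zero>\<^bsub>U\<^esub>}"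
    using linear_map_lin_span[OF P.cvs_axioms U pair_ext_lin _ gens_carrier, of "{\<zero>\<^bsub>U\<^esub>}" f]
      assms[unfolded tensor_null_eq] by (metis singletonI)
  then show ?thesis by simp
qed

text \<open>Two representatives differ by an element of the null space, where the extension
  vanishes; hence the arbitrary choice inside \<open>tensor_lift\<close> does not affect the
  value.\<close>

lemma pair_ext_cls:
  assumes "f \<in> carrier (pair_alg V W)"
  shows "tensor_lift U \<beta> (tensor_null V W +>\<^bsub>pair_alg V W\<^esub> f) = pair_ext U \<beta> f"
proof -
  define g where "g = (SOME g. g \<in> tensor_null V W +>\<^bsub>pair_alg V W\<^esub> f)"
  have g: "g \<in> carrier (pair_alg V W)"
    "tensor_null V W +>\<^bsub>pair_alg V W\<^esub> g = tensor_null V W +>\<^bsub>pair_alg V W\<^esub> f"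
    using P.quot_some[OF null_submodule assms] unfolding g_def by auto
  then have n: "g - f \<in> tensor_null V W"
    using P.quot_eq_iff[OF null_submodule g(1) assms] pair_alg_minus[OF g(1) assms] by simp
  then have "g - f \<in> carrier (pair_alg V W)"
    using null_submodule unfolding P.submodule_iff by (metis subsetD)
  then have "pair_ext U \<beta> (f \<oplus>\<^bsub>pair_alg V W\<^esub> (g - f)) = pair_ext U \<beta> f"
    using linear_mapD(2)[OF pair_ext_lin assms] linear_mapD(1)[OF pair_ext_lin assms]
      pair_ext_null[OF n] by (simp del: pair_alg_simps)
  then have "pair_ext U \<beta> g = pair_ext U \<beta> f" by simp
  then show ?thesis
    by (simp add: tensor_lift_def Let_def flip: g_def lin_ext_def)
qed

lemma tensor_lift_linear: "linear_map (tensor V W) U (tensor_lift U \<beta>)"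
proof (rule linear_mapI)
  note L = linear_mapD[OF pair_ext_lin] and C = linear_mapD[OF cls_linear]
  fix x c assume "x \<in> carrier (tensor V W)"
  then obtain f where f: "f \<in> carrier (pair_alg V W)" "x = tensor_null V W +>\<^bsub>pair_alg V W\<^esub> f"
    unfolding tensor_carrier by auto
  show "tensor_lift U \<beta> x \<in> carrier U"
    using L(1)[OF f(1)] pair_ext_cls[OF f(1)] f(2) by simp
  show "tensor_lift U \<beta> (c \<odot>\<^bsub>tensor V W\<^esub> x) = c \<odot>\<^bsub>U\<^esub> tensor_lift U \<beta> x"
    unfolding f(2) using f(1) by (simp only: C(3)[symmetric] pair_ext_cls P.smult_closed L)
  fix y assume "y \<in> carrier (tensor V W)"
  then obtain g where g: "g \<in> carrier (pair_alg V W)" "y = tensor_null V W +>\<^bsub>pair_alg V W\<^esub> g"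
    unfolding tensor_carrier by auto
  show "tensor_lift U \<beta> (x \<oplus>\<^bsub>tensor V W\<^esub> y) = tensor_lift U \<beta> x \<oplus>\<^bsub>U\<^esub> tensor_lift U \<beta> y"
    unfolding f(2) g(2) using f(1) g(1) by (simp only: C(2)[symmetric] pair_ext_cls P.a_closed L)
qed

lemma tensor_lift_ten:
  "a \<in> carrier V \<Longrightarrow> b \<in> carrier W \<Longrightarrow> tensor_lift U \<beta> (ten V W a b) = \<beta> a b"
  unfolding ten_def by (subst pair_ext_cls) (auto simp: U beta_closed)

end

end

section \<open>Complex algebras\<close>

locale calg = cvs A + ring A for A :: "(complex, 'a) module" (structure) +
  assumes smult_mult_left: "x \<in> carrier A \<Longrightarrow> y \<in> carrier A \<Longrightarrow> (c \<odot> x) \<otimes> y = c \<odot> (x \<otimes> y)"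
    and smult_mult_right: "x \<in> carrier A \<Longrightarrow> y \<in> carrier A \<Longrightarrow> x \<otimes> (c \<odot> y) = c \<odot> (x \<otimes> y)"

lemma calgI:
  assumes "cvs A"
    and "\<one>\<^bsub>A\<^esub> \<in> carrier A"
    and "\<And>x y. x \<in> carrier A \<Longrightarrow> y \<in> carrier A \<Longrightarrow> x \<otimes>\<^bsub>A\<^esub> y \<in> carrier A"
    and "\<And>x y z. x \<in> carrier A \<Longrightarrow> y \<in> carrier A \<Longrightarrow> z \<in> carrier A \<Longrightarrow>
      (x \<otimes>\<^bsub>A\<^esub> y) \<otimes>\<^bsub>A\<^esub> z = x \<otimes>\<^bsub>A\<^esub> (y \<otimes>\<^bsub>A\<^esub> z)"
    and "\<And>x. x \<in> carrier A \<Longrightarrow> \<one>\<^bsub>A\<^esub> \<otimes>\<^bsub>A\<^esub> x = x"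
    and "\<And>x. x \<in> carrier A \<Longrightarrow> x \<otimes>\<^bsub>A\<^esub> \<one>\<^bsub>A\<^esub> = x"
    and "\<And>x y z. x \<in> carrier A \<Longrightarrow> y \<in> carrier A \<Longrightarrow> z \<in> carrier A \<Longrightarrow>
      (x \<oplus>\<^bsub>A\<^esub> y) \<otimes>\<^bsub>A\<^esub> z = x \<otimes>\<^bsub>A\<^esub> z \<oplus>\<^bsub>A\<^esub> y \<otimes>\<^bsub>A\<^esub> z"
    and "\<And>x y z. x \<in> carrier A \<Longrightarrow> y \<in> carrier A \<Longrightarrow> z \<in> carrier A \<Longrightarrow>
      z \<otimes>\<^bsub>A\<^esub> (x \<oplus>\<^bsub>A\<^esub> y) = z \<otimes>\<^bsub>A\<^esub> x \<oplus>\<^bsub>A\<^esub> z \<otimes>\<^bsub>A\<^esub> y"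
    and "\<And>c x y. x \<in> carrier A \<Longrightarrow> y \<in> carrier A \<Longrightarrow> (c \<odot>\<^bsub>A\<^esub> x) \<otimes>\<^bsub>A\<^esub> y = c \<odot>\<^bsub>A\<^esub> (x \<otimes>\<^bsub>A\<^esub> y)"
    and "\<And>c x y. x \<in> carrier A \<Longrightarrow> y \<in> carrier A \<Longrightarrow> x \<otimes>\<^bsub>A\<^esub> (c \<odot>\<^bsub>A\<^esub> y) = c \<odot>\<^bsub>A\<^esub> (x \<otimes>\<^bsub>A\<^esub> y)"
  shows "calg A"
proof -
  interpret cvs A by fact
  have "ring A"
    by (intro ringI abelian_group_axioms monoidI assms)
  then show ?thesis
    unfolding calg_def calg_axioms_def using assms by blast
qed

subsection \<open>Quotient algebras\<close>

context calg
begin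

lemma quot_mult:
  assumes "ideal I A" "a \<in> carrier A" "b \<in> carrier A"
  shows "(I +> a) \<otimes>\<^bsub>quot_alg A I\<^esub> (I +> b) = I +> (a \<otimes> b)"
  using ideal.rcoset_mult_add[OF assms] by (simp add: quot_alg_def FactRing_def)

lemma quot_one: "\<one>\<^bsub>quot_alg A I\<^esub> = I +> \<one>"
  by (simp add: quot_alg_def FactRing_def)

lemma quot_calg:
  assumes "ideal I A" "submodule I complex_alg A"
  shows "calg (quot_alg A I)"
proof -
  note s = quot_add[OF assms(2)] quot_smult[OF assms(2)] quot_mult[OF assms(1)] quot_one
  have c: "I +> a \<in> carrier (quot_alg A I)" if "a \<in> carrier A" for a
    using that by (simp add: quot_carrier del: quot_alg_simps)
  have ex: "\<exists>a\<in>carrier A. x = I +> a" if "x \<in> carrier (quot_alg A I)" for x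
    using that by (auto simp: quot_carrier simp del: quot_alg_simps)
  show ?thesis
    by (rule calgI[OF quot_cvs[OF assms(2)]]; ((drule ex)+)?; (elim bexE)?; hypsubst?;
        simp only: s c one_closed m_closed a_closed smult_closed m_assoc l_one r_one l_distr r_distr
          smult_mult_left smult_mult_right)
qed

end

subsection \<open>Tensor products of algebras\<close>

lemma pair_alg_induct [consumes 1, case_names zero add]:
  assumes "f \<in> carrier (pair_alg V W)" "Q 0"
    "\<And>f a b c. f \<in> carrier (pair_alg V W) \<Longrightarrow> Q f \<Longrightarrow> a \<in> carrier V \<Longrightarrow> b \<in> carrier W \<Longrightarrow>
      Q (f + Poly_Mapping.single (a, b) c)"
  shows "Q f"
proof -
  interpret cvs "pair_alg V W" by (rule pair_alg_cvs)
  have "(\<Sum>p\<in>A. Poly_Mapping.single p (lookup f p)) \<in> carrier (pair_alg V W) \<and>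
      Q (\<Sum>p\<in>A. Poly_Mapping.single p (lookup f p))"
    if "finite A" "A \<subseteq> keys f" for A
    using that
  proof (induct A)
    case empty
    then show ?case using assms(2) by simp
  next
    case (insert p A)
    obtain a b where p: "p = (a, b)" by (cases p)
    have ab: "a \<in> carrier V" "b \<in> carrier W"
      using assms(1) insert(4) p by auto
    let ?s = "\<Sum>p\<in>A. Poly_Mapping.single p (lookup f p)"
    have IH: "?s \<in> carrier (pair_alg V W)" "Q ?s" using insert by auto
    have "?s \<oplus>\<^bsub>pair_alg V W\<^esub> Poly_Mapping.single p (lookup f p) \<in> carrier (pair_alg V W)"
      by (rule a_closed[OF IH(1)]) (use p ab in auto)
    moreover have "Q (?s + Poly_Mapping.single p (lookup f p))"
      unfolding p by (rule assms(3)[OF IH ab])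
    ultimately show ?case using insert(1,2) by (simp add: add.commute)
  qed
  from this[of "keys f"] show ?thesis by (simp flip: poly_mapping_sum_singles)
qed

text \<open>The product sums over exact supports, which change under addition. Enlarging the index
  sets to common supersets turns bilinearity into a termwise identity.\<close>

lemma pair_mult_superset:
  assumes "finite A" "finite B" "keys f \<subseteq> A" "keys g \<subseteq> B"
  shows "f \<otimes>\<^bsub>pair_alg V W\<^esub> g = (\<Sum>p\<in>A. \<Sum>q\<in>B.
    Poly_Mapping.single (fst p \<otimes>\<^bsub>V\<^esub> fst q, snd p \<otimes>\<^bsub>W\<^esub> snd q) (lookup f p * lookup g q))"
proof -
  have "f \<otimes>\<^bsub>pair_alg V W\<^esub> g = (\<Sum>p\<in>keys f. \<Sum>q\<in>B.
    Poly_Mapping.single (fst p \<otimes>\<^bsub>V\<^esub> fst q, snd p \<otimes>\<^bsub>W\<^esub> snd q) (lookup f p * lookup g q))"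
    unfolding pair_alg_def
    by (simp, intro sum.cong refl sum.mono_neutral_left) (use assms in \<open>auto simp: in_keys_iff\<close>)
  also have "\<dots> = (\<Sum>p\<in>A. \<Sum>q\<in>B.
    Poly_Mapping.single (fst p \<otimes>\<^bsub>V\<^esub> fst q, snd p \<otimes>\<^bsub>W\<^esub> snd q) (lookup f p * lookup g q))"
    by (intro sum.mono_neutral_left) (use assms in \<open>auto simp: in_keys_iff\<close>)
  finally show ?thesis .
qed

lemma pair_mult_add_left:
  "(f + f') \<otimes>\<^bsub>pair_alg V W\<^esub> g = f \<otimes>\<^bsub>pair_alg V W\<^esub> g + f' \<otimes>\<^bsub>pair_alg V W\<^esub> g"
  using keys_add[of f f']
  by (simp add: pair_mult_superset[of "keys f \<union> keys f'" "keys g"] lookup_add algebra_simps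
      single_add sum.distrib)

lemma pair_mult_add_right:
  "g \<otimes>\<^bsub>pair_alg V W\<^esub> (f + f') = g \<otimes>\<^bsub>pair_alg V W\<^esub> f + g \<otimes>\<^bsub>pair_alg V W\<^esub> f'"
  using keys_add[of f f']
  by (simp add: pair_mult_superset[of "keys g" "keys f \<union> keys f'"] lookup_add algebra_simps
      single_add sum.distrib)

lemma pm_scale_sum: "pm_scale c (sum F A) = (\<Sum>i\<in>A. pm_scale c (F i))"
  by (rule poly_mapping_eqI) (simp add: lookup_sum sum_distrib_left)

lemma pair_mult_scale_left:
  "pm_scale c f \<otimes>\<^bsub>pair_alg V W\<^esub> g = pm_scale c (f \<otimes>\<^bsub>pair_alg V W\<^esub> g)"
  using keys_pm_scale[of c f]
  by (simp add: pair_mult_superset[of "keys f" "keys g"] pm_scale_sum mult.assoc)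

lemma pair_mult_scale_right:
  "g \<otimes>\<^bsub>pair_alg V W\<^esub> pm_scale c f = pm_scale c (g \<otimes>\<^bsub>pair_alg V W\<^esub> f)"
  using keys_pm_scale[of c f]
  by (simp add: pair_mult_superset[of "keys g" "keys f"] pm_scale_sum mult.left_commute)

lemma pair_mult_single:
  "Poly_Mapping.single (a, b) c \<otimes>\<^bsub>pair_alg V W\<^esub> Poly_Mapping.single (a', b') c' =
   Poly_Mapping.single (a \<otimes>\<^bsub>V\<^esub> a', b \<otimes>\<^bsub>W\<^esub> b') (c * c')"
  by (simp add: pair_mult_superset[of "{(a, b)}" "{(a', b')}"])

lemma pair_mult_zero [simp]:
  "0 \<otimes>\<^bsub>pair_alg V W\<^esub> g = 0" "g \<otimes>\<^bsub>pair_alg V W\<^esub> 0 = 0"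
  by (simp_all add: pair_alg_def)

lemma pair_mult_diff:
  "(f - f') \<otimes>\<^bsub>pair_alg V W\<^esub> g = f \<otimes>\<^bsub>pair_alg V W\<^esub> g - f' \<otimes>\<^bsub>pair_alg V W\<^esub> g"
  "g \<otimes>\<^bsub>pair_alg V W\<^esub> (f - f') = g \<otimes>\<^bsub>pair_alg V W\<^esub> f - g \<otimes>\<^bsub>pair_alg V W\<^esub> f'"
  using pair_mult_add_left[where f = "f - f'" and f' = f' and g = g and V = V and W = W]
    pair_mult_add_right[where f = "f - f'" and f' = f' and g = g and V = V and W = W]
  by simp_all

locale calg_pair = A: calg A + B: calg B
  for A :: "(complex, 'a) module" and B :: "(complex, 'b) module"
begin

sublocale tensor_pair A B ..

lemma pair_mult_closed:
  assumes "f \<in> carrier (pair_alg A B)" "g \<in> carrier (pair_alg A B)"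
  shows "f \<otimes>\<^bsub>pair_alg A B\<^esub> g \<in> carrier (pair_alg A B)"
proof -
  have addc: "x + y \<in> carrier (pair_alg A B)"
    if "x \<in> carrier (pair_alg A B)" "y \<in> carrier (pair_alg A B)" for x y
    using P.a_closed[OF that] by simp
  have 1: "f \<otimes>\<^bsub>pair_alg A B\<^esub> Poly_Mapping.single (a, b) c \<in> carrier (pair_alg A B)"
    if "a \<in> carrier A" "b \<in> carrier B" for a b c
    using assms(1)
  proof (induct rule: pair_alg_induct)
    case zero
    then show ?case by simp
  next
    case (add f a' b' c')
    then show ?case
      unfolding pair_mult_add_left pair_mult_single using that
      by (intro addc single_closed A.m_closed B.m_closed)
  qed
  show ?thesis
    using assms(2)
  proof (induct rule: pair_alg_induct)
    case zero
    then show ?case by simp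
  next
    case (add g a b c)
    then show ?case unfolding pair_mult_add_right by (intro addc 1)
  qed
qed

lemma pair_mult_assoc:
  assumes "f \<in> carrier (pair_alg A B)" "g \<in> carrier (pair_alg A B)" "k \<in> carrier (pair_alg A B)"
  shows "(f \<otimes>\<^bsub>pair_alg A B\<^esub> g) \<otimes>\<^bsub>pair_alg A B\<^esub> k = f \<otimes>\<^bsub>pair_alg A B\<^esub> (g \<otimes>\<^bsub>pair_alg A B\<^esub> k)"
proof -
  note d = pair_mult_add_left pair_mult_add_right pair_mult_zero pair_mult_single
  note m = A.m_assoc B.m_assoc mult.assoc
  have 1: "(Poly_Mapping.single (a, b) c \<otimes>\<^bsub>pair_alg A B\<^esub> Poly_Mapping.single (a', b') c') \<otimes>\<^bsub>pair_alg A B\<^esub> k =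
      Poly_Mapping.single (a, b) c \<otimes>\<^bsub>pair_alg A B\<^esub> (Poly_Mapping.single (a', b') c' \<otimes>\<^bsub>pair_alg A B\<^esub> k)"
    if "a \<in> carrier A" "b \<in> carrier B" "a' \<in> carrier A" "b' \<in> carrier B" for a b c a' b' c'
    using assms(3) by (induct rule: pair_alg_induct) (use that in \<open>simp_all only: d m\<close>)
  have 2: "(Poly_Mapping.single (a, b) c \<otimes>\<^bsub>pair_alg A B\<^esub> g) \<otimes>\<^bsub>pair_alg A B\<^esub> k =
      Poly_Mapping.single (a, b) c \<otimes>\<^bsub>pair_alg A B\<^esub> (g \<otimes>\<^bsub>pair_alg A B\<^esub> k)"
    if "a \<in> carrier A" "b \<in> carrier B" for a b c
    using assms(2)
  proof (induct rule: pair_alg_induct)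
    case (add f a' b' c')
    then show ?case by (simp only: d(1-3) 1[OF that])
  qed simp
  show ?thesis
    using assms(1)
  proof (induct rule: pair_alg_induct)
    case (add f a' b' c')
    then show ?case by (simp only: d(1-3) 2)
  qed simp
qed

lemma pair_mult_one:
  assumes "f \<in> carrier (pair_alg A B)"
  shows "\<one>\<^bsub>pair_alg A B\<^esub> \<otimes>\<^bsub>pair_alg A B\<^esub> f = f" "f \<otimes>\<^bsub>pair_alg A B\<^esub> \<one>\<^bsub>pair_alg A B\<^esub> = f"
  using assms
  by (induct rule: pair_alg_induct)
    (simp_all only: pair_alg_simps pair_mult_add_left pair_mult_add_right pair_mult_zero pair_mult_single
      A.l_one A.r_one B.l_one B.r_one mult_1_left mult_1_right)

lemma pair_alg_calg: "calg (pair_alg A B)"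
proof (rule calgI[OF pair_alg_cvs])
  show "\<one>\<^bsub>pair_alg A B\<^esub> \<in> carrier (pair_alg A B)"
    unfolding pair_alg_simps(5) by (rule single_closed[OF A.one_closed B.one_closed])
qed (simp_all only: pair_mult_closed pair_mult_assoc pair_mult_one pair_alg_simps(2,4)
    pair_mult_add_left pair_mult_add_right pair_mult_scale_left pair_mult_scale_right)

sublocale PA: calg "pair_alg A B"
  by (rule pair_alg_calg)

text \<open>A basis pair times a generator is again a generator of the same kind, since
  multiplication in \<open>A\<close> and \<open>B\<close> is bilinear. Linearity in one factor gives
  the whole null space, linearity in the other gives arbitrary multipliers. This is what makes the
  tensor product an algebra.\<close>

lemma null_mult_closed:
  assumes f: "f \<in> tensor_null A B" and g: "g \<in> carrier (pair_alg A B)"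
  shows "g \<otimes>\<^bsub>pair_alg A B\<^esub> f \<in> tensor_null A B" "f \<otimes>\<^bsub>pair_alg A B\<^esub> g \<in> tensor_null A B"
proof -
  have N: "tensor_null A B \<subseteq> carrier (pair_alg A B)" "0 \<in> tensor_null A B"
    "\<And>x y. x \<in> tensor_null A B \<Longrightarrow> y \<in> tensor_null A B \<Longrightarrow> x + y \<in> tensor_null A B"
    "\<And>c x. x \<in> tensor_null A B \<Longrightarrow> pm_scale c x \<in> tensor_null A B"
    using null_submodule unfolding P.submodule_iff by simp_all
  have lin: "linear_map (pair_alg A B) (pair_alg A B) (\<lambda>f. g \<otimes>\<^bsub>pair_alg A B\<^esub> f)"
    "linear_map (pair_alg A B) (pair_alg A B) (\<lambda>f. f \<otimes>\<^bsub>pair_alg A B\<^esub> g)"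
    if "g \<in> carrier (pair_alg A B)" for g
    by (rule linear_mapI; use that in \<open>simp only: PA.m_closed PA.l_distr PA.r_distr
        PA.smult_mult_left PA.smult_mult_right\<close>)+
  have gen: "tensor_gens A B \<subseteq> tensor_null A B"
    unfolding tensor_null_eq by (rule lin_span_superset)
  have s: "basis_pair a b \<otimes>\<^bsub>pair_alg A B\<^esub> s \<in> tensor_gens A B"
    "s \<otimes>\<^bsub>pair_alg A B\<^esub> basis_pair a b \<in> tensor_gens A B"
    if ab: "a \<in> carrier A" "b \<in> carrier B" and s: "s \<in> tensor_gens A B" for a b s
  proof -
    have "basis_pair a b \<otimes>\<^bsub>pair_alg A B\<^esub> s \<in> tensor_gens A B \<and>
      s \<otimes>\<^bsub>pair_alg A B\<^esub> basis_pair a b \<in> tensor_gens A B"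
      using s
    proof (cases rule: tensor_gens_cases)
      case (1 x x' y)
      show ?thesis
        unfolding 1(4) pair_mult_diff pair_mult_single mult_1_left A.r_distr[OF 1(1,2) ab(1)]
          A.l_distr[OF 1(1,2) ab(1)] tensor_gens_def
        using A.m_closed[OF ab(1) 1(1)] A.m_closed[OF 1(1) ab(1)] A.m_closed[OF ab(1) 1(2)]
          A.m_closed[OF 1(2) ab(1)] B.m_closed[OF ab(2) 1(3)] B.m_closed[OF 1(3) ab(2)]
        unfolding Un_iff mem_Collect_eq by metis
    next
      case (2 x y y')
      show ?thesis
        unfolding 2(4) pair_mult_diff pair_mult_single mult_1_left B.r_distr[OF 2(2,3) ab(2)]
          B.l_distr[OF 2(2,3) ab(2)] tensor_gens_def
        using A.m_closed[OF ab(1) 2(1)] A.m_closed[OF 2(1) ab(1)] B.m_closed[OF ab(2) 2(2)]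
          B.m_closed[OF 2(2) ab(2)] B.m_closed[OF ab(2) 2(3)] B.m_closed[OF 2(3) ab(2)]
        unfolding Un_iff mem_Collect_eq by metis
    next
      case (3 x y c)
      show ?thesis
        unfolding 3(3) pair_mult_diff pair_mult_scale_left pair_mult_scale_right
          pair_mult_single mult_1_left A.smult_mult_left[OF 3(1) ab(1)]
          A.smult_mult_right[OF ab(1) 3(1)] tensor_gens_def
        using A.m_closed[OF ab(1) 3(1)] A.m_closed[OF 3(1) ab(1)] B.m_closed[OF ab(2) 3(2)]
          B.m_closed[OF 3(2) ab(2)]
        unfolding Un_iff mem_Collect_eq by metis
    next
      case (4 x y c)
      show ?thesis
        unfolding 4(3) pair_mult_diff pair_mult_scale_left pair_mult_scale_right
          pair_mult_single mult_1_left B.smult_mult_left[OF 4(2) ab(2)]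
          B.smult_mult_right[OF ab(2) 4(2)] tensor_gens_def
        using A.m_closed[OF ab(1) 4(1)] A.m_closed[OF 4(1) ab(1)] B.m_closed[OF ab(2) 4(2)]
          B.m_closed[OF 4(2) ab(2)]
        unfolding Un_iff mem_Collect_eq by metis
    qed
    then show "basis_pair a b \<otimes>\<^bsub>pair_alg A B\<^esub> s \<in> tensor_gens A B"
      "s \<otimes>\<^bsub>pair_alg A B\<^esub> basis_pair a b \<in> tensor_gens A B" by simp_all
  qed
  have b1: "basis_pair a b \<otimes>\<^bsub>pair_alg A B\<^esub> f \<in> tensor_null A B"
    if ab: "a \<in> carrier A" "b \<in> carrier B" for a b
    by (rule linear_map_lin_span[OF P.cvs_axioms P.cvs_axioms lin(1)[OF single_closed[OF ab]]
          null_submodule gens_carrier subsetD[OF gen s(1)[OF ab]] f[unfolded tensor_null_eq]])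
  have b2: "f \<otimes>\<^bsub>pair_alg A B\<^esub> basis_pair a b \<in> tensor_null A B"
    if ab: "a \<in> carrier A" "b \<in> carrier B" for a b
    by (rule linear_map_lin_span[OF P.cvs_axioms P.cvs_axioms lin(2)[OF single_closed[OF ab]]
          null_submodule gens_carrier subsetD[OF gen s(2)[OF ab]] f[unfolded tensor_null_eq]])
  have e: "Poly_Mapping.single (a, b) c = pm_scale c (basis_pair a b)" for a b c
    by simp
  have "g \<otimes>\<^bsub>pair_alg A B\<^esub> f \<in> tensor_null A B \<and> f \<otimes>\<^bsub>pair_alg A B\<^esub> g \<in> tensor_null A B"
    using g
  proof (induct rule: pair_alg_induct)
    case zero
    then show ?case using N(2) by simp
  next
    case (add g a b c)
    then show ?case
      unfolding e[of a b c] pair_mult_add_left pair_mult_add_right pair_mult_scale_left pair_mult_scale_right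
      by (intro conjI N(3,4) b1 b2) simp_all
  qed
  then show "g \<otimes>\<^bsub>pair_alg A B\<^esub> f \<in> tensor_null A B" "f \<otimes>\<^bsub>pair_alg A B\<^esub> g \<in> tensor_null A B"
    by simp_all
qed

lemma null_ideal: "ideal (tensor_null A B) (pair_alg A B)"
proof (rule idealI)
  show "ring (pair_alg A B)" by (rule PA.ring_axioms)
  show "subgroup (tensor_null A B) (add_monoid (pair_alg A B))"
    using null_submodule by (rule submodule.axioms)
qed (rule null_mult_closed; assumption)+

sublocale TA: calg "tensor A B"
  unfolding tensor_def by (rule PA.quot_calg[OF null_ideal null_submodule])

lemma ten_mult:
  assumes "a \<in> carrier A" "b \<in> carrier B" "a' \<in> carrier A" "b' \<in> carrier B"
  shows "ten A B a b \<otimes>\<^bsub>tensor A B\<^esub> ten A B a' b' = ten A B (a \<otimes>\<^bsub>A\<^esub> a') (b \<otimes>\<^bsub>B\<^esub> b')"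
  unfolding ten_def tensor_def
  using PA.quot_mult[OF null_ideal single_closed[OF assms(1,2)] single_closed[OF assms(3,4)], of 1 1]
  by (simp add: pair_mult_single)

lemma ten_one: "\<one>\<^bsub>tensor A B\<^esub> = ten A B \<one>\<^bsub>A\<^esub> \<one>\<^bsub>B\<^esub>"
  unfolding ten_def tensor_def PA.quot_one by simp

end

subsection \<open>The free algebra\<close>

lemma poly_mapping_add_induct [case_names zero add]:
  fixes f :: "'a \<Rightarrow>\<^sub>0 complex"
  assumes "Q 0" "\<And>f k c. Q f \<Longrightarrow> Q (f + Poly_Mapping.single k c)"
  shows "Q f"
proof -
  have "Q (\<Sum>p\<in>A. Poly_Mapping.single p (lookup f p))" if "finite A" for A
    using that
  proof (induct A)
    case (insert p A)
    then show ?case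
      using assms(2)[of "\<Sum>p\<in>A. Poly_Mapping.single p (lookup f p)" p "lookup f p"]
      by (simp add: add.commute)
  qed (simp add: assms(1))
  from this[of "keys f"] show ?thesis by (simp flip: poly_mapping_sum_singles)
qed

lemma pm_scale_mult:
  fixes p r :: free_poly
  shows "pm_scale c p * r = pm_scale c (p * r)" "p * pm_scale c r = pm_scale c (p * r)"
proof -
  have s: "pm_scale c (p * Poly_Mapping.single k d) = p * Poly_Mapping.single k (c * d)" for p :: free_poly and k c d
    by (induct p rule: poly_mapping_add_induct)
      (simp_all add: pm_scale_add distrib_right mult_single mult.left_commute
        poly_mapping_eqI[of "pm_scale c 0" 0])
  show "p * pm_scale c r = pm_scale c (p * r)"
    by (induct r rule: poly_mapping_add_induct)
      (simp_all add: pm_scale_add distrib_left s poly_mapping_eqI[of "pm_scale c 0" 0])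
  show "pm_scale c p * r = pm_scale c (p * r)"
    unfolding pm_scale_def mult_map_scale_conv_mult by (simp add: mult.assoc)
qed

lemma pm_scale_0 [simp]: "pm_scale c 0 = 0" "pm_scale 0 p = 0"
  by (rule poly_mapping_eqI; simp)+

lemma pm_scale_diff: "pm_scale c (f - g) = pm_scale c f - pm_scale c g"
  "pm_scale (a - b) f = pm_scale a f - pm_scale b f" "pm_scale c (- f) = - pm_scale c f"
  "pm_scale (- c) f = - pm_scale c f"
  by (rule poly_mapping_eqI; simp add: lookup_minus algebra_simps)+

lemma const_mult: "const c * p = pm_scale c p"
  by (simp add: const_def pm_scale_def mult_map_scale_conv_mult)

lemma const_eq: "const c = pm_scale c 1"
  using const_mult[of c 1] by simp

lemma free_alg_simps [simp]:
  "carrier free_alg = UNIV" "monoid.mult free_alg = (*)" "one free_alg = 1"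
  "ring.zero free_alg = 0" "add free_alg = (+)" "smult free_alg = pm_scale"
  by (simp_all add: free_alg_def)

lemma free_alg_calg: "calg free_alg"
proof (rule calgI)
  have "abelian_group free_alg"
    by (rule abelian_groupI) (auto simp: algebra_simps intro: exI[of _ "- x" for x])
  then show "cvs free_alg"
    unfolding cvs_def cvs_axioms_def by (auto simp: pm_scale_add)
qed (auto simp: pm_scale_mult algebra_simps)

interpretation F: calg free_alg
  by (rule free_alg_calg)

lemma free_alg_minus [simp]: "\<ominus>\<^bsub>free_alg\<^esub> p = - p" "p \<ominus>\<^bsub>free_alg\<^esub> r = p - r"
proof -
  show "\<ominus>\<^bsub>free_alg\<^esub> p = - p" for p
    using F.smult_minus_one[of p] by (simp add: pm_scale_minus_one)
  then show "p \<ominus>\<^bsub>free_alg\<^esub> r = p - r" by (simp add: a_minus_def)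
qed

lemma free_eval_eq: "free_eval B g = lin_ext B (word_eval B g)"
  by (simp add: fun_eq_iff free_eval_def lin_ext_def)

section \<open>Evaluation homomorphisms out of the free algebra\<close>

locale gen_eval = calg B for B :: "(complex, 'b) module" (structure) +
  fixes g :: "sl_gen \<Rightarrow> 'b"
  assumes g_closed [simp]: "g a \<in> carrier B"
begin

lemma word_eval_closed: "word_eval B g w \<in> carrier B"
proof (cases w)
  case (Word as)
  have "foldr (\<lambda>a r. g a \<otimes> r) as \<one> \<in> carrier B" by (induct as) auto
  then show ?thesis by (simp add: word_eval_def Word)
qed

lemma word_eval_plus: "word_eval B g (v + w) = word_eval B g v \<otimes> word_eval B g w"
proof (cases v; cases w)
  fix as bs assume vw: "v = Word as" "w = Word bs"
  have c: "foldr (\<lambda>a r. g a \<otimes> r) as \<one> \<in> carrier B" for as by (induct as) auto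
  have "foldr (\<lambda>a r. g a \<otimes> r) (as @ bs) \<one> =
      foldr (\<lambda>a r. g a \<otimes> r) as \<one> \<otimes> foldr (\<lambda>a r. g a \<otimes> r) bs \<one>"
    by (induct as) (simp_all add: c m_assoc del: foldr_append)
  then show ?thesis by (simp add: word_eval_def vw)
qed

lemma eval_linear: "linear_map free_alg B (free_eval B g)"
  unfolding free_eval_eq
  by (rule linear_mapI; unfold free_alg_simps)
    (auto intro!: lin_ext_closed lin_ext_add lin_ext_pm_scale cvs_axioms word_eval_closed)

lemma eval_closed [simp]: "free_eval B g p \<in> carrier B"
  using linear_mapD(1)[OF eval_linear] by simp

lemma eval_add: "free_eval B g (p + r) = free_eval B g p \<oplus> free_eval B g r"
  using linear_mapD(2)[OF eval_linear] by simp

lemma eval_scale: "free_eval B g (pm_scale c p) = c \<odot> free_eval B g p"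
  using linear_mapD(3)[OF eval_linear] by simp

lemma eval_zero: "free_eval B g 0 = \<zero>"
  by (simp add: free_eval_def)

lemma eval_uminus: "free_eval B g (- p) = \<ominus> free_eval B g p"
  using eval_scale[of "- 1" p] by (simp add: pm_scale_minus_one smult_minus_one)

lemma eval_diff: "free_eval B g (p - r) = free_eval B g p \<ominus> free_eval B g r"
  using eval_add[of p "- r"] by (simp add: eval_uminus a_minus_def)

lemma eval_single: "free_eval B g (Poly_Mapping.single w c) = c \<odot> word_eval B g w"
  unfolding free_eval_eq by (rule lin_ext_single[of _ "word_eval B g", OF cvs_axioms word_eval_closed])

lemma eval_mult: "free_eval B g (p * r) = free_eval B g p \<otimes> free_eval B g r"
proof -
  have 1: "free_eval B g (Poly_Mapping.single v c * r) =
      free_eval B g (Poly_Mapping.single v c) \<otimes> free_eval B g r" for v c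
  proof (induct r rule: poly_mapping_add_induct)
    case (add r w d)
    have "free_eval B g (Poly_Mapping.single v c * Poly_Mapping.single w d) =
        free_eval B g (Poly_Mapping.single v c) \<otimes> free_eval B g (Poly_Mapping.single w d)"
      by (simp add: mult_single eval_single word_eval_plus word_eval_closed smult_mult_left
          smult_mult_right smult_assoc1[symmetric] mult.commute)
    then show ?case by (simp add: distrib_left eval_add r_distr add)
  qed (simp add: eval_zero)
  show ?thesis
  proof (induct p rule: poly_mapping_add_induct)
    case (add p v c)
    then show ?case by (simp add: distrib_right eval_add l_distr 1)
  qed (simp add: eval_zero)
qed

lemma eval_one: "free_eval B g 1 = \<one>"
proof -
  have "word_eval B g 0 = \<one>" by (simp add: word_eval_def zero_gen_word_def)
  then show ?thesis using eval_single[of 0 1] by simp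
qed

lemma eval_gen: "free_eval B g (gen a) = g a"
  unfolding gen_def eval_single by (simp add: word_eval_def)

lemma eval_const: "free_eval B g (const c) = c \<odot> \<one>"
  by (simp add: const_eq eval_scale eval_one)

lemmas eval_simps = eval_add eval_diff eval_uminus eval_zero eval_one eval_mult eval_scale
  eval_const eval_gen

lemma kernel_ideal: "ideal {p. free_eval B g p = \<zero>} free_alg"
proof (rule idealI)
  show "ring free_alg" by (rule F.ring_axioms)
  have "submodule {p. free_eval B g p = \<zero>} complex_alg free_alg"
    unfolding F.submodule_iff by (auto simp: eval_simps)
  then show "subgroup {p. free_eval B g p = \<zero>} (add_monoid free_alg)"
    by (rule submodule.axioms)
qed (auto simp: eval_simps)

lemma eval_ideal:
  assumes "\<And>r. r \<in> sl_rels h \<Longrightarrow> free_eval B g r = \<zero>" "p \<in> sl_ideal h"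
  shows "free_eval B g p = \<zero>"
  using F.genideal_minimal[OF kernel_ideal, of "sl_rels h"] assms by (auto simp: sl_ideal_def)

end

subsection \<open>The algebra \<open>SL\<^sub>h(2)\<close>\<close>

lemma sl_ideal_ideal: "ideal (sl_ideal h) free_alg"
  unfolding sl_ideal_def by (rule F.genideal_ideal) simp

lemma sl_ideal_rels: "r \<in> sl_rels h \<Longrightarrow> r \<in> sl_ideal h"
  unfolding sl_ideal_def by (rule subsetD[OF F.genideal_self]) simp_all

lemma sl_ideal_closed:
  "p \<in> sl_ideal h \<Longrightarrow> r * p \<in> sl_ideal h" "p \<in> sl_ideal h \<Longrightarrow> p * r \<in> sl_ideal h"
  "p \<in> sl_ideal h \<Longrightarrow> s \<in> sl_ideal h \<Longrightarrow> p + s \<in> sl_ideal h"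
  "p \<in> sl_ideal h \<Longrightarrow> pm_scale c p \<in> sl_ideal h"
  "p \<in> sl_ideal h \<Longrightarrow> - p \<in> sl_ideal h"
  "p \<in> sl_ideal h \<Longrightarrow> s \<in> sl_ideal h \<Longrightarrow> p - s \<in> sl_ideal h"
  "0 \<in> sl_ideal h"
proof -
  interpret I: ideal "sl_ideal h" free_alg by (rule sl_ideal_ideal)
  show l: "r * p \<in> sl_ideal h" if "p \<in> sl_ideal h" for r p using I.I_l_closed[OF that, of r] by simp
  show "p * r \<in> sl_ideal h" if "p \<in> sl_ideal h" using I.I_r_closed[OF that, of r] by simp
  show a: "p + s \<in> sl_ideal h" if "p \<in> sl_ideal h" "s \<in> sl_ideal h" for p s
    using I.a_closed[OF that] by simp
  show s: "pm_scale c p \<in> sl_ideal h" if "p \<in> sl_ideal h" for c p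
    using l[OF that, of "const c"] by (simp add: const_mult)
  show m: "- p \<in> sl_ideal h" if "p \<in> sl_ideal h" for p
    using s[OF that, of "- 1"] by (simp add: pm_scale_minus_one)
  show "p - s \<in> sl_ideal h" if "p \<in> sl_ideal h" "s \<in> sl_ideal h"
    using a[OF that(1) m[OF that(2)]] by simp
  show "0 \<in> sl_ideal h" using I.zero_closed by simp
qed

lemma sl_ideal_submodule: "submodule (sl_ideal h) complex_alg free_alg"
  unfolding F.submodule_iff by (auto simp: sl_ideal_closed)

lemma SLh_calg: "calg (SLh h)"
  unfolding SLh_def by (rule F.quot_calg[OF sl_ideal_ideal sl_ideal_submodule])

text \<open>The class of an arbitrary free polynomial, so that calculations can stay in the free
  algebra and equality becomes membership in \<open>sl_ideal h\<close>.\<close>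

definition slq :: "complex \<Rightarrow> free_poly \<Rightarrow> free_poly set" where
  "slq h p = sl_ideal h +>\<^bsub>free_alg\<^esub> p"

lemma sl_eq: "sl h a = slq h (gen a)"
  by (simp add: sl_def slq_def)

lemma slq_closed [simp]: "slq h p \<in> carrier (SLh h)"
  unfolding slq_def SLh_def F.quot_carrier by simp

lemma SLh_carrier: "carrier (SLh h) = range (slq h)"
  unfolding slq_def SLh_def F.quot_carrier by simp

lemma slq_eq_iff: "slq h p = slq h r \<longleftrightarrow> p - r \<in> sl_ideal h"
  unfolding slq_def using F.quot_eq_iff[OF sl_ideal_submodule, of p r] by simp

lemma slq_add: "slq h (p + r) = slq h p \<oplus>\<^bsub>SLh h\<^esub> slq h r"
  unfolding slq_def SLh_def using F.quot_add[OF sl_ideal_submodule, of p r] by simp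

lemma slq_scale: "slq h (pm_scale c p) = c \<odot>\<^bsub>SLh h\<^esub> slq h p"
  unfolding slq_def SLh_def using F.quot_smult[OF sl_ideal_submodule, of p h c] by simp

lemma slq_mult: "slq h (p * r) = slq h p \<otimes>\<^bsub>SLh h\<^esub> slq h r"
  unfolding slq_def SLh_def using F.quot_mult[OF sl_ideal_ideal, of p r] by simp

lemma slq_one: "slq h 1 = \<one>\<^bsub>SLh h\<^esub>"
  unfolding slq_def SLh_def using F.quot_one by simp

lemma slq_zero: "slq h 0 = \<zero>\<^bsub>SLh h\<^esub>"
  unfolding slq_def SLh_def using F.quot_zero[OF sl_ideal_submodule] by simp

lemma (in gen_eval) gen_hom_slq:
  assumes "\<And>r. r \<in> sl_rels h \<Longrightarrow> free_eval B g r = \<zero>"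
  shows "gen_hom B g (slq h p) = free_eval B g p"
proof -
  define r where "r = (SOME r. r \<in> slq h p)"
  have "slq h r = slq h p"
    using F.quot_some[OF sl_ideal_submodule, of p h] unfolding r_def slq_def by simp
  then have "free_eval B g (r - p) = \<zero>"
    using eval_ideal[OF assms] by (simp add: slq_eq_iff)
  then have "free_eval B g r = free_eval B g p"
    by (simp add: eval_diff)
  then show ?thesis by (simp add: gen_hom_def flip: r_def)
qed

lemma (in gen_eval) gen_hom_linear:
  assumes "\<And>r. r \<in> sl_rels h \<Longrightarrow> free_eval B g r = \<zero>"
  shows "linear_map (SLh h) B (gen_hom B g)"
  by (rule linear_mapI)
    (auto simp: SLh_carrier gen_hom_slq[OF assms] eval_simps simp flip: slq_add slq_scale)

subsection \<open>Matrix form of the relations\<close>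

definition T :: "nat \<Rightarrow> nat \<Rightarrow> free_poly" where
  "T i k = gen (T_entry i k)"

lemma gen_T: "gen Gx = T 1 1" "gen Gu = T 1 2" "gen Gv = T 2 1" "gen Gy = T 2 2"
  by (simp_all add: T_def T_entry_def)

text \<open>Entry \<open>(a, b)\<close> of \<open>T F T\<^sup>t\<close>, with the noncommuting
  factors in the order of the matrix product.\<close>

definition Frel :: "complex \<Rightarrow> nat \<Rightarrow> nat \<Rightarrow> free_poly" where
  "Frel h a b = pm_scale (- h) (T a 1 * T b 1) + T a 1 * T b 2 + pm_scale (- 1) (T a 2 * T b 1)"

definition Fmat :: "complex \<Rightarrow> nat \<Rightarrow> nat \<Rightarrow> complex" where
  "Fmat h a b = (if a = 1 then if b = 1 then - h else 1 else if b = 1 then - 1 else 0)"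

text \<open>Entry \<open>(a, b)\<close> of \<open>T\<^sup>t E T\<close>.\<close>

definition Erel :: "complex \<Rightarrow> nat \<Rightarrow> nat \<Rightarrow> free_poly" where
  "Erel h a b = T 1 a * T 2 b + pm_scale (- 1) (T 2 a * T 1 b) + pm_scale h (T 2 a * T 2 b)"

definition Emat :: "complex \<Rightarrow> nat \<Rightarrow> nat \<Rightarrow> complex" where
  "Emat h a b = (if a = 1 then if b = 1 then 0 else 1 else if b = 1 then - 1 else h)"

text \<open>Five relations, among them the determinant relation, are matrix entries up to sign. The
  commutators \<open>[x,y]\<close> and \<open>[v,u]\<close> arise by combining the determinant
  relation with an off-diagonal entry of \<open>T\<^sup>t E T - E\<close>.\<close>

lemma sl_rels_matrix:
  "sl_rels h = {- (Erel h 1 1 - const (Emat h 1 1)), - (Frel h 1 1 - const (Fmat h 1 1)),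
     Frel h 2 2 - const (Fmat h 2 2), Erel h 2 2 - const (Emat h 2 2),
     (Frel h 1 2 - const (Fmat h 1 2)) + (Erel h 2 1 - const (Emat h 2 1)),
     (Frel h 1 2 - const (Fmat h 1 2)) - (Erel h 1 2 - const (Emat h 1 2)),
     Frel h 1 2 - const (Fmat h 1 2)}"
  unfolding sl_rels_def Let_def gen_T Frel_def Fmat_def Erel_def Emat_def
  by (simp add: const_mult const_eq pm_scale_diff pm_scale_add pm_scale_mult algebra_simps
      power2_eq_square insert_commute)

lemma matrix_rels_in_ideal:
  "a \<in> {1, 2} \<Longrightarrow> b \<in> {1, 2} \<Longrightarrow> Frel h a b - const (Fmat h a b) \<in> sl_ideal h"
  "a \<in> {1, 2} \<Longrightarrow> b \<in> {1, 2} \<Longrightarrow> Erel h a b - const (Emat h a b) \<in> sl_ideal h"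
proof -
  define f e where "f a b = Frel h a b - const (Fmat h a b)" "e a b = Erel h a b - const (Emat h a b)" for a b
  have r: "- e 1 1 \<in> sl_ideal h" "- f 1 1 \<in> sl_ideal h" "f 2 2 \<in> sl_ideal h" "e 2 2 \<in> sl_ideal h"
     "f 1 2 + e 2 1 \<in> sl_ideal h" "f 1 2 - e 1 2 \<in> sl_ideal h" "f 1 2 \<in> sl_ideal h"
    unfolding f_e_def by (rule sl_ideal_rels; unfold sl_rels_matrix; simp)+
  have 1: "e 1 1 \<in> sl_ideal h" using sl_ideal_closed(5)[OF r(1)] by simp
  have 2: "f 1 1 \<in> sl_ideal h" using sl_ideal_closed(5)[OF r(2)] by simp
  have 3: "e 2 1 \<in> sl_ideal h" using sl_ideal_closed(6)[OF r(5,7)] by simp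
  have 4: "e 1 2 \<in> sl_ideal h" using sl_ideal_closed(6)[OF r(7,6)] by simp
  \<comment> \<open>The seven relations give only seven of the eight matrix entries; the remaining
    one is this linear combination of the others.\<close>
  have "f 2 1 = f 1 2 - e 1 2 + e 2 1 + pm_scale h (e 1 1) + pm_scale h (f 2 2)"
    unfolding f_e_def Frel_def Fmat_def Erel_def Emat_def
    by (simp add: const_mult const_eq pm_scale_diff pm_scale_add pm_scale_mult algebra_simps)
  then have 5: "f 2 1 \<in> sl_ideal h"
    using sl_ideal_closed(3,4) r(3,6) 1 3 by (metis (no_types))
  show "a \<in> {1, 2} \<Longrightarrow> b \<in> {1, 2} \<Longrightarrow> Frel h a b - const (Fmat h a b) \<in> sl_ideal h"
    using r 1 2 3 4 5 unfolding f_e_def by auto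
  show "a \<in> {1, 2} \<Longrightarrow> b \<in> {1, 2} \<Longrightarrow> Erel h a b - const (Emat h a b) \<in> sl_ideal h"
    using r 1 2 3 4 5 unfolding f_e_def by auto
qed

lemma (in gen_eval) eval_relsI:
  assumes "\<And>a b. a \<in> {1, 2} \<Longrightarrow> b \<in> {1, 2} \<Longrightarrow> free_eval B g (Frel h a b) = Fmat h a b \<odot> \<one>"
    "\<And>a b. a \<in> {1, 2} \<Longrightarrow> b \<in> {1, 2} \<Longrightarrow> free_eval B g (Erel h a b) = Emat h a b \<odot> \<one>"
    "r \<in> sl_rels h"
  shows "free_eval B g r = \<zero>"
proof -
  have f: "free_eval B g (Frel h a b - const (Fmat h a b)) = \<zero>" if "a \<in> {1, 2}" "b \<in> {1, 2}" for a b
    using assms(1)[OF that] by (simp add: eval_diff eval_const a_minus_def r_neg)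
  have e: "free_eval B g (Erel h a b - const (Emat h a b)) = \<zero>" if "a \<in> {1, 2}" "b \<in> {1, 2}" for a b
    using assms(2)[OF that] by (simp add: eval_diff eval_const a_minus_def r_neg)
  have s: "(1::nat) \<in> {1, 2}" "(2::nat) \<in> {1, 2}" by auto
  show ?thesis
    using assms(3) unfolding sl_rels_matrix insert_iff empty_iff
    by (elim disjE; simp only: eval_uminus eval_add[of "_ - _"] eval_diff[of "_ - _"] f e s)
      (auto simp: a_minus_def)
qed

subsection \<open>The matrix coefficients\<close>

text \<open>This is \<open>2 h m\<close> for the weight \<open>m = n/2 - k\<close>, the factor
  produced when \<open>\<eta>\<close> is moved across the exponential of
  \<open>m \<sigma>\<close>.\<close>

definition kap :: "complex \<Rightarrow> nat \<Rightarrow> nat \<Rightarrow> complex" where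
  "kap h n k = (of_nat n - 2 * of_nat k) * h"

definition shift :: "(nat \<Rightarrow> 'a::zero) \<Rightarrow> nat \<Rightarrow> 'a" where
  "shift c k = (if k = 0 then 0 else c (k - 1))"

text \<open>If \<open>w = \<Sum>k\<le>n. Z n k \<otimes> c k\<close>, where \<open>Z n k = Y (Y + hX) \<cdots> (Y + (k-1)hX) X\<^sup>n\<^sup>-\<^sup>k\<close> are the ordered
  monomials of degree \<open>n\<close>, then \<open>col h n c i\<close> are the coefficients of the product of \<open>w\<close> with the
  \<open>i\<close>-th entry of \<open>(X, Y) T\<close>; this uses \<open>Z n k X = Z (n+1) k\<close> and
  \<open>Z n k Y = Z (n+1) (k+1) + (n-2k)h Z (n+1) k\<close>.\<close>

definition col :: "complex \<Rightarrow> nat \<Rightarrow> (nat \<Rightarrow> free_poly) \<Rightarrow> nat \<Rightarrow> nat \<Rightarrow> free_poly" where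
  "col h n c i k = c k * T 1 i + (pm_scale (kap h n k) (c k) + shift c k) * T 2 i"

text \<open>Coefficient of \<open>Z n k\<close> in the transformed monomial with index
  \<open>a\<close>: the row is \<open>k\<close>, the column is \<open>a\<close>. With
  \<open>W\<close> for the transformed monomials, the recursion mirrors
  \<open>W (n+1) 0 = W n 0 X'\<close> and
  \<open>W (n+1) (a+1) = W n a Y' - (n-2a)h W n a X'\<close>.\<close>

fun dmat :: "complex \<Rightarrow> nat \<Rightarrow> nat \<Rightarrow> nat \<Rightarrow> free_poly" where
  "dmat h 0 0 k = (if k = 0 then 1 else 0)"
| "dmat h 0 (Suc a) k = 0"
| "dmat h (Suc n) 0 k = col h n (dmat h n 0) 1 k"
| "dmat h (Suc n) (Suc a) k =
     col h n (dmat h n a) 2 k - pm_scale (kap h n a) (col h n (dmat h n a) 1 k)"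

lemma col_zero: "c k = 0 \<Longrightarrow> shift c k = 0 \<Longrightarrow> col h n c i k = 0"
  by (simp add: col_def)

lemma dmat_support: "k > n \<Longrightarrow> dmat h n a k = 0"
proof (induct n arbitrary: a k)
  case 0
  then show ?case by (cases a) auto
next
  case (Suc n)
  then have "col h n (dmat h n a) i k = 0" for a i
    by (intro col_zero) (auto simp: shift_def)
  then show ?case by (cases a) auto
qed

lemma col_diff:
  "col h n (\<lambda>k. c k - d k) i k = col h n c i k - col h n d i k"
  by (simp add: col_def shift_def pm_scale_diff algebra_simps)

lemma col_scale:
  "col h n (\<lambda>k. pm_scale s (c k)) i k = pm_scale s (col h n c i k)"
  by (simp add: col_def shift_def pm_scale_add pm_scale_mult algebra_simps flip: pm_scale_add(3))

lemma col_in_ideal: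
  "(\<And>k. c k \<in> sl_ideal h) \<Longrightarrow> col h n c i k \<in> sl_ideal h"
  by (auto simp: col_def shift_def intro!: sl_ideal_closed)

text \<open>Multiplication by \<open>X' Y' - Y' X' - h X' X'\<close> on the level of coefficients.
  The result is a combination of the entries of \<open>T F T\<^sup>t - F\<close>.\<close>

lemma col_commutation:
  "col h (Suc n) (col h n c 1) 2 k - col h (Suc n) (col h n c 2) 1 k
     - pm_scale h (col h (Suc n) (col h n c 1) 1 k) \<in> sl_ideal h"
proof -
  define f where "f a b = Frel h a b - const (Fmat h a b)" for a b
  \<comment> \<open>\<open>al\<close> and \<open>be\<close> are the coefficients after right
    multiplication by \<open>Y\<close> once and twice.\<close>
  define al where "al k = pm_scale (kap h n k) (c k) + shift c k" for k
  define be where "be k = pm_scale (kap h (Suc n) k) (al k) + shift al k" for k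
  have kap_Suc: "kap h (Suc n) k = kap h n k + h" for k
    by (simp add: kap_def algebra_simps)
  have kap_shift: "kap h (Suc n) k = kap h n (k - 1) - h" if "k > 0" for k
    using that by (cases k) (auto simp: kap_def algebra_simps)
  have c2: "col h (Suc n) (col h n c i) j k = c k * T 1 i * T 1 j + al k * T 2 i * T 1 j +
      (al k + pm_scale h (c k)) * T 1 i * T 2 j + be k * T 2 i * T 2 j" for i j
  proof (cases "k = 0")
    case True
    then show ?thesis
      by (simp add: col_def[of h "Suc n"] be_def al_def col_def[of h n] shift_def kap_Suc
          pm_scale_add pm_scale_mult algebra_simps)
  next
    case False
    then show ?thesis
      by (simp add: col_def[of h "Suc n"] be_def al_def col_def[of h n] shift_def kap_Suc
          pm_scale_add pm_scale_mult algebra_simps)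
  qed
  \<comment> \<open>The constants subtracted in the \<open>f a b\<close> cancel, weighted by their
    coefficients: \<open>- h c - al + (al + h c) + 0 = 0\<close>.\<close>
  have "col h (Suc n) (col h n c 1) 2 k - col h (Suc n) (col h n c 2) 1 k
     - pm_scale h (col h (Suc n) (col h n c 1) 1 k) =
     c k * f 1 1 + al k * f 2 1 + (al k + pm_scale h (c k)) * f 1 2 + be k * f 2 2"
    unfolding c2 f_def Frel_def Fmat_def
    by (simp add: const_eq pm_scale_add pm_scale_diff pm_scale_mult algebra_simps)
  also have "\<dots> \<in> sl_ideal h"
    unfolding f_def by (intro sl_ideal_closed matrix_rels_in_ideal) auto
  finally show ?thesis .
qed

text \<open>Agreement of the two routes. For \<open>a = Suc b\<close> the recursion appends
  \<open>Y'\<close> last, whereas the left side appends \<open>X'\<close> last; exchanging the last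
  two factors costs an element of the ideal by \<open>col_commutation\<close>. The induction
  hypothesis replaces \<open>dmat h (Suc n) b\<close> by an appended \<open>X'\<close> up to the
  error \<open>e\<close>, and \<open>col\<close> keeps that error inside the ideal.\<close>

lemma dmat_col:
  assumes "a \<le> n"
  shows "slq h (col h n (dmat h n a) 1 k) = slq h (dmat h (Suc n) a k)"
  using assms
proof (induct n arbitrary: a k)
  case 0
  then show ?case unfolding le_zero_eq by (simp only: dmat.simps(3))
next
  case (Suc n)
  show ?case
  proof (cases a)
    case 0
    show ?thesis by (simp only: 0 dmat.simps(3)[of h "Suc n" k])
  next
    case (Suc b)
    then have b: "b \<le> n" using Suc.prems by simp
    define c where "c = dmat h n b"
    define e where "e k = dmat h (Suc n) b k - col h n c 1 k" for k
    have e: "e k \<in> sl_ideal h" for k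
      using Suc.hyps[OF b, of k] unfolding c_def e_def slq_eq_iff by (metis minus_diff_eq sl_ideal_closed(5))
    have d1: "dmat h (Suc n) b = (\<lambda>k. col h n c 1 k - (- e k))"
      by (simp add: fun_eq_iff e_def)
    have d2: "dmat h (Suc n) (Suc b) = (\<lambda>k. col h n c 2 k - pm_scale (kap h n b) (col h n c 1 k))"
      by (simp add: fun_eq_iff c_def)
    have "col h (Suc n) (dmat h (Suc n) (Suc b)) 1 k - dmat h (Suc (Suc n)) (Suc b) k =
      pm_scale (kap h (Suc n) b) (col h (Suc n) (\<lambda>k. - e k) 1 k) * (- 1) + col h (Suc n) (\<lambda>k. - e k) 2 k
      - (col h (Suc n) (col h n c 1) 2 k - col h (Suc n) (col h n c 2) 1 k
       - pm_scale h (col h (Suc n) (col h n c 1) 1 k))"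
      unfolding dmat.simps(4)[of h "Suc n"] d2 unfolding d1 col_diff col_scale
      by (simp add: kap_def algebra_simps pm_scale_diff pm_scale_add)
    also have "\<dots> \<in> sl_ideal h"
      using e by (intro sl_ideal_closed col_commutation col_in_ideal)
    finally show ?thesis
      unfolding slq_eq_iff Suc .
  qed
qed

lemma dmat_col2:
  assumes "a \<le> n"
  shows "slq h (col h n (dmat h n a) 2 k) =
    slq h (dmat h (Suc n) (Suc a) k + pm_scale (kap h n a) (dmat h (Suc n) a k))"
proof -
  have "col h n (dmat h n a) 2 k - (dmat h (Suc n) (Suc a) k + pm_scale (kap h n a) (dmat h (Suc n) a k)) =
     pm_scale (kap h n a) (col h n (dmat h n a) 1 k - dmat h (Suc n) a k)"
    by (simp add: pm_scale_diff)
  then show ?thesis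
    using dmat_col[OF assms, of h k] unfolding slq_eq_iff by (simp add: sl_ideal_closed(4))
qed

subsection \<open>Tensor products with \<open>SL\<^sub>h(2)\<close>\<close>

interpretation H: calg "SLh h" for h
  by (rule SLh_calg)

locale slh_tensor = cvs V for V :: "(complex, 'a) module" (structure) +
  fixes h :: complex
begin

sublocale VH: tensor_pair V "SLh h" ..

abbreviation "VH \<equiv> tensor V (SLh h)"

text \<open>The second leg is given by a free polynomial, so the recursion for the coefficients can
  be applied to it before passing to the quotient.\<close>

definition tq :: "'a \<Rightarrow> free_poly \<Rightarrow> (('a \<times> free_poly set) \<Rightarrow>\<^sub>0 complex) set" where
  "tq v p = ten V (SLh h) v (slq h p)"

lemma tq_closed [simp]: "v \<in> carrier V \<Longrightarrow> tq v p \<in> carrier VH"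
  by (simp add: tq_def)

lemma tq_add_left: "v \<in> carrier V \<Longrightarrow> w \<in> carrier V \<Longrightarrow> tq (v \<oplus> w) p = tq v p \<oplus>\<^bsub>VH\<^esub> tq w p"
  by (simp add: tq_def VH.ten_add_left)

lemma tq_smult_left: "v \<in> carrier V \<Longrightarrow> tq (c \<odot> v) p = c \<odot>\<^bsub>VH\<^esub> tq v p"
  by (simp add: tq_def VH.ten_smult_left)

lemma tq_add: "v \<in> carrier V \<Longrightarrow> tq v (p + r) = tq v p \<oplus>\<^bsub>VH\<^esub> tq v r"
  by (simp add: tq_def VH.ten_add_right slq_add)

lemma tq_scale: "v \<in> carrier V \<Longrightarrow> tq v (pm_scale c p) = c \<odot>\<^bsub>VH\<^esub> tq v p"
  by (simp add: tq_def VH.ten_smult_right slq_scale)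

lemma tq_zero: "v \<in> carrier V \<Longrightarrow> tq v 0 = \<zero>\<^bsub>VH\<^esub>"
  using tq_scale[of v 0 0] by simp

lemma tq_zero_left: "tq \<zero> p = \<zero>\<^bsub>VH\<^esub>"
  using tq_smult_left[of \<zero> 0 p] by simp

lemma tq_cong: "slq h p = slq h r \<Longrightarrow> tq v p = tq v r"
  by (simp add: tq_def)

text \<open>Kept abstract in \<open>Z\<close> because it is used twice: with the monomials of the
  plane, and with the classes of a fixed row of matrix coefficients in their place.\<close>

lemma regroup:
  assumes Z: "\<And>k. Z k \<in> carrier V" and c: "\<And>k. k > n \<Longrightarrow> c k = 0"
  shows "(\<Oplus>\<^bsub>VH\<^esub>m\<in>{..n}. tq (Z m) (c m * T 1 i) \<oplus>\<^bsub>VH\<^esub>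
      tq (Z (Suc m) \<oplus> kap h n m \<odot> Z m) (c m * T 2 i)) =
    (\<Oplus>\<^bsub>VH\<^esub>m\<in>{..Suc n}. tq (Z m) (col h n c i m))"
proof -
  define A where "A m = tq (Z m) (c m * T 1 i)" for m
  define B where "B m = tq (Z m) (pm_scale (kap h n m) (c m * T 2 i))" for m
  define C where "C m = tq (Z m) (shift c m * T 2 i)" for m
  have cl: "A m \<in> carrier VH" "B m \<in> carrier VH" "C m \<in> carrier VH" for m
    by (simp_all add: A_def B_def C_def Z)
  note clP = cl(1)[THEN Pi_I] cl(2)[THEN Pi_I] cl(3)[THEN Pi_I] cl Pi_I
  \<comment> \<open>Boundary terms: \<open>c\<close> vanishes at \<open>n + 1\<close> and
    \<open>shift c\<close> at \<open>0\<close>. Hence the sums may end at \<open>n\<close> or at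
    \<open>n + 1\<close>, and the shifted one may be reindexed.\<close>
  have ends: "A (Suc n) = \<zero>\<^bsub>VH\<^esub>" "B (Suc n) = \<zero>\<^bsub>VH\<^esub>" "C 0 = \<zero>\<^bsub>VH\<^esub>"
    by (simp_all add: A_def B_def C_def c Z shift_def tq_zero)
  have l: "tq (Z m) (c m * T 1 i) \<oplus>\<^bsub>VH\<^esub> tq (Z (Suc m) \<oplus> kap h n m \<odot> Z m) (c m * T 2 i) =
    A m \<oplus>\<^bsub>VH\<^esub> (C (Suc m) \<oplus>\<^bsub>VH\<^esub> B m)" for m
    by (simp add: A_def B_def C_def Z tq_add_left tq_smult_left tq_scale shift_def)
  have r: "tq (Z m) (col h n c i m) = A m \<oplus>\<^bsub>VH\<^esub> (C m \<oplus>\<^bsub>VH\<^esub> B m)" for m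
    unfolding col_def
    by (simp add: A_def B_def C_def Z tq_add distrib_right pm_scale_mult VH.T.a_comm)
  have "(\<Oplus>\<^bsub>VH\<^esub>m\<in>{..n}. A m \<oplus>\<^bsub>VH\<^esub> (C (Suc m) \<oplus>\<^bsub>VH\<^esub> B m)) =
     (\<Oplus>\<^bsub>VH\<^esub>m\<in>{..n}. A m) \<oplus>\<^bsub>VH\<^esub> ((\<Oplus>\<^bsub>VH\<^esub>m\<in>{..n}. C (Suc m)) \<oplus>\<^bsub>VH\<^esub> (\<Oplus>\<^bsub>VH\<^esub>m\<in>{..n}. B m))"
    using cl by (simp add: VH.T.finsum_addf Pi_iff)
  moreover have "(\<Oplus>\<^bsub>VH\<^esub>m\<in>{..Suc n}. A m \<oplus>\<^bsub>VH\<^esub> (C m \<oplus>\<^bsub>VH\<^esub> B m)) =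
     (\<Oplus>\<^bsub>VH\<^esub>m\<in>{..Suc n}. A m) \<oplus>\<^bsub>VH\<^esub> ((\<Oplus>\<^bsub>VH\<^esub>m\<in>{..Suc n}. C m) \<oplus>\<^bsub>VH\<^esub> (\<Oplus>\<^bsub>VH\<^esub>m\<in>{..Suc n}. B m))"
    using cl by (simp add: VH.T.finsum_addf Pi_iff del: VH.T.finsum_Suc)
  moreover have "(\<Oplus>\<^bsub>VH\<^esub>m\<in>{..Suc n}. A m) = (\<Oplus>\<^bsub>VH\<^esub>m\<in>{..n}. A m)"
    "(\<Oplus>\<^bsub>VH\<^esub>m\<in>{..Suc n}. B m) = (\<Oplus>\<^bsub>VH\<^esub>m\<in>{..n}. B m)"
    using cl ends by (simp_all add: Pi_iff)
  moreover have "(\<Oplus>\<^bsub>VH\<^esub>m\<in>{..Suc n}. C m) = (\<Oplus>\<^bsub>VH\<^esub>m\<in>{..n}. C (Suc m))"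
    using cl ends by (subst VH.T.finsum_Suc2) (simp_all add: Pi_iff)
  ultimately show ?thesis unfolding l r by simp
qed

lemma tq_sum_diff:
  assumes Z: "\<And>k. Z k \<in> carrier V"
  shows "(\<Oplus>\<^bsub>VH\<^esub>m\<in>A. tq (Z m) (c m - pm_scale s (d m))) =
    (\<Oplus>\<^bsub>VH\<^esub>m\<in>A. tq (Z m) (c m)) \<oplus>\<^bsub>VH\<^esub> (- s) \<odot>\<^bsub>VH\<^esub> (\<Oplus>\<^bsub>VH\<^esub>m\<in>A. tq (Z m) (d m))"
proof -
  have "tq (Z m) (c m - pm_scale s (d m)) = tq (Z m) (c m) \<oplus>\<^bsub>VH\<^esub> (- s) \<odot>\<^bsub>VH\<^esub> tq (Z m) (d m)" for m
    using tq_add[OF Z, of m "c m" "pm_scale (- s) (d m)"] by (simp add: pm_scale_diff Z flip: tq_scale)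
  then show ?thesis
    by (simp add: VH.T.finsum_addf VH.T.smult_finsum Z Pi_iff)
qed

end

locale slh_alg_tensor = calg A for A :: "(complex, 'a) module" (structure) +
  fixes h :: complex
begin

sublocale slh_tensor A h ..

sublocale VH: calg_pair A "SLh h" ..

lemma tq_mult:
  "v \<in> carrier A \<Longrightarrow> w \<in> carrier A \<Longrightarrow> tq v p \<otimes>\<^bsub>VH\<^esub> tq w r = tq (v \<otimes> w) (p * r)"
  by (simp add: tq_def VH.ten_mult slq_mult)

lemma tq_one: "\<one>\<^bsub>VH\<^esub> = tq \<one> 1"
  by (simp add: tq_def VH.ten_one slq_one)

lemma tq_sum_mult:
  assumes Z: "\<And>k. Z k \<in> carrier A" and v: "v \<in> carrier A" "w \<in> carrier A" and I: "finite I"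
  shows "(\<Oplus>\<^bsub>VH\<^esub>m\<in>I. tq (Z m) (c m)) \<otimes>\<^bsub>VH\<^esub> (tq v p \<oplus>\<^bsub>VH\<^esub> tq w r) =
    (\<Oplus>\<^bsub>VH\<^esub>m\<in>I. tq (Z m \<otimes> v) (c m * p) \<oplus>\<^bsub>VH\<^esub> tq (Z m \<otimes> w) (c m * r))"
proof -
  have "(\<Oplus>\<^bsub>VH\<^esub>m\<in>I. tq (Z m) (c m)) \<otimes>\<^bsub>VH\<^esub> (tq v p \<oplus>\<^bsub>VH\<^esub> tq w r) =
    (\<Oplus>\<^bsub>VH\<^esub>m\<in>I. tq (Z m) (c m) \<otimes>\<^bsub>VH\<^esub> (tq v p \<oplus>\<^bsub>VH\<^esub> tq w r))"
    using assms by (intro VH.TA.finsum_ldistr) auto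
  then show ?thesis
    using assms by (simp add: VH.TA.r_distr tq_mult)
qed

end

subsection \<open>Comultiplication and counit\<close>

interpretation HH: slh_alg_tensor "SLh h" h for h ..

abbreviation qq :: "complex \<Rightarrow> free_poly \<Rightarrow> free_poly \<Rightarrow> ((free_poly set \<times> free_poly set) \<Rightarrow>\<^sub>0 complex) set" where
  "qq h p r \<equiv> HH.tq h (slq h p) r"

abbreviation "SLh2 h \<equiv> tensor (SLh h) (SLh h)"

lemma qq_cong: "p - p' \<in> sl_ideal h \<Longrightarrow> r - r' \<in> sl_ideal h \<Longrightarrow> qq h p r = qq h p' r'"
  by (simp add: HH.tq_def flip: slq_eq_iff)

definition comult_gen :: "complex \<Rightarrow> sl_gen \<Rightarrow> ((free_poly set \<times> free_poly set) \<Rightarrow>\<^sub>0 complex) set" where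
  "comult_gen h a = qq h (T (T_row a) 1) (T 1 (T_col a)) \<oplus>\<^bsub>SLh2 h\<^esub> qq h (T (T_row a) 2) (T 2 (T_col a))"

lemma sl_comult_eq: "sl_comult h = gen_hom (SLh2 h) (comult_gen h)"
  unfolding sl_comult_def
  by (rule arg_cong[of _ _ "gen_hom _"])
    (simp add: fun_eq_iff comult_gen_def HH.tq_def sl_eq T_def Pi_iff)

interpretation DE: gen_eval "SLh2 h" "comult_gen h" for h
  by (rule gen_eval.intro[OF HH.VH.TA.calg_axioms]; unfold_locales) (simp add: comult_gen_def)

abbreviation "DEv h \<equiv> free_eval (SLh2 h) (comult_gen h)"

lemma DEv_T:
  assumes "i \<in> {1, 2}" "k \<in> {1, 2}"
  shows "DEv h (T i k) = qq h (T i 1) (T 1 k) \<oplus>\<^bsub>SLh2 h\<^esub> qq h (T i 2) (T 2 k)"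
proof -
  have "T_row (T_entry i k) = i" "T_col (T_entry i k) = k"
    using assms by (auto simp: T_entry_def)
  then show ?thesis by (simp add: T_def[of i k] DE.eval_gen comult_gen_def)
qed

lemma qq_mult: "qq h p r \<otimes>\<^bsub>SLh2 h\<^esub> qq h p' r' = qq h (p * p') (r * r')"
  by (simp add: HH.tq_mult slq_mult)

lemma DEv_TT:
  assumes "i \<in> {1, 2}" "k \<in> {1, 2}" "i' \<in> {1, 2}" "k' \<in> {1, 2}"
  shows "DEv h (T i k * T i' k') =
    (qq h (T i 1 * T i' 1) (T 1 k * T 1 k') \<oplus>\<^bsub>SLh2 h\<^esub> qq h (T i 1 * T i' 2) (T 1 k * T 2 k'))
    \<oplus>\<^bsub>SLh2 h\<^esub> (qq h (T i 2 * T i' 1) (T 2 k * T 1 k') \<oplus>\<^bsub>SLh2 h\<^esub> qq h (T i 2 * T i' 2) (T 2 k * T 2 k'))"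
  unfolding DE.eval_mult DEv_T[OF assms(1,2)] DEv_T[OF assms(3,4)]
  by (subst HH.VH.TA.l_distr)
    (simp_all only: HH.VH.TA.r_distr HH.tq_closed slq_closed HH.VH.T.a_closed qq_mult)

text \<open>The twelve terms of a three-term quadratic relation under the coproduct, regrouped so
  that terms sharing one tensor leg stand together and the relation can be applied in the other
  leg.\<close>

lemma (in cvs) lincomb_transpose:
  assumes [simp]: "a1 \<in> carrier V" "a2 \<in> carrier V" "a3 \<in> carrier V" "a4 \<in> carrier V"
    "b1 \<in> carrier V" "b2 \<in> carrier V" "b3 \<in> carrier V" "b4 \<in> carrier V"
    "c1 \<in> carrier V" "c2 \<in> carrier V" "c3 \<in> carrier V" "c4 \<in> carrier V"
  shows "x \<odot> ((a1 \<oplus> a2) \<oplus> (a3 \<oplus> a4)) \<oplus> y \<odot> ((b1 \<oplus> b2) \<oplus> (b3 \<oplus> b4)) \<oplus> z \<odot> ((c1 \<oplus> c2) \<oplus> (c3 \<oplus> c4))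
    = ((x \<odot> a1 \<oplus> y \<odot> b1 \<oplus> z \<odot> c1) \<oplus> (x \<odot> a2 \<oplus> y \<odot> b2 \<oplus> z \<odot> c2)) \<oplus>
      ((x \<odot> a3 \<oplus> y \<odot> b3 \<oplus> z \<odot> c3) \<oplus> (x \<odot> a4 \<oplus> y \<odot> b4 \<oplus> z \<odot> c4))"
  by (simp add: smult_r_distr a_ac)

lemma qq_right_sum:
  assumes "pm_scale x r1 + pm_scale y r2 + pm_scale z r3 - const c \<in> sl_ideal h"
  shows "x \<odot>\<^bsub>SLh2 h\<^esub> qq h p r1 \<oplus>\<^bsub>SLh2 h\<^esub> y \<odot>\<^bsub>SLh2 h\<^esub> qq h p r2 \<oplus>\<^bsub>SLh2 h\<^esub> z \<odot>\<^bsub>SLh2 h\<^esub> qq h p r3 =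
    qq h (pm_scale c p) 1"
proof -
  have "x \<odot>\<^bsub>SLh2 h\<^esub> qq h p r1 \<oplus>\<^bsub>SLh2 h\<^esub> y \<odot>\<^bsub>SLh2 h\<^esub> qq h p r2 \<oplus>\<^bsub>SLh2 h\<^esub> z \<odot>\<^bsub>SLh2 h\<^esub> qq h p r3 =
      qq h p (pm_scale x r1 + pm_scale y r2 + pm_scale z r3)"
    by (simp add: HH.tq_add HH.tq_scale)
  also have "\<dots> = qq h p (const c)"
    using assms by (intro qq_cong) (auto intro: sl_ideal_closed)
  also have "\<dots> = qq h (pm_scale c p) 1"
    by (simp add: const_eq HH.tq_scale slq_scale HH.tq_smult_left)
  finally show ?thesis .
qed

lemma qq_left_sum:
  assumes "pm_scale x r1 + pm_scale y r2 + pm_scale z r3 - const c \<in> sl_ideal h"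
  shows "x \<odot>\<^bsub>SLh2 h\<^esub> qq h r1 p \<oplus>\<^bsub>SLh2 h\<^esub> y \<odot>\<^bsub>SLh2 h\<^esub> qq h r2 p \<oplus>\<^bsub>SLh2 h\<^esub> z \<odot>\<^bsub>SLh2 h\<^esub> qq h r3 p =
    qq h 1 (pm_scale c p)"
proof -
  have "x \<odot>\<^bsub>SLh2 h\<^esub> qq h r1 p \<oplus>\<^bsub>SLh2 h\<^esub> y \<odot>\<^bsub>SLh2 h\<^esub> qq h r2 p \<oplus>\<^bsub>SLh2 h\<^esub> z \<odot>\<^bsub>SLh2 h\<^esub> qq h r3 p =
      qq h (pm_scale x r1 + pm_scale y r2 + pm_scale z r3) p"
    by (simp add: slq_add slq_scale HH.tq_add_left HH.tq_smult_left)
  also have "\<dots> = qq h (const c) p"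
    using assms by (intro qq_cong) (auto intro: sl_ideal_closed)
  also have "\<dots> = qq h 1 (pm_scale c p)"
    by (simp add: const_eq HH.tq_scale slq_scale HH.tq_smult_left)
  finally show ?thesis .
qed

text \<open>The relations of \<open>SL\<^sub>h(2)\<close> are equivalent to \<open>T F T\<^sup>t = F\<close> and \<open>T\<^sup>t E T = E\<close>
  (\<open>sl_rels_matrix\<close>). As the entries of \<open>T \<otimes> 1\<close> and \<open>1 \<otimes> T\<close> commute, both identities pass from \<open>T\<close> to
  the product of these two matrices.\<close>

lemma DEv_Frel:
  assumes a: "a \<in> {1, 2}" and b: "b \<in> {1, 2}"
  shows "DEv h (Frel h a b) = Fmat h a b \<odot>\<^bsub>SLh2 h\<^esub> \<one>\<^bsub>SLh2 h\<^esub>"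
proof -
  have s: "(1::nat) \<in> {1, 2}" "(2::nat) \<in> {1, 2}" by auto
  have F: "pm_scale (- h) (T k 1 * T l 1) + pm_scale 1 (T k 1 * T l 2) + pm_scale (- 1) (T k 2 * T l 1)
      - const (Fmat h k l) \<in> sl_ideal h" if "k \<in> {1, 2}" "l \<in> {1, 2}" for k l
    using matrix_rels_in_ideal(1)[OF that] by (simp add: Frel_def pm_scale_add)
  have "DEv h (Frel h a b) = DEv h (pm_scale (- h) (T a 1 * T b 1) + pm_scale 1 (T a 1 * T b 2) +
      pm_scale (- 1) (T a 2 * T b 1))"
    by (simp add: Frel_def pm_scale_add)
  also have "\<dots> = (qq h (pm_scale (Fmat h 1 1) (T a 1 * T b 1)) 1 \<oplus>\<^bsub>SLh2 h\<^esub>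
      qq h (pm_scale (Fmat h 1 2) (T a 1 * T b 2)) 1) \<oplus>\<^bsub>SLh2 h\<^esub>
      (qq h (pm_scale (Fmat h 2 1) (T a 2 * T b 1)) 1 \<oplus>\<^bsub>SLh2 h\<^esub>
      qq h (pm_scale (Fmat h 2 2) (T a 2 * T b 2)) 1)"
    unfolding DE.eval_add DE.eval_scale DEv_TT[OF a s(1) b s(1)] DEv_TT[OF a s(1) b s(2)]
      DEv_TT[OF a s(2) b s(1)]
    by (subst HH.VH.T.lincomb_transpose)
      (simp_all only: qq_right_sum[OF F] s HH.tq_closed slq_closed)
  also have "\<dots> = qq h (pm_scale (- h) (T a 1 * T b 1) + pm_scale 1 (T a 1 * T b 2) + pm_scale (- 1) (T a 2 * T b 1)) 1"
    by (simp add: Fmat_def slq_add HH.tq_add_left HH.VH.T.a_assoc slq_zero HH.tq_zero_left)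
  also have "\<dots> = qq h (const (Fmat h a b)) 1"
    by (rule qq_cong[OF F[OF a b]]) (simp add: sl_ideal_closed)
  finally show ?thesis
    by (simp add: const_eq slq_scale HH.tq_smult_left HH.tq_one slq_one)
qed

lemma DEv_Erel:
  assumes a: "a \<in> {1, 2}" and b: "b \<in> {1, 2}"
  shows "DEv h (Erel h a b) = Emat h a b \<odot>\<^bsub>SLh2 h\<^esub> \<one>\<^bsub>SLh2 h\<^esub>"
proof -
  have s: "(1::nat) \<in> {1, 2}" "(2::nat) \<in> {1, 2}" by auto
  have E: "pm_scale 1 (T 1 k * T 2 l) + pm_scale (- 1) (T 2 k * T 1 l) + pm_scale h (T 2 k * T 2 l)
      - const (Emat h k l) \<in> sl_ideal h" if "k \<in> {1, 2}" "l \<in> {1, 2}" for k l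
    using matrix_rels_in_ideal(2)[OF that] by (simp add: Erel_def pm_scale_add)
  have "DEv h (Erel h a b) = DEv h (pm_scale 1 (T 1 a * T 2 b) + pm_scale (- 1) (T 2 a * T 1 b) +
      pm_scale h (T 2 a * T 2 b))"
    by (simp add: Erel_def pm_scale_add)
  also have "\<dots> = (qq h 1 (pm_scale (Emat h 1 1) (T 1 a * T 1 b)) \<oplus>\<^bsub>SLh2 h\<^esub>
      qq h 1 (pm_scale (Emat h 1 2) (T 1 a * T 2 b))) \<oplus>\<^bsub>SLh2 h\<^esub>
      (qq h 1 (pm_scale (Emat h 2 1) (T 2 a * T 1 b)) \<oplus>\<^bsub>SLh2 h\<^esub>
      qq h 1 (pm_scale (Emat h 2 2) (T 2 a * T 2 b)))"
    unfolding DE.eval_add DE.eval_scale DEv_TT[OF s(1) a s(2) b] DEv_TT[OF s(2) a s(1) b]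
      DEv_TT[OF s(2) a s(2) b]
    by (subst HH.VH.T.lincomb_transpose)
      (simp_all only: qq_left_sum[OF E] s HH.tq_closed slq_closed)
  also have "\<dots> = qq h 1 (pm_scale 1 (T 1 a * T 2 b) + pm_scale (- 1) (T 2 a * T 1 b) + pm_scale h (T 2 a * T 2 b))"
    by (simp add: Emat_def HH.tq_add HH.VH.T.a_assoc HH.tq_zero)
  also have "\<dots> = qq h 1 (const (Emat h a b))"
    by (rule qq_cong[OF _ E[OF a b]]) (simp add: sl_ideal_closed)
  finally show ?thesis
    by (simp add: const_eq HH.tq_scale HH.tq_one slq_one)
qed

lemma DEv_rels: "r \<in> sl_rels h \<Longrightarrow> DEv h r = \<zero>\<^bsub>SLh2 h\<^esub>"
  by (rule DE.eval_relsI[OF DEv_Frel DEv_Erel])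

lemma sl_comult_slq: "sl_comult h (slq h p) = DEv h p"
  unfolding sl_comult_eq by (rule DE.gen_hom_slq[OF DEv_rels])

lemma sl_comult_linear: "linear_map (SLh h) (SLh2 h) (sl_comult h)"
  unfolding sl_comult_eq by (rule DE.gen_hom_linear[OF DEv_rels])

text \<open>In the first leg, the coproduct of \<open>col h n c i k\<close> produces
  \<open>col\<close> of the columns of \<open>dmat h n\<close>. By \<open>dmat_col\<close> and
  \<open>dmat_col2\<close> these obey, for a fixed row \<open>k\<close>, the same two rules as the
  monomials \<open>Z\<close>, so \<open>regroup\<close> reassembles \<open>col\<close> in the second
  leg.\<close>

lemma DEv_col:
  assumes c: "\<And>k. k > n \<Longrightarrow> c k = 0"
    and DEv_c: "\<And>k. DEv h (c k) = (\<Oplus>\<^bsub>SLh2 h\<^esub>m\<in>{..n}. qq h (dmat h n m k) (c m))"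
    and i: "i \<in> {1, 2}"
  shows "DEv h (col h n c i k) = (\<Oplus>\<^bsub>SLh2 h\<^esub>m\<in>{..Suc n}. qq h (dmat h (Suc n) m k) (col h n c i m))"
proof -
  have s: "(1::nat) \<in> {1, 2}" "(2::nat) \<in> {1, 2}" by auto
  let ?D' = "\<lambda>m. shift (dmat h n m) k"
  let ?D'' = "\<lambda>m. pm_scale (kap h n k) (dmat h n m k) + ?D' m"
  have sh: "DEv h (shift c k) = (\<Oplus>\<^bsub>SLh2 h\<^esub>m\<in>{..n}. qq h (?D' m) (c m))"
    by (cases k) (simp_all add: shift_def DE.eval_zero DEv_c slq_zero HH.tq_zero_left HH.VH.T.finsum_zero)
  have "DEv h (pm_scale (kap h n k) (c k) + shift c k) = (\<Oplus>\<^bsub>SLh2 h\<^esub>m\<in>{..n}. qq h (?D'' m) (c m))"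
    unfolding DE.eval_add DE.eval_scale sh DEv_c
    by (simp add: HH.VH.T.smult_finsum Pi_iff slq_add slq_scale HH.tq_add_left HH.tq_smult_left
        HH.VH.T.finsum_addf)
  then have "DEv h (col h n c i k) =
    (\<Oplus>\<^bsub>SLh2 h\<^esub>m\<in>{..n}. qq h (dmat h n m k) (c m)) \<otimes>\<^bsub>SLh2 h\<^esub> DEv h (T 1 i) \<oplus>\<^bsub>SLh2 h\<^esub>
    (\<Oplus>\<^bsub>SLh2 h\<^esub>m\<in>{..n}. qq h (?D'' m) (c m)) \<otimes>\<^bsub>SLh2 h\<^esub> DEv h (T 2 i)"
    unfolding col_def DE.eval_add[of _ "_ * _"] DE.eval_mult by (simp add: DEv_c)
  also have "\<dots> = (\<Oplus>\<^bsub>SLh2 h\<^esub>m\<in>{..n}.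
      (qq h (dmat h n m k * T 1 1) (c m * T 1 i) \<oplus>\<^bsub>SLh2 h\<^esub> qq h (dmat h n m k * T 1 2) (c m * T 2 i)) \<oplus>\<^bsub>SLh2 h\<^esub>
      (qq h (?D'' m * T 2 1) (c m * T 1 i) \<oplus>\<^bsub>SLh2 h\<^esub> qq h (?D'' m * T 2 2) (c m * T 2 i)))"
    unfolding DEv_T[OF s(1) i] DEv_T[OF s(2) i]
    by (simp add: HH.tq_sum_mult Pi_iff HH.VH.T.finsum_addf flip: slq_mult)
  also have "\<dots> = (\<Oplus>\<^bsub>SLh2 h\<^esub>m\<in>{..n}. qq h (col h n (dmat h n m) 1 k) (c m * T 1 i) \<oplus>\<^bsub>SLh2 h\<^esub>
      qq h (col h n (dmat h n m) 2 k) (c m * T 2 i))"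
  proof (rule finsum_cong_simp[OF HH.VH.T.cvs_axioms refl])
    fix m
    have ac: "(a \<oplus>\<^bsub>SLh2 h\<^esub> b) \<oplus>\<^bsub>SLh2 h\<^esub> (d \<oplus>\<^bsub>SLh2 h\<^esub> e) = (a \<oplus>\<^bsub>SLh2 h\<^esub> d) \<oplus>\<^bsub>SLh2 h\<^esub> (b \<oplus>\<^bsub>SLh2 h\<^esub> e)"
      if "a \<in> carrier (SLh2 h)" "b \<in> carrier (SLh2 h)" "d \<in> carrier (SLh2 h)" "e \<in> carrier (SLh2 h)" for a b d e
      using that by (simp add: HH.VH.T.a_ac)
    show "(qq h (dmat h n m k * T 1 1) (c m * T 1 i) \<oplus>\<^bsub>SLh2 h\<^esub> qq h (dmat h n m k * T 1 2) (c m * T 2 i)) \<oplus>\<^bsub>SLh2 h\<^esub>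
      (qq h (?D'' m * T 2 1) (c m * T 1 i) \<oplus>\<^bsub>SLh2 h\<^esub> qq h (?D'' m * T 2 2) (c m * T 2 i)) =
      qq h (col h n (dmat h n m) 1 k) (c m * T 1 i) \<oplus>\<^bsub>SLh2 h\<^esub> qq h (col h n (dmat h n m) 2 k) (c m * T 2 i)"
      unfolding col_def slq_add[of h "dmat h n m k * _"]
      by (subst ac) (simp_all only: HH.tq_add_left HH.tq_closed slq_closed)
  qed (simp)
  also have "\<dots> = (\<Oplus>\<^bsub>SLh2 h\<^esub>m\<in>{..n}. qq h (dmat h (Suc n) m k) (c m * T 1 i) \<oplus>\<^bsub>SLh2 h\<^esub>
      HH.tq h (slq h (dmat h (Suc n) (Suc m) k) \<oplus>\<^bsub>SLh h\<^esub> kap h n m \<odot>\<^bsub>SLh h\<^esub> slq h (dmat h (Suc n) m k)) (c m * T 2 i))"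
    by (rule finsum_cong_simp[OF HH.VH.T.cvs_axioms refl])
      (simp_all only: atMost_iff dmat_col dmat_col2 slq_add slq_scale HH.tq_closed slq_closed HH.VH.T.a_closed
         H.a_closed H.smult_closed)
  also have "\<dots> = (\<Oplus>\<^bsub>SLh2 h\<^esub>m\<in>{..Suc n}. qq h (dmat h (Suc n) m k) (col h n c i m))"
    by (rule HH.regroup[of "\<lambda>m. slq h (dmat h (Suc n) m k)", OF slq_closed c])
  finally show ?thesis .
qed

lemma DEv_dmat:
  assumes "a \<le> n"
  shows "DEv h (dmat h n a k) = (\<Oplus>\<^bsub>SLh2 h\<^esub>m\<in>{..n}. qq h (dmat h n m k) (dmat h n a m))"
  using assms
proof (induct n arbitrary: a k)
  case 0
  then show ?case
    by (cases k) (simp_all add: DE.eval_one DE.eval_zero HH.tq_one slq_one slq_zero HH.tq_zero_left Pi_iff)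
next
  case (Suc n)
  have col: "DEv h (col h n (dmat h n b) i k) =
      (\<Oplus>\<^bsub>SLh2 h\<^esub>m\<in>{..Suc n}. qq h (dmat h (Suc n) m k) (col h n (dmat h n b) i m))"
    if "b \<le> n" "i \<in> {1, 2}" for b i k
    by (rule DEv_col[OF dmat_support Suc.hyps]) (use that in auto)
  show ?case
  proof (cases a)
    case 0
    then show ?thesis using col[of 0 1 k] by (simp only: dmat.simps(3)) simp
  next
    case (Suc b)
    then have b: "b \<le> n" using Suc.prems by simp
    have "DEv h (dmat h (Suc n) (Suc b) k) = DEv h (col h n (dmat h n b) 2 k) \<oplus>\<^bsub>SLh2 h\<^esub>
       (- kap h n b) \<odot>\<^bsub>SLh2 h\<^esub> DEv h (col h n (dmat h n b) 1 k)"
      unfolding dmat.simps by (simp add: DE.eval_diff DE.eval_scale HH.VH.T.smult_minus_left a_minus_def)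
    also have "\<dots> = (\<Oplus>\<^bsub>SLh2 h\<^esub>m\<in>{..Suc n}. qq h (dmat h (Suc n) m k)
        (col h n (dmat h n b) 2 m - pm_scale (kap h n b) (col h n (dmat h n b) 1 m)))"
      unfolding col[OF b insertI1] col[OF b insertI2[OF insertI1]]
      by (rule HH.tq_sum_diff[of "\<lambda>m. slq h (dmat h (Suc n) m k)", OF slq_closed, symmetric])
    finally show ?thesis unfolding Suc dmat.simps .
  qed
qed

section \<open>The counit\<close>

lemma complex_alg_calg: "calg complex_alg"
proof (rule calgI)
  show "cvs complex_alg"
    unfolding cvs_def cvs_axioms_def using cring.axioms(1)[OF cring_complex_alg, THEN ring.is_abelian_group]
    by (auto simp: algebra_simps)
qed (auto simp: algebra_simps)

lemma complex_alg_minus [simp]: "\<ominus>\<^bsub>complex_alg\<^esub> x = - x" "x \<ominus>\<^bsub>complex_alg\<^esub> y = x - y"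
proof -
  interpret C: calg complex_alg by (rule complex_alg_calg)
  show "\<ominus>\<^bsub>complex_alg\<^esub> x = - x" for x using C.smult_minus_one[of x] by simp
  then show "x \<ominus>\<^bsub>complex_alg\<^esub> y = x - y" by (simp add: a_minus_def)
qed

definition counit_gen :: "sl_gen \<Rightarrow> complex" where
  "counit_gen a = (if T_row a = T_col a then 1 else 0)"

interpretation CE: gen_eval complex_alg counit_gen
  by (rule gen_eval.intro[OF complex_alg_calg]; unfold_locales) simp

abbreviation "CEv \<equiv> free_eval complex_alg counit_gen"

lemma CEv_simps: "CEv (p + r) = CEv p + CEv r" "CEv (p - r) = CEv p - CEv r"
  "CEv (p * r) = CEv p * CEv r" "CEv (pm_scale c p) = c * CEv p" "CEv 0 = 0" "CEv 1 = 1"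
  "CEv (const c) = c"
  by (simp_all add: CE.eval_simps)

lemma CEv_T: "i \<in> {1, 2} \<Longrightarrow> k \<in> {1, 2} \<Longrightarrow> CEv (T i k) = (if i = k then 1 else 0)"
  by (auto simp: T_def CE.eval_gen counit_gen_def T_entry_def)

lemma CEv_rels: "r \<in> sl_rels h \<Longrightarrow> CEv r = 0"
  by (rule CE.eval_relsI[of h r, unfolded complex_alg_simps])
    (auto simp: Frel_def Erel_def Fmat_def Emat_def CEv_simps CEv_T)

lemma sl_counit_slq: "sl_counit (slq h p) = CEv p"
  unfolding sl_counit_def counit_gen_def[symmetric]
  by (rule CE.gen_hom_slq) (simp add: CEv_rels)

lemma sl_counit_linear: "linear_map (SLh h) complex_alg sl_counit"
  unfolding sl_counit_def counit_gen_def[symmetric]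
  by (rule CE.gen_hom_linear) (simp add: CEv_rels)

text \<open>At the counit \<open>T\<close> becomes the identity matrix, so the transformed monomials
  are the original ones.\<close>

lemma CEv_dmat: "a \<le> n \<Longrightarrow> CEv (dmat h n a k) = (if k = a then 1 else 0)"
proof (induct n arbitrary: a k)
  case 0
  then show ?case by (auto simp: CEv_simps)
next
  case (Suc n)
  then show ?case
    by (cases a) (auto simp: CEv_simps CEv_T col_def shift_def kap_def)
qed

subsection \<open>Twisted primitive functionals\<close>

text \<open>A homomorphism into this algebra of upper triangular matrices \<open>(p q; 0 r)\<close> whose first component
  is the counit amounts to a character \<open>r\<close> and a functional \<open>q\<close> with \<open>q (a b) = \<epsilon> a q b + q a r b\<close>.\<close>

definition tri_alg :: "(complex, complex \<times> complex \<times> complex) module" where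
  "tri_alg = \<lparr>carrier = UNIV,
     monoid.mult = (\<lambda>a b. (fst a * fst b, fst a * fst (snd b) + fst (snd a) * snd (snd b), snd (snd a) * snd (snd b))),
     one = (1, 0, 1), ring.zero = (0, 0, 0),
     add = (\<lambda>a b. (fst a + fst b, fst (snd a) + fst (snd b), snd (snd a) + snd (snd b))),
     smult = (\<lambda>c a. (c * fst a, c * fst (snd a), c * snd (snd a)))\<rparr>"

lemma tri_alg_simps [simp]:
  "carrier tri_alg = UNIV" "one tri_alg = (1, 0, 1)" "ring.zero tri_alg = (0, 0, 0)"
  "(p, q, r) \<otimes>\<^bsub>tri_alg\<^esub> (p', q', r') = (p * p', p * q' + q * r', r * r')"
  "(p, q, r) \<oplus>\<^bsub>tri_alg\<^esub> (p', q', r') = (p + p', q + q', r + r')"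
  "c \<odot>\<^bsub>tri_alg\<^esub> (p, q, r) = (c * p, c * q, c * r)"
  by (simp_all add: tri_alg_def)

lemma tri_alg_calg: "calg tri_alg"
proof (rule calgI)
  have "abelian_group tri_alg"
  proof (rule abelian_groupI)
    fix x assume "x \<in> carrier tri_alg"
    then show "\<exists>y\<in>carrier tri_alg. y \<oplus>\<^bsub>tri_alg\<^esub> x = \<zero>\<^bsub>tri_alg\<^esub>"
      by (cases x) (auto intro: exI[of _ "- a" for a])
  qed auto
  then show "cvs tri_alg"
    unfolding cvs_def cvs_axioms_def by (auto simp: algebra_simps)
qed (auto simp: algebra_simps)

text \<open>The last component is the character that sends \<open>T\<close> to the unipotent matrix
  \<open>(1 t; 0 1)\<close>.\<close>

definition tri_gen :: "complex \<Rightarrow> (sl_gen \<Rightarrow> complex) \<Rightarrow> sl_gen \<Rightarrow> complex \<times> complex \<times> complex" where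
  "tri_gen t \<phi> a = (counit_gen a, \<phi> a, if a = Gu then t else counit_gen a)"

text \<open>The assumptions are what the relations demand of the middle component:
  \<open>\<phi>_det\<close> comes from the determinant relation, \<open>\<phi>_twist\<close> from
  the commutators of \<open>u\<close> with the other generators. In particular
  \<open>\<phi> Gv \<noteq> 0\<close> forces \<open>t = 2 * h\<close>.\<close>

locale twisted_primitive =
  fixes h t :: complex and \<phi> :: "sl_gen \<Rightarrow> complex"
  assumes \<phi>_det: "\<phi> Gx + \<phi> Gy = h * \<phi> Gv"
    and \<phi>_twist: "a \<noteq> Gu \<Longrightarrow> t * \<phi> a = 2 * h * \<phi> a"
begin

sublocale TE: gen_eval tri_alg "tri_gen t \<phi>"
  by (rule gen_eval.intro[OF tri_alg_calg]; unfold_locales) simp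

definition tpf :: "free_poly \<Rightarrow> complex" where
  "tpf p = fst (snd (free_eval tri_alg (tri_gen t \<phi>) p))"

definition chr :: "free_poly \<Rightarrow> complex" where
  "chr p = snd (snd (free_eval tri_alg (tri_gen t \<phi>) p))"

lemma tri_minus [simp]: "x \<ominus>\<^bsub>tri_alg\<^esub> y = (fst x - fst y, fst (snd x) - fst (snd y), snd (snd x) - snd (snd y))"
  using TE.smult_minus_one[of y, symmetric] by (cases x; cases y) (simp add: a_minus_def)



lemma TE_fst: "fst (free_eval tri_alg (tri_gen t \<phi>) p) = CEv p"
proof (induct p rule: poly_mapping_add_induct)
  case zero
  then show ?case by (simp add: TE.eval_zero CEv_simps)
next
  case (add p w c)
  have "fst (word_eval tri_alg (tri_gen t \<phi>) w) = word_eval complex_alg counit_gen w"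
  proof (cases w)
    case (Word as)
    have "fst (foldr (\<lambda>a r. tri_gen t \<phi> a \<otimes>\<^bsub>tri_alg\<^esub> r) as \<one>\<^bsub>tri_alg\<^esub>) =
       foldr (\<lambda>a r. counit_gen a \<otimes>\<^bsub>complex_alg\<^esub> r) as \<one>\<^bsub>complex_alg\<^esub>"
      by (induct as) (simp_all add: tri_gen_def, simp add: tri_alg_def)
    then show ?thesis by (simp add: word_eval_def Word)
  qed
  then show ?case
    using add by (simp add: TE.eval_add CEv_simps TE.eval_single CE.eval_single)
      (simp add: tri_alg_def)
qed

lemma TE_eq: "free_eval tri_alg (tri_gen t \<phi>) p = (CEv p, tpf p, chr p)"
  by (simp add: tpf_def chr_def TE_fst[symmetric])

lemma tpf_simps: "tpf (p + r) = tpf p + tpf r" "tpf (p - r) = tpf p - tpf r"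
  "tpf (p * r) = CEv p * tpf r + tpf p * chr r" "tpf (pm_scale c p) = c * tpf p"
  "tpf 0 = 0" "tpf 1 = 0" "tpf (const c) = 0"
  using TE.eval_add[of p r] TE.eval_diff[of p r] TE.eval_mult[of p r] TE.eval_scale[of c p]
    TE.eval_zero TE.eval_one TE.eval_const[of c]
  by (simp_all add: TE_eq)

lemma chr_simps: "chr (p + r) = chr p + chr r" "chr (p - r) = chr p - chr r"
  "chr (p * r) = chr p * chr r" "chr (pm_scale c p) = c * chr p"
  "chr 0 = 0" "chr 1 = 1" "chr (const c) = c"
  using TE.eval_add[of p r] TE.eval_diff[of p r] TE.eval_mult[of p r] TE.eval_scale[of c p]
    TE.eval_zero TE.eval_one TE.eval_const[of c]
  by (simp_all add: TE_eq)

lemma tpf_chr_gen: "tpf (gen a) = \<phi> a" "chr (gen a) = (if a = Gu then t else counit_gen a)"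
  using TE.eval_gen[of a] by (simp_all add: TE_eq tri_gen_def)

lemma tpf_chr_T:
  "tpf (T 1 1) = \<phi> Gx" "tpf (T 1 2) = \<phi> Gu" "tpf (T 2 1) = \<phi> Gv" "tpf (T 2 2) = \<phi> Gy"
  "chr (T 1 1) = 1" "chr (T 1 2) = t" "chr (T 2 1) = 0" "chr (T 2 2) = 1"
  unfolding gen_T[symmetric] by (simp_all add: tpf_chr_gen counit_gen_def)

lemmas eval_rules = tpf_simps chr_simps tpf_chr_T tpf_chr_T[unfolded One_nat_def] CEv_simps CEv_T

lemma TE_rels:
  assumes "r \<in> sl_rels h"
  shows "free_eval tri_alg (tri_gen t \<phi>) r = \<zero>\<^bsub>tri_alg\<^esub>"
proof -
  have tw: "t * \<phi> Gx = 2 * h * \<phi> Gx" "t * \<phi> Gy = 2 * h * \<phi> Gy" "t * \<phi> Gv = 2 * h * \<phi> Gv"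
    by (simp_all add: \<phi>_twist)
  have gx: "\<phi> Gx = h * \<phi> Gv - \<phi> Gy" using \<phi>_det by (simp add: eq_diff_eq)
  have "tpf r = 0 \<and> chr r = 0"
    using assms unfolding sl_rels_def Let_def gen_T insert_iff empty_iff
    by (elim disjE FalseE; hypsubst; simp add: eval_rules power2_eq_square)
      (use tw gx in \<open>auto simp: algebra_simps\<close>)
  then show ?thesis by (simp add: TE_eq CEv_rels[OF assms])
qed

definition hfun :: "free_poly set \<Rightarrow> complex" where
  "hfun X = fst (snd (gen_hom tri_alg (tri_gen t \<phi>) X))"

lemma hfun_slq: "hfun (slq h p) = tpf p"
  by (simp add: hfun_def tpf_def TE.gen_hom_slq[OF TE_rels])

lemma hfun_linear: "linear_map (SLh h) complex_alg hfun"
  by (rule linear_mapI) (auto simp: SLh_carrier hfun_slq tpf_simps simp flip: slq_add slq_scale)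

lemma tpf_cong: "slq h p = slq h r \<Longrightarrow> tpf p = tpf r"
  by (metis hfun_slq)

lemma tpf_shift: "tpf (shift c k) = shift (\<lambda>k. tpf (c k)) k"
  by (simp add: shift_def tpf_simps)

text \<open>For \<open>a \<le> n\<close>, \<open>dmat_col\<close> allows \<open>X'\<close> to be
  appended instead of \<open>Y'\<close>. The character is \<open>1\<close> on \<open>x\<close> and
  \<open>0\<close> on \<open>v\<close>, so the old value survives from the first term only, and the
  remaining contributions come from the counit, where \<open>dmat\<close> is the identity
  matrix.\<close>

lemma tpf_dmat_Suc:
  assumes "a \<le> n"
  shows "tpf (dmat h (Suc n) a k) = tpf (dmat h n a k) + (if k = a then \<phi> Gx + kap h n k * \<phi> Gv else 0)
    + (if k = Suc a then \<phi> Gv else 0)"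
proof -
  have "tpf (dmat h (Suc n) a k) = tpf (col h n (dmat h n a) 1 k)"
    by (rule tpf_cong[OF dmat_col[OF assms, symmetric]])
  also have "\<dots> = tpf (dmat h n a k) + (if k = a then \<phi> Gx + kap h n k * \<phi> Gv else 0)
    + (if k = Suc a then \<phi> Gv else 0)"
    using assms by (auto simp: col_def eval_rules CEv_dmat shift_def split: if_splits)
  finally show ?thesis .
qed

lemma tpf_dmat_last:
  "tpf (dmat h (Suc n) (Suc n) k) = (if k = n then \<phi> Gu + kap h n k * \<phi> Gy else 0)
    + (if k = Suc n then \<phi> Gy else 0)
    + t * tpf (dmat h n n k) + kap h n k * tpf (dmat h n n k) + shift (\<lambda>k. tpf (dmat h n n k)) k
    - kap h n n * (tpf (dmat h n n k) + (if k = n then \<phi> Gx + kap h n k * \<phi> Gv else 0)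
      + (if k = Suc n then \<phi> Gv else 0))"
  by (auto simp: col_def eval_rules CEv_dmat tpf_shift shift_def algebra_simps
      split: if_splits)

end

section \<open>Raising and lowering functionals\<close>

interpretation RE: twisted_primitive h 0 "\<lambda>a. if a = Gu then 1 else 0" for h
  by unfold_locales auto

text \<open>With the value \<open>1\<close> on \<open>Gv\<close> the twist has to be
  \<open>2 * h\<close>, and the determinant condition asks the values on \<open>Gx\<close> and
  \<open>Gy\<close> to add up to \<open>h\<close>.\<close>

interpretation LO: twisted_primitive h "2 * h" "\<lambda>a. if a = Gy then h else if a = Gv then 1 else 0" for h
  by unfold_locales auto

text \<open>Since \<open>\<phi>\<close> is supported on \<open>Gu\<close>, a column
  \<open>a \<le> n\<close> keeps its values when the degree grows. A new last column takes its entry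
  above the diagonal from the previous one through \<open>shift\<close> and adds \<open>1\<close>,
  which yields the values \<open>1, 2, ...\<close>.\<close>

lemma raising_dmat:
  "a \<le> n \<Longrightarrow> a \<le> k \<Longrightarrow> RE.tpf (dmat h n a k) = 0"
  "Suc k \<le> n \<Longrightarrow> RE.tpf (dmat h n (Suc k) k) = of_nat (Suc k)"
proof -
  have "a \<le> n \<Longrightarrow> (a \<le> k \<longrightarrow> RE.tpf (dmat h n a k) = 0) \<and>
    (a = Suc k \<longrightarrow> RE.tpf (dmat h n a k) = of_nat a)" for a k
  proof (induct n arbitrary: a k)
    case 0
    then show ?case by (auto simp: RE.tpf_simps)
  next
    case (Suc n)
    show ?case
    proof (cases "a \<le> n")
      case True
      then show ?thesis using Suc.hyps by (auto simp: RE.tpf_dmat_Suc simp del: dmat.simps)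
    next
      case False
      then have a: "a = Suc n" using Suc.prems by simp
      show ?thesis
        using Suc.hyps[of n k] Suc.hyps[of n "k - 1"]
        unfolding a RE.tpf_dmat_last by (auto simp: shift_def simp del: dmat.simps)
    qed
  qed
  note * = this
  show "a \<le> n \<Longrightarrow> a \<le> k \<Longrightarrow> RE.tpf (dmat h n a k) = 0" using *[of a k] by blast
  show "Suc k \<le> n \<Longrightarrow> RE.tpf (dmat h n (Suc k) k) = of_nat (Suc k)" using *[of "Suc k" k] by blast
qed

text \<open>Below the diagonal, each increase of the degree beyond \<open>a\<close> adds
  \<open>\<phi> Gv = 1\<close> in row \<open>a + 1\<close> and nothing elsewhere. The count starts
  in degree \<open>a\<close>, where all rows beyond \<open>a\<close> vanish.\<close>

lemma lowering_dmat:
  "a \<le> n \<Longrightarrow> a < k \<Longrightarrow> LO.tpf h (dmat h n a k) = (if k = Suc a then of_nat (n - a) else 0)"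
proof (induct n arbitrary: a k)
  case 0
  then show ?case by (auto simp: LO.tpf_simps)
next
  case (Suc n)
  show ?case
  proof (cases "a \<le> n")
    case True
    then show ?thesis using Suc by (auto simp: LO.tpf_dmat_Suc Suc_diff_le)
  next
    case False
    then show ?thesis using Suc.prems by (simp add: dmat_support LO.tpf_simps)
  qed
qed

subsection \<open>Ordered monomials in the quantum plane\<close>

lemma (in calg) list_prod_closed: "set bs \<subseteq> carrier A \<Longrightarrow> list_prod A bs \<in> carrier A"
  by (induct bs) (auto simp: list_prod_def)

lemma (in calg) list_prod_snoc:
  "set bs \<subseteq> carrier A \<Longrightarrow> b \<in> carrier A \<Longrightarrow> list_prod A (bs @ [b]) = list_prod A bs \<otimes> b"
proof (induct bs)
  case Nil
  then show ?case by (simp add: list_prod_def)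
next
  case (Cons a bs)
  then show ?case
    using list_prod_closed[of bs] by (simp add: list_prod_def m_assoc)
qed

locale h_plane = calg A for A :: "(complex, 'a) module" (structure) +
  fixes h :: complex and X Y :: 'a
  assumes X [simp]: "X \<in> carrier A" and Y [simp]: "Y \<in> carrier A"
    and comm: "X \<otimes> Y = Y \<otimes> X \<oplus> h \<odot> (X \<otimes> X)"
begin

definition fac :: "complex \<Rightarrow> 'a" where
  "fac c = Y \<oplus> c \<odot> X"

definition L :: "nat \<Rightarrow> 'a" where
  "L a = list_prod A (map (\<lambda>i. fac (of_nat i * h)) [0..<a])"

definition W :: "nat \<Rightarrow> nat \<Rightarrow> 'a" where
  "W n a = L a \<otimes> X [^] (n - a)"

lemma fac_closed [simp]: "fac c \<in> carrier A"
  by (simp add: fac_def)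

lemma fac_set: "set (map (\<lambda>i. fac (f i)) xs) \<subseteq> carrier A"
  by auto

lemma L_closed [simp]: "L a \<in> carrier A"
  unfolding L_def by (rule list_prod_closed[OF fac_set])

lemma L_Suc: "L (Suc a) = L a \<otimes> fac (of_nat a * h)"
  unfolding L_def by (simp add: list_prod_snoc[OF fac_set])

lemma W_closed [simp]: "W n a \<in> carrier A"
  by (simp add: W_def)

lemma X_fac: "X \<otimes> fac c = fac (c + h) \<otimes> X"
  by (simp add: fac_def r_distr l_distr comm smult_mult_left smult_mult_right smult_l_distr a_ac)

lemma Xpow_fac: "X [^] b \<otimes> fac c = fac (c + of_nat b * h) \<otimes> X [^] (b::nat)"
proof (induct b arbitrary: c)
  case (Suc b)
  have "X [^] Suc b \<otimes> fac c = X [^] b \<otimes> (X \<otimes> fac c)"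
    by (simp add: m_assoc)
  also have "\<dots> = (X [^] b \<otimes> fac (c + h)) \<otimes> X"
    by (simp add: X_fac m_assoc)
  also have "\<dots> = fac (c + of_nat (Suc b) * h) \<otimes> X [^] Suc b"
    unfolding Suc by (simp add: m_assoc algebra_simps)
  finally show ?case .
qed simp

lemma Xpow_list_prod:
  "X [^] b \<otimes> list_prod A (map (\<lambda>i. fac (f i)) xs) =
   list_prod A (map (\<lambda>i. fac (f i + of_nat b * h)) xs) \<otimes> X [^] (b::nat)"
proof (induct xs rule: rev_induct)
  case Nil
  then show ?case by (simp add: list_prod_def)
next
  case (snoc x xs)
  note [simp] = list_prod_closed[OF fac_set]
  have "X [^] b \<otimes> list_prod A (map (\<lambda>i. fac (f i)) (xs @ [x])) =
      (X [^] b \<otimes> list_prod A (map (\<lambda>i. fac (f i)) xs)) \<otimes> fac (f x)"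
    by (simp add: list_prod_snoc[OF fac_set] m_assoc)
  also have "\<dots> = list_prod A (map (\<lambda>i. fac (f i + of_nat b * h)) xs) \<otimes> (X [^] b \<otimes> fac (f x))"
    unfolding snoc by (simp add: m_assoc)
  also have "\<dots> = list_prod A (map (\<lambda>i. fac (f i + of_nat b * h)) (xs @ [x])) \<otimes> X [^] b"
    by (simp add: Xpow_fac list_prod_snoc[OF fac_set] m_assoc)
  finally show ?case .
qed

lemma W_zero: "W 0 0 = \<one>"
  by (simp add: W_def L_def list_prod_def)

lemma W_Suc_0: "W (Suc n) 0 = W n 0 \<otimes> X"
  by (simp add: W_def m_assoc)

text \<open>Moving a linear factor to the left across \<open>n - a\<close> copies of
  \<open>X\<close> adds \<open>(n - a) h\<close> to its constant. This turns
  \<open>- (n - 2a) h\<close> into \<open>a h\<close>, the constant of the next factor of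
  \<open>L\<close>.\<close>

lemma W_Suc_Suc:
  assumes "a \<le> n"
  shows "W (Suc n) (Suc a) = W n a \<otimes> Y \<oplus> (- kap h n a) \<odot> (W n a \<otimes> X)"
proof -
  have "- kap h n a + of_nat (n - a) * h = of_nat a * h"
    using assms by (simp add: kap_def of_nat_diff algebra_simps)
  then have "X [^] (n - a) \<otimes> fac (- kap h n a) = fac (of_nat a * h) \<otimes> X [^] (n - a)"
    by (simp add: Xpow_fac)
  then have "W (Suc n) (Suc a) = W n a \<otimes> fac (- kap h n a)"
    by (simp add: W_def L_Suc m_assoc)
  then show ?thesis
    by (simp add: fac_def r_distr smult_mult_right)
qed

end

section \<open>Expansion of the transformed monomials\<close>

lemma (in slh_alg_tensor) expansion_step:
  assumes XY: "X \<in> carrier A" "Y \<in> carrier A"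
    and Z: "\<And>n k. Z n k \<in> carrier A"
    and ZX: "\<And>n k. k \<le> n \<Longrightarrow> Z n k \<otimes> X = Z (Suc n) k"
    and ZY: "\<And>n k. k \<le> n \<Longrightarrow> Z n k \<otimes> Y = Z (Suc n) (Suc k) \<oplus> kap h n k \<odot> Z (Suc n) k"
    and c: "\<And>k. k > n \<Longrightarrow> c k = 0"
  shows "(\<Oplus>\<^bsub>VH\<^esub>m\<in>{..n}. tq (Z n m) (c m)) \<otimes>\<^bsub>VH\<^esub> (tq X (T 1 i) \<oplus>\<^bsub>VH\<^esub> tq Y (T 2 i)) =
    (\<Oplus>\<^bsub>VH\<^esub>m\<in>{..Suc n}. tq (Z (Suc n) m) (col h n c i m))"
proof -
  have "(\<Oplus>\<^bsub>VH\<^esub>m\<in>{..n}. tq (Z n m) (c m)) \<otimes>\<^bsub>VH\<^esub> (tq X (T 1 i) \<oplus>\<^bsub>VH\<^esub> tq Y (T 2 i)) =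
    (\<Oplus>\<^bsub>VH\<^esub>m\<in>{..n}. tq (Z n m \<otimes> X) (c m * T 1 i) \<oplus>\<^bsub>VH\<^esub> tq (Z n m \<otimes> Y) (c m * T 2 i))"
    by (rule tq_sum_mult[OF Z XY]) simp
  also have "\<dots> = (\<Oplus>\<^bsub>VH\<^esub>m\<in>{..n}. tq (Z (Suc n) m) (c m * T 1 i) \<oplus>\<^bsub>VH\<^esub>
      tq (Z (Suc n) (Suc m) \<oplus> kap h n m \<odot> Z (Suc n) m) (c m * T 2 i))"
    by (rule finsum_cong_simp[OF VH.T.cvs_axioms refl]) (simp_all add: ZX ZY Z)
  also have "\<dots> = (\<Oplus>\<^bsub>VH\<^esub>m\<in>{..Suc n}. tq (Z (Suc n) m) (col h n c i m))"
    by (rule regroup[OF Z c])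
  finally show ?thesis .
qed

text \<open>The family \<open>Z\<close> is described only by its start and its two multiplication
  rules, which can be checked directly for operators on polynomials. The relation between
  \<open>X\<close> and \<open>Y\<close> is derived from these rules in low degree.\<close>

locale plane_expansion = slh_alg_tensor A h for A :: "(complex, 'a) module" (structure) and h +
  fixes X Y :: 'a and Z :: "nat \<Rightarrow> nat \<Rightarrow> 'a"
  assumes X [simp]: "X \<in> carrier A" and Y [simp]: "Y \<in> carrier A"
    and Z [simp]: "Z n k \<in> carrier A"
    and Z_zero: "Z 0 0 = \<one>"
    and ZX: "k \<le> n \<Longrightarrow> Z n k \<otimes> X = Z (Suc n) k"
    and ZY: "k \<le> n \<Longrightarrow> Z n k \<otimes> Y = Z (Suc n) (Suc k) \<oplus> kap h n k \<odot> Z (Suc n) k"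
begin

definition X' where "X' = tq X (T 1 1) \<oplus>\<^bsub>VH\<^esub> tq Y (T 2 1)"
definition Y' where "Y' = tq X (T 1 2) \<oplus>\<^bsub>VH\<^esub> tq Y (T 2 2)"

definition E where "E n c = (\<Oplus>\<^bsub>VH\<^esub>m\<in>{..n}. tq (Z n m) (c m))"

lemma E_closed [simp]: "E n c \<in> carrier VH"
  by (simp add: E_def Pi_iff)

lemma E_X': "(\<And>k. k > n \<Longrightarrow> c k = 0) \<Longrightarrow> E n c \<otimes>\<^bsub>VH\<^esub> X' = E (Suc n) (col h n c 1)"
  unfolding E_def X'_def by (rule expansion_step[OF X Y Z ZX ZY])

lemma E_Y': "(\<And>k. k > n \<Longrightarrow> c k = 0) \<Longrightarrow> E n c \<otimes>\<^bsub>VH\<^esub> Y' = E (Suc n) (col h n c 2)"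
  unfolding E_def Y'_def by (rule expansion_step[OF X Y Z ZX ZY])

lemma E_cong: "(\<And>k. slq h (c k) = slq h (d k)) \<Longrightarrow> E n c = E n d"
  unfolding E_def by (simp add: tq_cong[of "c _" "d _"])

lemma E_lincomb: "E n (\<lambda>k. c k - pm_scale s (d k)) = E n c \<oplus>\<^bsub>VH\<^esub> (- s) \<odot>\<^bsub>VH\<^esub> E n d"
  unfolding E_def by (rule tq_sum_diff[OF Z])

lemma E_one: "E 0 (dmat h 0 0) = \<one>\<^bsub>VH\<^esub>"
  by (simp add: E_def Z_zero tq_one Pi_iff)

lemma E_dmat_X': "a \<le> n \<Longrightarrow> E n (dmat h n a) \<otimes>\<^bsub>VH\<^esub> X' = E (Suc n) (dmat h (Suc n) a)"
  by (simp only: E_X'[OF dmat_support]) (rule E_cong, rule dmat_col)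

lemma E_dmat_Y':
  assumes "a \<le> n"
  shows "E n (dmat h n a) \<otimes>\<^bsub>VH\<^esub> Y' \<oplus>\<^bsub>VH\<^esub> (- kap h n a) \<odot>\<^bsub>VH\<^esub> (E n (dmat h n a) \<otimes>\<^bsub>VH\<^esub> X') =
    E (Suc n) (dmat h (Suc n) (Suc a))"
proof -
  have "dmat h (Suc n) (Suc a) = (\<lambda>k. col h n (dmat h n a) 2 k - pm_scale (kap h n a) (col h n (dmat h n a) 1 k))"
    by (simp add: fun_eq_iff)
  then show ?thesis
    by (simp only: E_X'[OF dmat_support] E_Y'[OF dmat_support] E_lincomb)
qed

lemma X'_closed [simp]: "X' \<in> carrier VH" and Y'_closed [simp]: "Y' \<in> carrier VH"
  by (simp_all add: X'_def Y'_def)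

lemma X'_eq: "X' = E 1 (dmat h 1 0)"
  using E_dmat_X'[of 0 0] by (simp add: E_one)

lemma Y'_eq: "Y' = E 1 (dmat h 1 1)"
proof -
  have "\<one>\<^bsub>VH\<^esub> \<otimes>\<^bsub>VH\<^esub> Y' \<oplus>\<^bsub>VH\<^esub> (- kap h 0 0) \<odot>\<^bsub>VH\<^esub> (\<one>\<^bsub>VH\<^esub> \<otimes>\<^bsub>VH\<^esub> X') = Y'"
    by (simp add: kap_def)
  then show ?thesis
    using E_dmat_Y'[of 0 0] by (simp only: E_one le_refl One_nat_def)
qed

text \<open>The expansion with coefficients \<open>dmat h 2 1\<close> is reached in two ways: as
  \<open>Y' X'\<close>, and as \<open>X' Y' - h X' X'\<close> because
  \<open>kap h 1 0 = h\<close>.\<close>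

lemma X'Y': "X' \<otimes>\<^bsub>VH\<^esub> Y' = Y' \<otimes>\<^bsub>VH\<^esub> X' \<oplus>\<^bsub>VH\<^esub> h \<odot>\<^bsub>VH\<^esub> (X' \<otimes>\<^bsub>VH\<^esub> X')"
proof -
  have "X' \<otimes>\<^bsub>VH\<^esub> Y' \<oplus>\<^bsub>VH\<^esub> (- h) \<odot>\<^bsub>VH\<^esub> (X' \<otimes>\<^bsub>VH\<^esub> X') = E (Suc 1) (dmat h (Suc 1) (Suc 0))"
    using E_dmat_Y'[of 0 1] by (simp add: kap_def X'_eq[unfolded One_nat_def, symmetric] del: dmat.simps)
  moreover have "Y' \<otimes>\<^bsub>VH\<^esub> X' = E (Suc 1) (dmat h (Suc 1) (Suc 0))"
    using E_dmat_X'[of 1 1] by (simp add: Y'_eq[unfolded One_nat_def, symmetric] del: dmat.simps)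
  ultimately have "Y' \<otimes>\<^bsub>VH\<^esub> X' = X' \<otimes>\<^bsub>VH\<^esub> Y' \<oplus>\<^bsub>VH\<^esub> (- h) \<odot>\<^bsub>VH\<^esub> (X' \<otimes>\<^bsub>VH\<^esub> X')"
    by simp
  then show ?thesis
    by (simp add: VH.T.a_assoc VH.T.smult_l_distr[symmetric])
qed

sublocale P': h_plane VH h X' Y'
  by (rule h_plane.intro[OF VH.TA.calg_axioms]; unfold_locales) (simp_all add: X'Y')

lemma W'_expansion: "a \<le> n \<Longrightarrow> P'.W n a = (\<Oplus>\<^bsub>VH\<^esub>m\<in>{..n}. tq (Z n m) (dmat h n a m))"
proof -
  have "a \<le> n \<Longrightarrow> P'.W n a = E n (dmat h n a)"
  proof (induct n arbitrary: a)
    case 0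
    then show ?case by (simp only: le_zero_eq P'.W_zero E_one)
  next
    case (Suc n)
    show ?case
    proof (cases a)
      case 0
      show ?thesis unfolding 0 by (simp only: P'.W_Suc_0 Suc.hyps E_dmat_X' le0)
    next
      case (Suc b)
      then have b: "b \<le> n" using Suc.prems by simp
      show ?thesis unfolding Suc by (simp only: P'.W_Suc_Suc[OF b] Suc.hyps[OF b] E_dmat_Y'[OF b])
    qed
  qed
  then show "a \<le> n \<Longrightarrow> P'.W n a = (\<Oplus>\<^bsub>VH\<^esub>m\<in>{..n}. tq (Z n m) (dmat h n a m))"
    by (simp only: E_def)
qed

end

subsection \<open>Power series in a locally nilpotent operator\<close>

lemma scale2_simps:
  "scale2 c (p + r) = scale2 c p + scale2 c r" "scale2 (a + b) p = scale2 a p + scale2 b p"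
  "scale2 a (scale2 b p) = scale2 (a * b) p" "scale2 1 p = p" "scale2 0 p = 0" "scale2 c 0 = 0"
  "p * scale2 c r = scale2 c (p * r)" "scale2 c p * r = scale2 c (p * r)"
  "pderiv (scale2 c p) = scale2 c (pderiv p)"
  by (simp_all add: scale2_def smult_add_right smult_add_left pderiv_smult
      flip: one_pCons)
    (simp_all add: mult.commute flip: smult_add_left)

lemma scale2_sum: "scale2 c (sum f A) = (\<Sum>i\<in>A. scale2 c (f i))"
  by (induct A rule: infinite_finite_induct) (simp_all add: scale2_simps)

lemma scale2_sum_left: "scale2 (sum f A) p = (\<Sum>i\<in>A. scale2 (f i) p)"
  by (induct A rule: infinite_finite_induct) (simp_all add: scale2_simps)

lemma vector_space_scale2: "vector_space scale2"
  by unfold_locales (simp_all add: scale2_simps)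

definition nil_op :: "complex \<Rightarrow> poly2 \<Rightarrow> poly2" where
  "nil_op h p = scale2 (2 * h) (var_xi * pderiv p)"

lemma nil_op_simps:
  "nil_op h (p + r) = nil_op h p + nil_op h r" "nil_op h (scale2 c p) = scale2 c (nil_op h p)"
  "nil_op h 0 = 0"
  by (simp_all add: nil_op_def scale2_simps pderiv_add algebra_simps)

lemma nil_op_pow_simps:
  "(nil_op h ^^ k) (p + r) = (nil_op h ^^ k) p + (nil_op h ^^ k) r"
  "(nil_op h ^^ k) (scale2 c p) = scale2 c ((nil_op h ^^ k) p)" "(nil_op h ^^ k) 0 = 0"
  by (induct k) (simp_all add: nil_op_simps)

lemma degree_scale2: "Polynomial.degree (scale2 c p) \<le> Polynomial.degree p"
  unfolding scale2_def by (rule degree_smult_le)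

lemma var_xi_mult: "var_xi * p = Polynomial.smult [:0, 1:] p"
  by (simp add: var_xi_def)

lemma degree_var_xi_mult: "Polynomial.degree (var_xi * p) \<le> Polynomial.degree p"
  unfolding var_xi_mult by (rule degree_smult_le)

lemma degree_nil_op: "Polynomial.degree (nil_op h p) \<le> Polynomial.degree p - 1"
  unfolding nil_op_def
  by (rule order_trans[OF degree_scale2 order_trans[OF degree_var_xi_mult]]) (simp add: degree_pderiv)

lemma nil_op_degree_0: "Polynomial.degree p = 0 \<Longrightarrow> nil_op h p = 0"
  using pderiv_eq_0_iff[of p] by (simp add: nil_op_def scale2_simps)

lemma nil_op_pow_zero: "Polynomial.degree p < k \<Longrightarrow> (nil_op h ^^ k) p = 0"
proof (induct k arbitrary: p)
  case (Suc k)
  show ?case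
  proof (cases "Polynomial.degree p = 0")
    case True
    then show ?thesis by (simp add: nil_op_degree_0 nil_op_pow_simps funpow_Suc_right del: funpow.simps)
  next
    case False
    then have "Polynomial.degree (nil_op h p) < k" using degree_nil_op[of h p] Suc.prems by linarith
    then show ?thesis using Suc.hyps by (simp add: funpow_Suc_right del: funpow.simps)
  qed
qed simp

text \<open>Each application of \<open>nil_op\<close> lowers the degree in \<open>\<eta>\<close>, so
  truncation at that degree loses nothing. Products of series become composites of operators, which
  reduces operator identities to identities of formal power series.\<close>

definition fps_op :: "complex \<Rightarrow> complex fps \<Rightarrow> poly2 \<Rightarrow> poly2" where
  "fps_op h f p = (\<Sum>k\<le>Polynomial.degree p. scale2 (fps_nth f k) ((nil_op h ^^ k) p))"

lemma fps_op_bound: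
  "Polynomial.degree p \<le> d \<Longrightarrow> fps_op h f p = (\<Sum>k\<le>d. scale2 (fps_nth f k) ((nil_op h ^^ k) p))"
  unfolding fps_op_def
  by (rule sum.mono_neutral_left) (auto simp: nil_op_pow_zero scale2_simps)

lemma nil_series_eq: "nil_series a (nil_op h) p = fps_op h (Abs_fps a) p"
  unfolding nil_series_def fps_op_def
  by (rule sum.mono_neutral_cong_left) (auto simp: scale2_simps, meson linorder_not_le nil_op_pow_zero)

lemma fps_op_add: "fps_op h f (p + r) = fps_op h f p + fps_op h f r"
proof -
  define d where "d = max (Polynomial.degree p) (Polynomial.degree r)"
  have "Polynomial.degree p \<le> d" "Polynomial.degree r \<le> d" "Polynomial.degree (p + r) \<le> d"
    by (simp_all add: d_def degree_add_le)
  then show ?thesis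
    by (simp add: fps_op_bound[of _ d] nil_op_pow_simps scale2_simps sum.distrib)
qed

lemma fps_op_scale2: "fps_op h f (scale2 c p) = scale2 c (fps_op h f p)"
  by (subst fps_op_bound[OF degree_scale2])
    (simp add: fps_op_def nil_op_pow_simps scale2_simps scale2_sum mult.commute)

lemma fps_op_0: "fps_op h f 0 = 0"
  by (simp add: fps_op_def scale2_simps)

lemma fps_op_sum: "fps_op h f (sum g A) = (\<Sum>i\<in>A. fps_op h f (g i))"
  by (induct A rule: infinite_finite_induct) (simp_all add: fps_op_add fps_op_0)

lemma degree_nil_op_pow: "Polynomial.degree ((nil_op h ^^ k) p) \<le> Polynomial.degree p"
proof (induct k)
  case (Suc k)
  then show ?case using degree_nil_op[of h "(nil_op h ^^ k) p"] by simp
qed simp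

lemma fps_op_mult: "fps_op h (f * g) p = fps_op h f (fps_op h g p)"
proof -
  define d where "d = Polynomial.degree p"
  define s where "s i j = scale2 (fps_nth f i * fps_nth g j) ((nil_op h ^^ (i + j)) p)" for i j
  have "fps_op h f (fps_op h g p) = (\<Sum>j\<le>d. scale2 (fps_nth g j) (fps_op h f ((nil_op h ^^ j) p)))"
    unfolding fps_op_def[of h g] fps_op_sum fps_op_scale2 d_def ..
  also have "\<dots> = (\<Sum>j\<le>d. \<Sum>i\<le>d. s i j)"
    by (intro sum.cong refl)
      (simp add: fps_op_bound[of _ d] d_def degree_nil_op_pow scale2_sum scale2_simps s_def
        funpow_add mult.commute)
  also have "\<dots> = (\<Sum>i\<le>d. \<Sum>j\<le>d. s i j)" by (rule sum.swap)
  also have "\<dots> = (\<Sum>(i, j)\<in>{..d} \<times> {..d}. s i j)" by (rule sum.cartesian_product)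
  \<comment> \<open>Terms with \<open>i + j > d\<close> vanish by nilpotency, which leaves exactly
    the triangle of the Cauchy product.\<close>
  also have "\<dots> = (\<Sum>(i, j)\<in>{(i, j). i + j \<le> d}. s i j)"
  proof (rule sum.mono_neutral_right)
    have "s i j = 0" if "\<not> i + j \<le> d" for i j
      using that by (simp add: s_def d_def nil_op_pow_zero scale2_simps)
    then show "\<forall>x\<in>{..d} \<times> {..d} - {(i, j). i + j \<le> d}. (case x of (i, j) \<Rightarrow> s i j) = 0"
      by auto
  qed auto
  also have "\<dots> = (\<Sum>k\<le>d. \<Sum>i\<le>k. s i (k - i))"
    by (rule sum.triangle_reindex_eq)
  also have "\<dots> = fps_op h (f * g) p"
    unfolding fps_op_def d_def[symmetric]
    by (intro sum.cong refl) (simp add: s_def fps_mult_nth scale2_sum_left atLeast0AtMost)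
  finally show ?thesis by simp
qed

lemma fps_op_1: "fps_op h 1 p = p"
proof -
  have "fps_op h 1 p = (\<Sum>k\<le>Polynomial.degree p. if k = 0 then p else 0)"
    unfolding fps_op_def by (intro sum.cong refl) (simp add: scale2_simps)
  then show ?thesis by (simp add: sum.delta)
qed

lemma nil_op_xi: "nil_op h (var_xi * p) = var_xi * nil_op h p"
  by (simp add: nil_op_def var_xi_mult pderiv_smult scale2_def mult.commute)

lemma nil_op_pow_xi: "(nil_op h ^^ k) (var_xi * p) = var_xi * (nil_op h ^^ k) p"
  by (induct k) (simp_all add: nil_op_xi)

lemma fps_op_xi: "fps_op h f (var_xi * p) = var_xi * fps_op h f p"
  by (subst fps_op_bound[OF degree_var_xi_mult])
    (simp add: fps_op_def nil_op_pow_xi sum_distrib_left scale2_simps)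

lemma nil_op_eta: "nil_op h (var_eta * p) = var_eta * nil_op h p + scale2 (2 * h) (var_xi * p)"
proof -
  have "pderiv var_eta = 1" by (simp add: var_eta_def pderiv_pCons)
  then show ?thesis by (simp add: nil_op_def pderiv_mult scale2_simps algebra_simps)
qed

lemma nil_op_pow_eta:
  "(nil_op h ^^ k) (var_eta * p) =
    var_eta * (nil_op h ^^ k) p + scale2 (2 * h * of_nat k) (var_xi * (nil_op h ^^ (k - 1)) p)"
proof (induct k)
  case (Suc k)
  show ?case
  proof (cases k)
    case 0
    then show ?thesis by (simp add: nil_op_eta)
  next
    case (Suc l)
    have "(nil_op h ^^ Suc k) (var_eta * p) = nil_op h (var_eta * (nil_op h ^^ k) p) +
        nil_op h (scale2 (2 * h * of_nat k) (var_xi * (nil_op h ^^ (k - 1)) p))"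
      by (simp add: Suc.hyps nil_op_simps)
    also have "\<dots> = var_eta * (nil_op h ^^ Suc k) p + scale2 (2 * h) (var_xi * (nil_op h ^^ k) p)
        + scale2 (2 * h * of_nat k) (var_xi * (nil_op h ^^ k) p)"
      by (simp add: nil_op_eta nil_op_simps nil_op_xi Suc)
    finally show ?thesis by (simp add: algebra_simps flip: scale2_simps(2))
  qed
qed (simp add: scale2_simps)

text \<open>With \<open>N = nil_op h\<close>, the commutator \<open>[N, \<eta>]\<close> is
  multiplication by \<open>2 h \<xi>\<close>, which commutes with \<open>N\<close>. Hence
  \<open>[f(N), \<eta>] = 2 h \<xi> f'(N)\<close>.\<close>

lemma fps_op_eta:
  "fps_op h f (var_eta * p) = var_eta * fps_op h f p + scale2 (2 * h) (var_xi * fps_op h (fps_deriv f) p)"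
proof -
  define d where "d = Polynomial.degree p"
  have "Polynomial.degree (var_eta * p) \<le> Suc d"
    using degree_mult_le[of var_eta p] by (simp add: var_eta_def d_def)
  then have "fps_op h f (var_eta * p) =
      (\<Sum>k\<le>Suc d. var_eta * scale2 (fps_nth f k) ((nil_op h ^^ k) p)) +
      (\<Sum>k\<le>Suc d. scale2 (2 * h) (var_xi * scale2 (of_nat k * fps_nth f k) ((nil_op h ^^ (k - 1)) p)))"
    by (simp add: fps_op_bound nil_op_pow_eta scale2_simps sum.distrib algebra_simps del: sum.atMost_Suc)
  also have "(\<Sum>k\<le>Suc d. var_eta * scale2 (fps_nth f k) ((nil_op h ^^ k) p)) = var_eta * fps_op h f p"
    by (simp add: fps_op_bound[of p "Suc d"] d_def sum_distrib_left del: sum.atMost_Suc)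
  also have "(\<Sum>k\<le>Suc d. scale2 (2 * h) (var_xi * scale2 (of_nat k * fps_nth f k) ((nil_op h ^^ (k - 1)) p)))
      = scale2 (2 * h) (var_xi * fps_op h (fps_deriv f) p)"
    unfolding fps_op_def d_def[symmetric] sum_distrib_left scale2_sum
    by (subst sum.atMost_Suc_shift) (simp add: scale2_simps)
  finally show ?thesis .
qed

subsection \<open>The operators \<open>e\<^bsup>t\<sigma>\<^esup>\<close>\<close>

definition log_fps :: "complex fps" where
  "log_fps = Abs_fps (\<lambda>k. if k = 0 then 0 else 1 / of_nat k)"

text \<open>The binomial series of \<open>1 - x\<close> to the power \<open>- t\<close>.\<close>

definition exp_log :: "complex \<Rightarrow> complex fps" where
  "exp_log t = fps_exp t oo log_fps"

lemma log_fps_0: "fps_nth log_fps 0 = 0"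
  by (simp add: log_fps_def)

lemma exp_log_add: "exp_log (s + t) = exp_log s * exp_log t"
  by (simp add: exp_log_def fps_exp_add_mult fps_compose_mult_distrib log_fps_0)

lemma exp_log_zero: "exp_log 0 = 1"
  by (simp add: exp_log_def)

lemma exp_log_deriv: "fps_deriv (exp_log t) = fps_const t * exp_log (t + 1)"
proof -
  have d: "fps_deriv (exp_log t) = fps_const t * exp_log t * fps_deriv log_fps" for t
    unfolding exp_log_def
    by (simp add: fps_compose_deriv log_fps_0 fps_compose_mult_distrib)
  have l: "(1 - fps_X) * fps_deriv log_fps = 1"
  proof (rule fps_ext)
    fix n
    show "fps_nth ((1 - fps_X) * fps_deriv log_fps) n = fps_nth 1 n"
      by (cases n) (simp_all add: algebra_simps log_fps_def del: of_nat_Suc)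
  qed
  \<comment> \<open>\<open>exp_log 1\<close> turns out to be the geometric series: its product with
    \<open>1 - fps_X\<close> has derivative zero and constant term \<open>1\<close>. So it coincides
    with the derivative of \<open>log_fps\<close>, which explains the shift from \<open>t\<close> to
    \<open>t + 1\<close>.\<close>
  have "fps_deriv (exp_log 1 * (1 - fps_X)) = exp_log 1 * ((1 - fps_X) * fps_deriv log_fps) - exp_log 1"
    by (simp add: d algebra_simps)
  then have "fps_deriv (exp_log 1 * (1 - fps_X)) = 0" by (simp add: l)
  then have "exp_log 1 * (1 - fps_X) = fps_const (fps_nth (exp_log 1 * (1 - fps_X)) 0)"
    by (simp only: fps_deriv_eq_0_iff)
  then have e: "exp_log 1 * (1 - fps_X) = 1"
    by (simp add: exp_log_def)
  have "fps_deriv log_fps = exp_log 1 * ((1 - fps_X) * fps_deriv log_fps)"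
    by (metis e mult.assoc mult_1_left)
  then have "fps_deriv log_fps = exp_log 1" by (simp add: l)
  then show ?thesis by (simp add: d exp_log_add mult.assoc)
qed

lemma sigma_eq: "\<sigma>_op h = fps_op h log_fps"
  unfolding \<sigma>_op_def op_neg_ln_one_minus_def log_fps_def fun_eq_iff
  using nil_series_eq[of "\<lambda>k. if k = 0 then 0 else 1 / of_nat k" h] by (simp add: nil_op_def[abs_def])

text \<open>The exponential of an operator that is itself a series. The power
  \<open>log_fps ^ k\<close> starts in degree \<open>k\<close>, so on a polynomial of degree
  \<open>d\<close> both summations stop at \<open>d\<close>; exchanging them gives the coefficients
  of the composed series.\<close>

lemma exp_sigma_eq: "exp_\<sigma> h t = fps_op h (exp_log (of_real t))"
proof
  fix p :: poly2
  define d where "d = Polynomial.degree p"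
  define S where "S k = scale2 (of_real t ^ k) (fps_op h (log_fps ^ k) p)" for k
  have pow: "((\<lambda>p. scale2 (of_real t) (\<sigma>_op h p)) ^^ k) p = S k" for k
    unfolding S_def sigma_eq
    by (induct k) (simp_all add: fps_op_1 fps_op_scale2 scale2_simps fps_op_mult)
  have z: "S k = 0" if "k > d" for k
  proof -
    have "fps_op h (log_fps ^ k) p = 0"
      unfolding fps_op_def
      using startsby_zero_power_prefix[OF log_fps_0, of k] that
      by (intro sum.neutral) (auto simp: scale2_simps d_def)
    then show ?thesis by (simp add: S_def scale2_simps)
  qed
  have "exp_\<sigma> h t p = (\<Sum>k | S k \<noteq> 0. scale2 (1 / fact k) (S k))"
    unfolding exp_\<sigma>_def op_exp_def nil_series_def pow ..
  also have "\<dots> = (\<Sum>k\<le>d. scale2 (1 / fact k) (S k))"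
    by (rule sum.mono_neutral_left) (use z in \<open>auto simp: scale2_simps not_le[symmetric]\<close>)
  also have "\<dots> = (\<Sum>k\<le>d. \<Sum>n\<le>d. scale2 (of_real t ^ k / fact k * fps_nth (log_fps ^ k) n) ((nil_op h ^^ n) p))"
    unfolding S_def fps_op_def d_def by (simp add: scale2_sum scale2_simps)
  also have "\<dots> = (\<Sum>n\<le>d. scale2 (\<Sum>k\<le>d. of_real t ^ k / fact k * fps_nth (log_fps ^ k) n) ((nil_op h ^^ n) p))"
    by (subst sum.swap) (simp add: scale2_sum_left)
  also have "\<dots> = fps_op h (exp_log (of_real t)) p"
    unfolding fps_op_def d_def[symmetric]
  proof (intro sum.cong refl arg_cong2[of _ _ _ _ scale2])
    fix n assume n: "n \<in> {..d}"
    show "(\<Sum>k\<le>d. of_real t ^ k / fact k * fps_nth (log_fps ^ k) n) = fps_nth (exp_log (of_real t)) n"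
      unfolding exp_log_def fps_compose_nth
      using startsby_zero_power_prefix[OF log_fps_0] n
      by (intro sum.mono_neutral_cong_right) auto
  qed
  finally show "exp_\<sigma> h t p = fps_op h (exp_log (of_real t)) p" .
qed

lemma exp_sigma_linear:
  "exp_\<sigma> h t (p + r) = exp_\<sigma> h t p + exp_\<sigma> h t r" "exp_\<sigma> h t (scale2 c p) = scale2 c (exp_\<sigma> h t p)"
  by (simp_all add: exp_sigma_eq fps_op_add fps_op_scale2)

lemma exp_sigma_add: "exp_\<sigma> h s (exp_\<sigma> h t p) = exp_\<sigma> h (s + t) p"
  by (simp add: exp_sigma_eq exp_log_add fps_op_mult)

lemma exp_sigma_0: "exp_\<sigma> h 0 p = p"
  by (simp add: exp_sigma_eq exp_log_zero fps_op_1)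

lemma exp_sigma_xi: "exp_\<sigma> h t (var_xi * p) = var_xi * exp_\<sigma> h t p"
  by (simp add: exp_sigma_eq fps_op_xi)

lemma fps_op_const_mult: "fps_op h (fps_const c * f) p = scale2 c (fps_op h f p)"
  by (simp add: fps_op_def scale2_sum scale2_simps)

lemma exp_sigma_eta:
  "exp_\<sigma> h t (var_eta * p) =
    var_eta * exp_\<sigma> h t p + scale2 (2 * h * of_real t) (var_xi * exp_\<sigma> h (t + 1) p)"
  by (simp add: exp_sigma_eq fps_op_eta exp_log_deriv fps_op_const_mult scale2_simps)

lemma exp_sigma_1: "exp_\<sigma> h t 1 = 1"
  by (simp add: exp_sigma_eq fps_op_def exp_log_def scale2_simps)

subsection \<open>Tensor products of linear maps\<close>

lemma linear_map_id: "linear_map V V (\<lambda>x. x)"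
  by (simp add: linear_map_def)

lemma cvs_complex_alg: "cvs complex_alg"
  by (rule calg.axioms(1)[OF complex_alg_calg])

lemma linear_map_finsum_pointwise:
  assumes "cvs W" "\<And>i. i \<in> I \<Longrightarrow> linear_map V W (f i)"
  shows "linear_map V W (\<lambda>v. \<Oplus>\<^bsub>W\<^esub>i\<in>I. f i v)"
proof -
  interpret W: cvs W by fact
  have c: "f i v \<in> carrier W" if "i \<in> I" "v \<in> carrier V" for i v
    using linear_mapD(1)[OF assms(2)[OF that(1)] that(2)] .
  show ?thesis
  proof (rule linear_mapI)
    fix x y assume xy: "x \<in> carrier V" "y \<in> carrier V"
    have "(\<Oplus>\<^bsub>W\<^esub>i\<in>I. f i (x \<oplus>\<^bsub>V\<^esub> y)) = (\<Oplus>\<^bsub>W\<^esub>i\<in>I. f i x \<oplus>\<^bsub>W\<^esub> f i y)"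
      by (rule finsum_cong_simp[OF assms(1) refl])
        (use c xy linear_mapD(2)[OF assms(2)] in simp_all)
    then show "(\<Oplus>\<^bsub>W\<^esub>i\<in>I. f i (x \<oplus>\<^bsub>V\<^esub> y)) = (\<Oplus>\<^bsub>W\<^esub>i\<in>I. f i x) \<oplus>\<^bsub>W\<^esub> (\<Oplus>\<^bsub>W\<^esub>i\<in>I. f i y)"
      using c xy by (simp add: W.finsum_addf Pi_iff)
  next
    fix s x assume x: "x \<in> carrier V"
    have "(\<Oplus>\<^bsub>W\<^esub>i\<in>I. f i (s \<odot>\<^bsub>V\<^esub> x)) = (\<Oplus>\<^bsub>W\<^esub>i\<in>I. s \<odot>\<^bsub>W\<^esub> f i x)"
      by (rule finsum_cong_simp[OF assms(1) refl])
        (use c x linear_mapD(3)[OF assms(2)] in simp_all)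
    then show "(\<Oplus>\<^bsub>W\<^esub>i\<in>I. f i (s \<odot>\<^bsub>V\<^esub> x)) = s \<odot>\<^bsub>W\<^esub> (\<Oplus>\<^bsub>W\<^esub>i\<in>I. f i x)"
      using c x by (simp add: W.smult_finsum Pi_iff)
  qed (use c in \<open>simp add: W.finsum_closed Pi_iff\<close>)
qed

lemma linear_map_smult_fixed:
  assumes "cvs W" "linear_map V complex_alg f" "w \<in> carrier W"
  shows "linear_map V W (\<lambda>v. f v \<odot>\<^bsub>W\<^esub> w)"
proof -
  interpret W: cvs W by fact
  show ?thesis
    by (rule linear_mapI)
      (use assms(3) in \<open>simp_all add: linear_mapD[OF assms(2)] W.smult_l_distr W.smult_assoc1\<close>)
qed

lemma linear_map_smult:
  assumes "cvs W"
  shows "linear_map W W (\<lambda>w. c \<odot>\<^bsub>W\<^esub> w)"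
proof -
  interpret W: cvs W by fact
  show ?thesis
    by (rule linear_mapI)
      (simp_all add: W.smult_r_distr mult.commute flip: W.smult_assoc1)
qed

lemma bilinear_mapI:
  assumes "\<And>a. a \<in> carrier V \<Longrightarrow> linear_map W U (\<beta> a)"
    "\<And>b. b \<in> carrier W \<Longrightarrow> linear_map V U (\<lambda>a. \<beta> a b)"
  shows "bilinear_map V W U \<beta>"
  using assms by (simp add: bilinear_map_def)

lemma functional_bilinear:
  assumes "cvs V" "linear_map W complex_alg f"
  shows "bilinear_map V W V (\<lambda>m a. f a \<odot>\<^bsub>V\<^esub> m)"
  by (intro bilinear_mapI linear_map_smult_fixed linear_map_smult assms)

lemma tensor_pairI: "cvs V \<Longrightarrow> cvs W \<Longrightarrow> tensor_pair V W"
  by (simp add: tensor_pair_def)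

lemma tensor_cvs: "cvs V \<Longrightarrow> cvs W \<Longrightarrow> cvs (tensor V W)"
  using tensor_pair.ten_bilinear[OF tensor_pairI]
  by (metis tensor_pair.null_submodule tensor_pairI tensor_def cvs.quot_cvs pair_alg_cvs)

lemma tensor_map_bilinear:
  assumes "cvs V'" "cvs W'" "linear_map V V' f" "linear_map W W' g"
  shows "bilinear_map V W (tensor V' W') (\<lambda>a b. ten V' W' (f a) (g b))"
proof -
  interpret T': tensor_pair V' W' by (rule tensor_pairI[OF assms(1,2)])
  note b = bilinear_mapD[OF T'.ten_bilinear]
  show ?thesis
  proof (rule bilinear_mapI)
    fix a assume "a \<in> carrier V"
    then show "linear_map W (tensor V' W') (\<lambda>b. ten V' W' (f a) (g b))"
      by (intro linear_map_compose[OF assms(4) b(2)] linear_mapD(1)[OF assms(3)])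
  next
    fix c assume "c \<in> carrier W"
    then show "linear_map V (tensor V' W') (\<lambda>a. ten V' W' (f a) (g c))"
      by (intro linear_map_compose[OF assms(3) b(1)] linear_mapD(1)[OF assms(4)])
  qed
qed

lemma tensor_map_linear:
  assumes "cvs V" "cvs W" "cvs V'" "cvs W'" "linear_map V V' f" "linear_map W W' g"
  shows "linear_map (tensor V W) (tensor V' W') (tensor_map V' W' f g)"
  unfolding tensor_map_def
  by (rule tensor_pair.tensor_lift_linear[OF tensor_pairI[OF assms(1,2)] tensor_cvs[OF assms(3,4)]
        tensor_map_bilinear[OF assms(3-6)]])

lemma tensor_map_ten:
  assumes "cvs V" "cvs W" "cvs V'" "cvs W'" "linear_map V V' f" "linear_map W W' g"
    "a \<in> carrier V" "b \<in> carrier W"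
  shows "tensor_map V' W' f g (ten V W a b) = ten V' W' (f a) (g b)"
  unfolding tensor_map_def
  by (rule tensor_pair.tensor_lift_ten[OF tensor_pairI[OF assms(1,2)] tensor_cvs[OF assms(3,4)]
        tensor_map_bilinear[OF assms(3-6)] assms(7,8)])

locale tensor_triple =
  fixes A :: "(complex, 'a) module" and B :: "(complex, 'b) module" and C :: "(complex, 'c) module"
  assumes A: "cvs A" and B: "cvs B" and C: "cvs C"
begin

interpretation A: cvs A by (rule A)
interpretation B: cvs B by (rule B)
interpretation C: cvs C by (rule C)
interpretation AB: tensor_pair A B ..
interpretation BC: tensor_pair B C ..
interpretation A_BC: tensor_pair A "tensor B C" ..
interpretation AB_C: tensor_pair "tensor A B" C ..

abbreviation "U \<equiv> tensor A (tensor B C)"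

definition inner :: "'c \<Rightarrow> 'a \<Rightarrow> 'b \<Rightarrow> (('a \<times> (('b \<times> 'c) \<Rightarrow>\<^sub>0 complex) set) \<Rightarrow>\<^sub>0 complex) set" where
  "inner c a b = ten A (tensor B C) a (ten B C b c)"

lemma inner_bilinear: "c \<in> carrier C \<Longrightarrow> bilinear_map A B U (inner c)"
  unfolding inner_def
  by (rule bilinear_mapI)
    (auto intro!: bilinear_mapD(1)[OF A_BC.ten_bilinear]
      linear_map_compose[OF bilinear_mapD(1)[OF BC.ten_bilinear] bilinear_mapD(2)[OF A_BC.ten_bilinear]])

lemma outer_bilinear: "bilinear_map (tensor A B) C U (\<lambda>t c. tensor_lift U (inner c) t)"
proof (rule bilinear_mapI)
  note lin = AB.tensor_lift_linear[OF A_BC.T.cvs_axioms inner_bilinear]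
  note ten = AB.tensor_lift_ten[OF A_BC.T.cvs_axioms inner_bilinear]
  show "linear_map (tensor A B) U (\<lambda>t. tensor_lift U (inner c) t)" if "c \<in> carrier C" for c
    by (rule lin[OF that])
  fix t assume t: "t \<in> carrier (tensor A B)"
  have ci: "linear_map C U (\<lambda>c. inner c a b)" if "a \<in> carrier A" "b \<in> carrier B" for a b
    unfolding inner_def
    by (rule linear_map_compose[OF bilinear_mapD(2)[OF BC.ten_bilinear that(2)]
          bilinear_mapD(2)[OF A_BC.ten_bilinear that(1)]])
  \<comment> \<open>Linearity in \<open>c\<close> holds for pure tensors by \<open>ci\<close>. Both
    sides of each identity are linear in \<open>t\<close>, so it extends to all of
    \<open>tensor A B\<close>.\<close>
  show "linear_map C U (\<lambda>c. tensor_lift U (inner c) t)"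
  proof (rule linear_mapI)
    fix x assume x: "x \<in> carrier C"
    show "tensor_lift U (inner x) t \<in> carrier U" by (rule linear_mapD(1)[OF lin[OF x] t])
    show "tensor_lift U (inner (s \<odot>\<^bsub>C\<^esub> x)) t = s \<odot>\<^bsub>U\<^esub> tensor_lift U (inner x) t" for s
      by (rule AB.tensor_linear_eq[OF A_BC.T.cvs_axioms lin[OF C.smult_closed[OF x]]
            linear_map_compose[OF lin[OF x] linear_map_smult[OF A_BC.T.cvs_axioms]] _ t])
        (simp only: ten[OF x] ten[OF C.smult_closed[OF x]] linear_mapD(3)[OF ci x])
    fix y assume y: "y \<in> carrier C"
    have s: "linear_map (tensor A B) U (\<lambda>t. tensor_lift U (inner x) t \<oplus>\<^bsub>U\<^esub> tensor_lift U (inner y) t)"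
      using linear_mapD[OF lin[OF x]] linear_mapD[OF lin[OF y]]
      by (intro linear_mapI) (simp_all add: A_BC.T.a_ac A_BC.T.smult_r_distr)
    show "tensor_lift U (inner (x \<oplus>\<^bsub>C\<^esub> y)) t = tensor_lift U (inner x) t \<oplus>\<^bsub>U\<^esub> tensor_lift U (inner y) t"
      by (rule AB.tensor_linear_eq[OF A_BC.T.cvs_axioms lin[OF C.a_closed[OF x y]] s _ t])
        (simp only: ten[OF x] ten[OF y] ten[OF C.a_closed[OF x y]] linear_mapD(2)[OF ci x y])
  qed
qed

lemma assoc_eq: "tensor_assoc A B C = tensor_lift U (\<lambda>t c. tensor_lift U (inner c) t)"
  unfolding tensor_assoc_def inner_def[abs_def] ..

lemma assoc_linear: "linear_map (tensor (tensor A B) C) U (tensor_assoc A B C)"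
  unfolding assoc_eq by (rule AB_C.tensor_lift_linear[OF A_BC.T.cvs_axioms outer_bilinear])

lemma assoc_ten:
  assumes "a \<in> carrier A" "b \<in> carrier B" "c \<in> carrier C"
  shows "tensor_assoc A B C (ten (tensor A B) C (ten A B a b) c) = ten A (tensor B C) a (ten B C b c)"
proof -
  have "tensor_assoc A B C (ten (tensor A B) C (ten A B a b) c) = tensor_lift U (inner c) (ten A B a b)"
    unfolding assoc_eq
    by (rule AB_C.tensor_lift_ten[OF A_BC.T.cvs_axioms outer_bilinear]) (simp_all add: assms)
  also have "\<dots> = inner c a b"
    by (rule AB.tensor_lift_ten[OF A_BC.T.cvs_axioms inner_bilinear]) (simp_all add: assms)
  finally show ?thesis by (simp add: inner_def)
qed

end

subsection \<open>Comodules given by a matrix\<close>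

text \<open>The functionals \<open>co\<close> carry both halves of the basis property, spanning
  through \<open>expand\<close> and uniqueness through \<open>co_b\<close>, and they make the
  coaction an explicit formula for every vector.\<close>

locale matrix_comodule = M: cvs M for M :: "(complex, 'm) module" +
  fixes h :: complex and I :: "'i set" and b :: "'i \<Rightarrow> 'm" and co :: "'i \<Rightarrow> 'm \<Rightarrow> complex"
    and d :: "'i \<Rightarrow> 'i \<Rightarrow> free_poly set"
  assumes fin: "finite I"
    and b: "i \<in> I \<Longrightarrow> b i \<in> carrier M"
    and co: "i \<in> I \<Longrightarrow> linear_map M complex_alg (co i)"
    and co_b: "i \<in> I \<Longrightarrow> k \<in> I \<Longrightarrow> co i (b k) = (if i = k then 1 else 0)"
    and expand: "v \<in> carrier M \<Longrightarrow> v = (\<Oplus>\<^bsub>M\<^esub>i\<in>I. co i v \<odot>\<^bsub>M\<^esub> b i)"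
    and d: "i \<in> I \<Longrightarrow> k \<in> I \<Longrightarrow> d i k \<in> carrier (SLh h)"
    and comult: "i \<in> I \<Longrightarrow> k \<in> I \<Longrightarrow> sl_comult h (d i k) =
      (\<Oplus>\<^bsub>SLh2 h\<^esub>l\<in>I. ten (SLh h) (SLh h) (d i l) (d l k))"
    and counit: "i \<in> I \<Longrightarrow> k \<in> I \<Longrightarrow> sl_counit (d i k) = (if i = k then 1 else 0)"
begin

lemma co_expansion:
  assumes "i \<in> I"
  shows "co i (\<Oplus>\<^bsub>M\<^esub>k\<in>I. c k \<odot>\<^bsub>M\<^esub> b k) = c i"
proof -
  have "co i (\<Oplus>\<^bsub>M\<^esub>k\<in>I. c k \<odot>\<^bsub>M\<^esub> b k) = (\<Oplus>\<^bsub>complex_alg\<^esub>k\<in>I. co i (c k \<odot>\<^bsub>M\<^esub> b k))"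
    by (rule linear_map_finsum[OF M.cvs_axioms cvs_complex_alg co[OF assms]]) (use b in auto)
  also have "\<dots> = (\<Oplus>\<^bsub>complex_alg\<^esub>k\<in>I. if k = i then c i else 0)"
    by (rule finsum_cong_simp[OF cvs_complex_alg refl])
      (use b assms linear_mapD(3)[OF co[OF assms]] in \<open>auto simp: co_b\<close>)
  also have "\<dots> = c i"
    using cvs.finsum_single_index[OF cvs_complex_alg fin assms, of "\<lambda>k. if k = i then c i else 0"]
    by simp
  finally show ?thesis .
qed

lemma basis: "is_basis M I b"
  unfolding is_basis_def
proof (intro conjI ballI fin)
  show "b \<in> I \<rightarrow> carrier M" using b by auto
  fix v assume v: "v \<in> carrier M"
  show "\<exists>!c. c \<in> extensional I \<and> v = (\<Oplus>\<^bsub>M\<^esub>i\<in>I. c i \<odot>\<^bsub>M\<^esub> b i)"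
  proof (rule ex1I[of _ "restrict (\<lambda>i. co i v) I"])
    have "(\<Oplus>\<^bsub>M\<^esub>i\<in>I. restrict (\<lambda>i. co i v) I i \<odot>\<^bsub>M\<^esub> b i) = (\<Oplus>\<^bsub>M\<^esub>i\<in>I. co i v \<odot>\<^bsub>M\<^esub> b i)"
      by (rule finsum_cong_simp[OF M.cvs_axioms refl]) (use b in auto)
    then show "restrict (\<lambda>i. co i v) I \<in> extensional I \<and>
        v = (\<Oplus>\<^bsub>M\<^esub>i\<in>I. restrict (\<lambda>i. co i v) I i \<odot>\<^bsub>M\<^esub> b i)"
      using expand[OF v] by simp
    fix c assume c: "c \<in> extensional I \<and> v = (\<Oplus>\<^bsub>M\<^esub>i\<in>I. c i \<odot>\<^bsub>M\<^esub> b i)"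
    then show "c = restrict (\<lambda>i. co i v) I"
      using co_expansion[of _ c] by (auto simp: extensional_def restrict_def fun_eq_iff)
  qed
qed

lemma linear_eq_basis:
  assumes "cvs W" "linear_map M W f" "linear_map M W g" "\<And>i. i \<in> I \<Longrightarrow> f (b i) = g (b i)"
    "v \<in> carrier M"
  shows "f v = g v"
proof -
  interpret W: cvs W by fact
  have c: "(\<lambda>i. co i v \<odot>\<^bsub>M\<^esub> b i) \<in> I \<rightarrow> carrier M" using b by auto
  have "f v = (\<Oplus>\<^bsub>W\<^esub>i\<in>I. f (co i v \<odot>\<^bsub>M\<^esub> b i))"
    using linear_map_finsum[OF M.cvs_axioms assms(1,2) c] expand[OF assms(5)] by simp
  also have "\<dots> = (\<Oplus>\<^bsub>W\<^esub>i\<in>I. g (co i v \<odot>\<^bsub>M\<^esub> b i))"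
    by (rule finsum_cong_simp[OF assms(1) refl])
      (use b assms(4) linear_mapD(3)[OF assms(2)] linear_mapD(1,3)[OF assms(3)] in auto)
  also have "\<dots> = g v"
    using linear_map_finsum[OF M.cvs_axioms assms(1,3) c] expand[OF assms(5)] by simp
  finally show ?thesis .
qed

interpretation H: cvs "SLh h"
  by (rule calg.axioms(1)[OF SLh_calg])

interpretation MH: tensor_pair M "SLh h" ..


definition \<rho> :: "'m \<Rightarrow> (('m \<times> free_poly set) \<Rightarrow>\<^sub>0 complex) set" where
  "\<rho> v = (\<Oplus>\<^bsub>tensor M (SLh h)\<^esub>k\<in>I. ten M (SLh h) (b k) (\<Oplus>\<^bsub>SLh h\<^esub>m\<in>I. co m v \<odot>\<^bsub>SLh h\<^esub> d k m))"

lemma rho_linear: "linear_map M (tensor M (SLh h)) \<rho>"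
  unfolding \<rho>_def[abs_def]
proof (intro linear_map_finsum_pointwise MH.T.cvs_axioms)
  fix k assume k: "k \<in> I"
  have "linear_map M (SLh h) (\<lambda>v. \<Oplus>\<^bsub>SLh h\<^esub>m\<in>I. co m v \<odot>\<^bsub>SLh h\<^esub> d k m)"
    by (intro linear_map_finsum_pointwise linear_map_smult_fixed H.cvs_axioms co d k)
  then show "linear_map M (tensor M (SLh h)) (\<lambda>v. ten M (SLh h) (b k) (\<Oplus>\<^bsub>SLh h\<^esub>m\<in>I. co m v \<odot>\<^bsub>SLh h\<^esub> d k m))"
    by (rule linear_map_compose) (rule bilinear_mapD(2)[OF MH.ten_bilinear b[OF k]])
qed

lemma rho_b:
  assumes m: "m \<in> I"
  shows "\<rho> (b m) = (\<Oplus>\<^bsub>tensor M (SLh h)\<^esub>k\<in>I. ten M (SLh h) (b k) (d k m))"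
  unfolding \<rho>_def
proof (rule finsum_cong_simp[OF MH.T.cvs_axioms refl])
  fix k assume k: "k \<in> I"
  then show "ten M (SLh h) (b k) (d k m) \<in> carrier (tensor M (SLh h))" using b d m by simp
  have "(\<Oplus>\<^bsub>SLh h\<^esub>l\<in>I. co l (b m) \<odot>\<^bsub>SLh h\<^esub> d k l) = co m (b m) \<odot>\<^bsub>SLh h\<^esub> d k m"
    by (rule H.finsum_single_index[OF fin m]) (use d k m co_b in auto)
  then show "ten M (SLh h) (b k) (\<Oplus>\<^bsub>SLh h\<^esub>l\<in>I. co l (b m) \<odot>\<^bsub>SLh h\<^esub> d k l) = ten M (SLh h) (b k) (d k m)"
    using co_b[OF m m] d[OF k m] by simp
qed

lemma ten_b_d: "i \<in> I \<Longrightarrow> k \<in> I \<Longrightarrow> m \<in> I \<Longrightarrow> ten M (SLh h) (b i) (d k m) \<in> carrier (tensor M (SLh h))"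
  using b d by simp

text \<open>The map \<open>(id \<otimes> f) \<rho>\<close>.\<close>

definition act :: "(free_poly set \<Rightarrow> complex) \<Rightarrow> 'm \<Rightarrow> 'm" where
  "act f v = tensor_lift M (\<lambda>m a. f a \<odot>\<^bsub>M\<^esub> m) (\<rho> v)"

lemma act_linear: "linear_map (SLh h) complex_alg f \<Longrightarrow> linear_map M M (act f)"
  unfolding act_def[abs_def]
  by (rule linear_map_compose[OF rho_linear MH.tensor_lift_linear[OF M.cvs_axioms functional_bilinear[OF M.cvs_axioms]]])

lemma act_b:
  assumes f: "linear_map (SLh h) complex_alg f" and m: "m \<in> I"
  shows "act f (b m) = (\<Oplus>\<^bsub>M\<^esub>k\<in>I. f (d k m) \<odot>\<^bsub>M\<^esub> b k)"
proof -
  note fb = functional_bilinear[OF M.cvs_axioms f]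
  have "act f (b m) = (\<Oplus>\<^bsub>M\<^esub>k\<in>I. tensor_lift M (\<lambda>m a. f a \<odot>\<^bsub>M\<^esub> m) (ten M (SLh h) (b k) (d k m)))"
    unfolding act_def rho_b[OF m]
    by (rule linear_map_finsum[OF MH.T.cvs_axioms M.cvs_axioms MH.tensor_lift_linear[OF M.cvs_axioms fb]])
      (use ten_b_d m in auto)
  also have "\<dots> = (\<Oplus>\<^bsub>M\<^esub>k\<in>I. f (d k m) \<odot>\<^bsub>M\<^esub> b k)"
    by (rule finsum_cong_simp[OF M.cvs_axioms refl])
      (use b d m MH.tensor_lift_ten[OF M.cvs_axioms fb] in auto)
  finally show ?thesis .
qed

text \<open>On the basis vector \<open>b m\<close> both sides are the double sum of
  \<open>b l \<otimes> (d l k \<otimes> d k m)\<close>, taken in the two possible orders.\<close>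

lemma coassoc:
  assumes v: "v \<in> carrier M"
  shows "tensor_assoc M (SLh h) (SLh h) (tensor_map (tensor M (SLh h)) (SLh h) \<rho> id (\<rho> v)) =
    tensor_map M (SLh2 h) id (sl_comult h) (\<rho> v)"
proof -
  interpret TT: tensor_triple M "SLh h" "SLh h"
    by unfold_locales
  interpret MH_H: tensor_pair "tensor M (SLh h)" "SLh h" ..
  interpret M_HH: tensor_pair M "SLh2 h" ..
  let ?U = "tensor M (SLh2 h)"
  have idH: "linear_map (SLh h) (SLh h) id" and idM: "linear_map M M id"
    by (rule linear_mapI; simp)+
  note l1 = tensor_map_linear[OF M.cvs_axioms H.cvs_axioms MH.T.cvs_axioms H.cvs_axioms rho_linear idH]
  note l2 = tensor_map_linear[OF M.cvs_axioms H.cvs_axioms M.cvs_axioms tensor_cvs[OF H.cvs_axioms H.cvs_axioms] idM sl_comult_linear]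
  note t1 = tensor_map_ten[OF M.cvs_axioms H.cvs_axioms MH.T.cvs_axioms H.cvs_axioms rho_linear idH]
  note t2 = tensor_map_ten[OF M.cvs_axioms H.cvs_axioms M.cvs_axioms tensor_cvs[OF H.cvs_axioms H.cvs_axioms] idM sl_comult_linear]
  show ?thesis
  proof (rule linear_eq_basis[OF M_HH.T.cvs_axioms _ _ _ v])
    show "linear_map M ?U (\<lambda>v. tensor_assoc M (SLh h) (SLh h) (tensor_map (tensor M (SLh h)) (SLh h) \<rho> id (\<rho> v)))"
      by (rule linear_map_compose[OF linear_map_compose[OF rho_linear l1] TT.assoc_linear])
    show "linear_map M ?U (\<lambda>v. tensor_map M (SLh2 h) id (sl_comult h) (\<rho> v))"
      by (rule linear_map_compose[OF rho_linear l2])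
  next
    fix m assume m: "m \<in> I"
    let ?t = "\<lambda>l k. ten M (SLh2 h) (b l) (ten (SLh h) (SLh h) (d l k) (d k m))"
    have tc: "?t l k \<in> carrier ?U" if "l \<in> I" "k \<in> I" for l k
      using that b d m by simp
    have "tensor_assoc M (SLh h) (SLh h) (tensor_map (tensor M (SLh h)) (SLh h) \<rho> id (\<rho> (b m))) =
      (\<Oplus>\<^bsub>?U\<^esub>k\<in>I. tensor_assoc M (SLh h) (SLh h) (tensor_map (tensor M (SLh h)) (SLh h) \<rho> id (ten M (SLh h) (b k) (d k m))))"
      unfolding rho_b[OF m]
      by (rule linear_map_finsum[OF MH.T.cvs_axioms M_HH.T.cvs_axioms linear_map_compose[OF l1 TT.assoc_linear]])
        (use ten_b_d m in auto)
    also have "\<dots> = (\<Oplus>\<^bsub>?U\<^esub>k\<in>I. \<Oplus>\<^bsub>?U\<^esub>l\<in>I. ?t l k)"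
    proof (rule finsum_cong_simp[OF M_HH.T.cvs_axioms refl])
      fix k assume k: "k \<in> I"
      show "(\<Oplus>\<^bsub>?U\<^esub>l\<in>I. ?t l k) \<in> carrier ?U" using tc k by (simp add: Pi_iff)
      have "tensor_assoc M (SLh h) (SLh h) (tensor_map (tensor M (SLh h)) (SLh h) \<rho> id (ten M (SLh h) (b k) (d k m)))
        = tensor_assoc M (SLh h) (SLh h) (ten (tensor M (SLh h)) (SLh h) (\<rho> (b k)) (d k m))"
        using t1[OF b[OF k] d[OF k m]] by simp
      also have "\<dots> = (\<Oplus>\<^bsub>?U\<^esub>l\<in>I. tensor_assoc M (SLh h) (SLh h)
          (ten (tensor M (SLh h)) (SLh h) (ten M (SLh h) (b l) (d l k)) (d k m)))"
        unfolding rho_b[OF k]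
        by (rule linear_map_finsum[OF MH.T.cvs_axioms M_HH.T.cvs_axioms
              linear_map_compose[OF bilinear_mapD(1)[OF MH_H.ten_bilinear d[OF k m]] TT.assoc_linear]])
          (use ten_b_d k in auto)
      also have "\<dots> = (\<Oplus>\<^bsub>?U\<^esub>l\<in>I. ?t l k)"
        by (rule finsum_cong_simp[OF M_HH.T.cvs_axioms refl])
          (use tc k m b d TT.assoc_ten in auto)
      finally show "tensor_assoc M (SLh h) (SLh h) (tensor_map (tensor M (SLh h)) (SLh h) \<rho> id
        (ten M (SLh h) (b k) (d k m))) = (\<Oplus>\<^bsub>?U\<^esub>l\<in>I. ?t l k)" .
    qed
    also have "\<dots> = (\<Oplus>\<^bsub>?U\<^esub>l\<in>I. \<Oplus>\<^bsub>?U\<^esub>k\<in>I. ?t l k)"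
      by (rule M_HH.T.finsum_commute[OF fin fin]) (rule tc)
    also have "\<dots> = (\<Oplus>\<^bsub>?U\<^esub>l\<in>I. tensor_map M (SLh2 h) id (sl_comult h) (ten M (SLh h) (b l) (d l m)))"
    proof (rule finsum_cong_simp[OF M_HH.T.cvs_axioms refl])
      fix l assume l: "l \<in> I"
      have "tensor_map M (SLh2 h) id (sl_comult h) (ten M (SLh h) (b l) (d l m)) =
        ten M (SLh2 h) (b l) (\<Oplus>\<^bsub>SLh2 h\<^esub>k\<in>I. ten (SLh h) (SLh h) (d l k) (d k m))"
        using t2[OF b[OF l] d[OF l m]] comult[OF l m] by simp
      also have "\<dots> = (\<Oplus>\<^bsub>?U\<^esub>k\<in>I. ?t l k)"
        by (rule linear_map_finsum[OF tensor_cvs[OF H.cvs_axioms H.cvs_axioms] M_HH.T.cvs_axioms bilinear_mapD(2)[OF M_HH.ten_bilinear b[OF l]]])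
          (use d l m in auto)
      finally show e: "(\<Oplus>\<^bsub>?U\<^esub>k\<in>I. ?t l k) = tensor_map M (SLh2 h) id (sl_comult h) (ten M (SLh h) (b l) (d l m))" ..
      show "tensor_map M (SLh2 h) id (sl_comult h) (ten M (SLh h) (b l) (d l m)) \<in> carrier ?U"
        unfolding e[symmetric] using tc l by (simp add: Pi_iff)
    qed
    also have "\<dots> = tensor_map M (SLh2 h) id (sl_comult h) (\<rho> (b m))"
      unfolding rho_b[OF m]
      by (rule linear_map_finsum[OF MH.T.cvs_axioms M_HH.T.cvs_axioms l2, symmetric])
        (use ten_b_d m in auto)
    finally show "tensor_assoc M (SLh h) (SLh h) (tensor_map (tensor M (SLh h)) (SLh h) \<rho> id (\<rho> (b m))) =
       tensor_map M (SLh2 h) id (sl_comult h) (\<rho> (b m))" .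
  qed
qed

lemma comodule: "right_comodule (SLh h) (sl_comult h) sl_counit M \<rho>"
  unfolding right_comodule_def module_complex_alg_iff
proof (intro conjI ballI M.cvs_axioms rho_linear coassoc)
  fix v assume v: "v \<in> carrier M"
  have "act sl_counit v = v"
  proof (rule linear_eq_basis[OF M.cvs_axioms act_linear[OF sl_counit_linear] linear_map_id _ v])
    fix m assume m: "m \<in> I"
    have "(\<Oplus>\<^bsub>M\<^esub>k\<in>I. sl_counit (d k m) \<odot>\<^bsub>M\<^esub> b k) = sl_counit (d m m) \<odot>\<^bsub>M\<^esub> b m"
      by (rule M.finsum_single_index[OF fin m]) (use b m counit in auto)
    then show "act sl_counit (b m) = b m"
      using act_b[OF sl_counit_linear m] counit[OF m m] b[OF m] by simp
  qed
  then show "tensor_lift M (\<lambda>m a. sl_counit a \<odot>\<^bsub>M\<^esub> m) (\<rho> v) = v"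
    by (simp add: act_def)
qed

text \<open>The coaction maps \<open>N\<close> into the image of \<open>N \<otimes> H\<close>, which
  the application of \<open>f\<close> to the second leg sends back into \<open>N\<close>. Thus every
  functional yields an operator under which subcomodules are stable.\<close>

lemma subcomodule_act:
  assumes N: "subcomodule (SLh h) M \<rho> N" and f: "linear_map (SLh h) complex_alg f" and v: "v \<in> N"
  shows "act f v \<in> N"
proof -
  note fb = functional_bilinear[OF M.cvs_axioms f]
  have Ns: "submodule N complex_alg M" using N by (simp add: subcomodule_def)
  then have Nc: "N \<subseteq> carrier M" "\<And>c a. a \<in> N \<Longrightarrow> c \<odot>\<^bsub>M\<^esub> a \<in> N"
    unfolding M.submodule_iff by simp_all
  show ?thesis
    unfolding act_def
  proof (rule linear_map_lin_span[OF MH.T.cvs_axioms M.cvs_axioms MH.tensor_lift_linear[OF M.cvs_axioms fb] Ns])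
    show "\<rho> v \<in> lin_span (tensor M (SLh h)) {ten M (SLh h) n a | n a. n \<in> N \<and> a \<in> carrier (SLh h)}"
      using N v by (simp add: subcomodule_def)
  next
    show "{ten M (SLh h) n a | n a. n \<in> N \<and> a \<in> carrier (SLh h)} \<subseteq> carrier (tensor M (SLh h))"
      using Nc(1) by (auto intro!: MH.ten_closed)
  next
    fix s assume "s \<in> {ten M (SLh h) n a | n a. n \<in> N \<and> a \<in> carrier (SLh h)}"
    then obtain n a where na: "s = ten M (SLh h) n a" "n \<in> N" "a \<in> carrier (SLh h)" by auto
    then show "tensor_lift M (\<lambda>m a. f a \<odot>\<^bsub>M\<^esub> m) s \<in> N"
      using MH.tensor_lift_ten[OF M.cvs_axioms fb, of n a] Nc by auto
  qed
qed

end

text \<open>Irreducibility: a strictly upper triangular operator with nonzero superdiagonal moves every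
  nonzero vector of an invariant subspace into the line of the first basis vector, and from there an
  operator that vanishes below the subdiagonal, but nowhere on it, reaches all basis vectors.\<close>

locale matrix_comodule_hessenberg = matrix_comodule M h I b co d
  for M :: "(complex, 'm) module" and h and I :: "'i set" and b co d +
  fixes n :: nat and ix :: "nat \<Rightarrow> 'i" and e f :: "free_poly set \<Rightarrow> complex"
  assumes ix: "bij_betw ix {..n} I"
    and e: "linear_map (SLh h) complex_alg e" and f: "linear_map (SLh h) complex_alg f"
    and e_upper: "a \<le> n \<Longrightarrow> k \<le> n \<Longrightarrow> a \<le> k \<Longrightarrow> e (d (ix k) (ix a)) = 0"
    and e_super: "Suc k \<le> n \<Longrightarrow> e (d (ix k) (ix (Suc k))) \<noteq> 0"
    and f_lower: "a \<le> n \<Longrightarrow> k \<le> n \<Longrightarrow> Suc a < k \<Longrightarrow> f (d (ix k) (ix a)) = 0"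
    and f_sub: "Suc k \<le> n \<Longrightarrow> f (d (ix (Suc k)) (ix k)) \<noteq> 0"
begin

lemma ix_in: "k \<le> n \<Longrightarrow> ix k \<in> I"
  using ix by (auto simp: bij_betw_def)

lemma ix_cases: "i \<in> I \<Longrightarrow> \<exists>k\<le>n. i = ix k"
  using ix by (auto simp: bij_betw_def)

lemma co_act:
  assumes g: "linear_map (SLh h) complex_alg g" and v: "v \<in> carrier M" and k: "k \<le> n"
  shows "co (ix k) (act g v) = (\<Sum>a\<le>n. co (ix a) v * g (d (ix k) (ix a)))"
proof -
  note cs = cvs_complex_alg
  interpret C: cvs complex_alg by (rule cs)
  have csum: "(\<Oplus>\<^bsub>complex_alg\<^esub>i\<in>J. F i) = (\<Sum>i\<in>J. F i)" if "finite J" for J and F :: "'i \<Rightarrow> complex"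
    using that by (induct J) simp_all
  have l: "linear_map M complex_alg (\<lambda>v. co (ix k) (act g v))"
    by (rule linear_map_compose[OF act_linear[OF g] co[OF ix_in[OF k]]])
  have "co (ix k) (act g v) = (\<Oplus>\<^bsub>complex_alg\<^esub>i\<in>I. co (ix k) (act g (co i v \<odot>\<^bsub>M\<^esub> b i)))"
    using linear_map_finsum[OF M.cvs_axioms cs l, of "\<lambda>i. co i v \<odot>\<^bsub>M\<^esub> b i" I] b expand[OF v]
    by (simp add: Pi_iff)
  also have "\<dots> = (\<Sum>i\<in>I. co i v * g (d (ix k) i))"
    unfolding csum[OF fin]
    by (intro sum.cong refl)
      (use b linear_mapD(3)[OF l] in \<open>simp add: act_b[OF g] co_expansion[OF ix_in[OF k]]\<close>)
  also have "\<dots> = (\<Sum>a\<le>n. co (ix a) v * g (d (ix k) (ix a)))"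
    using sum.reindex_bij_betw[OF ix, of "\<lambda>i. co i v * g (d (ix k) i)"] by simp
  finally show ?thesis .
qed

context
  fixes N assumes N: "subcomodule (SLh h) M \<rho> N"
begin

lemma N_sub: "submodule N complex_alg M"
  using N by (simp add: subcomodule_def)

lemma N_closed: "v \<in> N \<Longrightarrow> v \<in> carrier M" "v \<in> N \<Longrightarrow> c \<odot>\<^bsub>M\<^esub> v \<in> N"
  "v \<in> N \<Longrightarrow> w \<in> N \<Longrightarrow> v \<oplus>\<^bsub>M\<^esub> w \<in> N"
  using N_sub unfolding M.submodule_iff by auto

lemma N_scale: "c \<odot>\<^bsub>M\<^esub> v \<in> N \<Longrightarrow> c \<noteq> 0 \<Longrightarrow> v \<in> carrier M \<Longrightarrow> v \<in> N"
  using N_closed(2)[of "c \<odot>\<^bsub>M\<^esub> v" "1 / c"] by (simp flip: M.smult_assoc1)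

lemma first_in_N:
  "r \<le> n \<Longrightarrow> v \<in> N \<Longrightarrow> co (ix r) v \<noteq> 0 \<Longrightarrow> (\<And>k. r < k \<Longrightarrow> k \<le> n \<Longrightarrow> co (ix k) v = 0) \<Longrightarrow> b (ix 0) \<in> N"
proof (induct r arbitrary: v)
  case 0
  have "v = (\<Oplus>\<^bsub>M\<^esub>i\<in>I. co i v \<odot>\<^bsub>M\<^esub> b i)" by (rule expand[OF N_closed(1)[OF 0(2)]])
  also have "\<dots> = co (ix 0) v \<odot>\<^bsub>M\<^esub> b (ix 0)"
  proof (rule M.finsum_single_index[OF fin])
    fix k assume "k \<in> I" "k \<noteq> ix 0"
    then show "co k v \<odot>\<^bsub>M\<^esub> b k = \<zero>\<^bsub>M\<^esub>"
      using ix_cases[of k] 0(4) b by (metis M.smult_zero_left gr0I)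
  qed (use ix_in[of 0] b in auto)
  finally show ?case
    using N_scale[of "co (ix 0) v" "b (ix 0)"] 0(2,3) b[OF ix_in[of 0]] by simp
next
  case (Suc r)
  have v: "v \<in> carrier M" by (rule N_closed(1)[OF Suc(3)])
  show ?case
  proof (rule Suc(1)[of "act e v"])
    show "act e v \<in> N" by (rule subcomodule_act[OF N e Suc(3)])
    show "r \<le> n" using Suc by simp
    \<comment> \<open>Only column \<open>r + 1\<close> survives: columns up to \<open>r\<close> are
      killed by \<open>e_upper\<close>, and those beyond \<open>r + 1\<close> carry no coordinate of
      \<open>v\<close>.\<close>
    have "co (ix r) (act e v) = (\<Sum>a\<in>{Suc r}. co (ix a) v * e (d (ix r) (ix a)))"
      unfolding co_act[OF e v \<open>r \<le> n\<close>]
    proof (rule sum.mono_neutral_right)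
      show "\<forall>i\<in>{..n} - {Suc r}. co (ix i) v * e (d (ix r) (ix i)) = 0"
      proof
        fix i assume i: "i \<in> {..n} - {Suc r}"
        show "co (ix i) v * e (d (ix r) (ix i)) = 0"
          using e_upper[of i r] Suc(5)[of i] i \<open>r \<le> n\<close> by (cases "i \<le> r") auto
      qed
    qed (use Suc in auto)
    then show "co (ix r) (act e v) \<noteq> 0"
      using Suc(4) e_super[OF Suc(2)] by simp
    fix k assume k: "r < k" "k \<le> n"
    show "co (ix k) (act e v) = 0"
      unfolding co_act[OF e v k(2)]
    proof (rule sum.neutral, rule)
      fix i assume i: "i \<in> {..n}"
      show "co (ix i) v * e (d (ix k) (ix i)) = 0"
        using e_upper[of i k] Suc(5)[of i] i k by (cases "i \<le> k") auto
    qed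
  qed
qed

lemma all_in_N: "b (ix 0) \<in> N \<Longrightarrow> k \<le> n \<Longrightarrow> b (ix k) \<in> N"
proof (induct k rule: less_induct)
  case (less k)
  show ?case
  proof (cases k)
    case 0
    then show ?thesis using less by simp
  next
    case (Suc l)
    then have l: "l \<le> n" "Suc l \<le> n" using less by auto
    define g where "g i = f (d i (ix l)) \<odot>\<^bsub>M\<^esub> b i" for i
    have gc: "g \<in> I \<rightarrow> carrier M" using b by (auto simp: g_def)
    \<comment> \<open>In the image of \<open>b (ix l)\<close> under the second operator, rows up to
      \<open>l\<close> belong to \<open>N\<close> by induction and rows beyond \<open>l + 1\<close>
      vanish. The row \<open>l + 1\<close> is then isolated by subtraction.\<close>
    have in_N: "g i \<in> N" if i: "i \<in> I - {ix (Suc l)}" for i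
    proof -
      obtain p where p: "p \<le> n" "i = ix p" using ix_cases i by auto
      then have "p \<noteq> Suc l" using i by auto
      then consider "p \<le> l" | "Suc l < p" by linarith
      then show ?thesis
      proof cases
        case 1
        then have "p < k" using Suc by simp
        then have "b (ix p) \<in> N" by (rule less.hyps[OF _ less.prems(1) p(1)])
        then show ?thesis
          unfolding g_def p(2) by (rule N_closed(2))
      next
        case 2
        then have "g i = 0 \<odot>\<^bsub>M\<^esub> b (ix 0)"
          unfolding g_def p(2) using f_lower[OF l(1) p(1)] b[OF ix_in[OF p(1)]] b[OF ix_in[of 0]] by simp
        then show ?thesis using N_closed(2)[OF less.prems(1)] by simp
      qed
    qed
    have "act f (b (ix l)) = finsum M g I"
      unfolding g_def[abs_def] by (rule act_b[OF f ix_in[OF l(1)]])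
    also have "\<dots> = finsum M g (insert (ix (Suc l)) (I - {ix (Suc l)}))"
      using ix_in[OF l(2)] by (simp add: insert_absorb)
    also have "\<dots> = g (ix (Suc l)) \<oplus>\<^bsub>M\<^esub> finsum M g (I - {ix (Suc l)})"
      using gc fin ix_in[OF l(2)] by (intro M.finsum_insert) auto
    finally have "act f (b (ix l)) = g (ix (Suc l)) \<oplus>\<^bsub>M\<^esub> finsum M g (I - {ix (Suc l)})" .
    moreover have rest: "finsum M g (I - {ix (Suc l)}) \<in> N"
      by (rule M.submodule_finsum[OF N_sub]) (use in_N in auto)
    moreover have "act f (b (ix l)) \<in> N"
      by (rule subcomodule_act[OF N f less.hyps]) (use less.prems Suc l in auto)
    moreover have gS: "g (ix (Suc l)) \<in> carrier M" using gc ix_in[OF l(2)] by auto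
    ultimately have "g (ix (Suc l)) = act f (b (ix l)) \<oplus>\<^bsub>M\<^esub> (- 1) \<odot>\<^bsub>M\<^esub> finsum M g (I - {ix (Suc l)})"
      using N_closed(1)[OF rest] by (simp add: M.smult_minus_one M.a_assoc M.r_neg)
    then have "g (ix (Suc l)) \<in> N"
      using N_closed(2,3) rest \<open>act f (b (ix l)) \<in> N\<close> by simp
    then show ?thesis
      unfolding g_def Suc by (rule N_scale) (use f_sub[OF l(2)] b[OF ix_in[OF l(2)]] in auto)
  qed
qed

lemma N_trivial: "N = {\<zero>\<^bsub>M\<^esub>} \<or> N = carrier M"
proof (cases "\<exists>v\<in>N. v \<noteq> \<zero>\<^bsub>M\<^esub>")
  case False
  have "\<zero>\<^bsub>M\<^esub> \<in> N" using N_sub[unfolded M.submodule_iff] by (elim conjE)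
  moreover have "x \<in> {\<zero>\<^bsub>M\<^esub>}" if "x \<in> N" for x
    using False that by (metis singletonI)
  ultimately have "N = {\<zero>\<^bsub>M\<^esub>}" by (intro equalityI subsetI) (metis singletonD)+
  then show ?thesis by (rule disjI1)
next
  case True
  then obtain v where v: "v \<in> N" "v \<noteq> \<zero>\<^bsub>M\<^esub>" by auto
  \<comment> \<open>The positions of the basis vectors that occur in \<open>v\<close>; the largest
    of them starts the descent to \<open>b (ix 0)\<close>.\<close>
  define K where "K = {k. k \<le> n \<and> co (ix k) v \<noteq> 0}"
  have "K \<noteq> {}"
  proof
    assume "K = {}"
    then have z: "co i v = 0" if "i \<in> I" for i using ix_cases[OF that] by (auto simp: K_def)
    have "(\<Oplus>\<^bsub>M\<^esub>i\<in>I. co i v \<odot>\<^bsub>M\<^esub> b i) = (\<Oplus>\<^bsub>M\<^esub>i\<in>I. \<zero>\<^bsub>M\<^esub>)"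
      by (rule finsum_cong_simp[OF M.cvs_axioms refl]) (use z b in auto)
    then show False using expand[OF N_closed(1)[OF v(1)]] v(2) by (simp add: M.finsum_zero)
  qed
  moreover have K: "finite K" by (rule finite_subset[of _ "{..n}"]) (auto simp: K_def)
  ultimately have m: "Max K \<in> K" by simp
  have "b (ix 0) \<in> N"
  proof (rule first_in_N[of "Max K" v])
    fix k assume "Max K < k" "k \<le> n"
    then show "co (ix k) v = 0" using Max_ge[OF K, of k] unfolding K_def by fastforce
  qed (use m v in \<open>auto simp: K_def\<close>)
  then have all: "b i \<in> N" if "i \<in> I" for i
    using all_in_N ix_cases[OF that] by auto
  have "carrier M \<subseteq> N"
  proof
    fix w assume w: "w \<in> carrier M"
    have "(\<Oplus>\<^bsub>M\<^esub>i\<in>I. co i w \<odot>\<^bsub>M\<^esub> b i) \<in> N"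
      by (rule M.submodule_finsum[OF N_sub]) (use all N_closed(2) in auto)
    then show "w \<in> N" using expand[OF w] by simp
  qed
  then show ?thesis using N_closed(1) by auto
qed

end

lemma irreducible: "irreducible_right_comodule (SLh h) (sl_comult h) sl_counit M \<rho>"
  unfolding irreducible_right_comodule_def
proof (intro conjI comodule allI impI)
  have i: "ix 0 \<in> I" by (rule ix_in) simp
  have "co (ix 0) \<zero>\<^bsub>M\<^esub> = 0"
    using linear_map_zero[OF M.cvs_axioms cvs_complex_alg co[OF i]] by simp
  then have "b (ix 0) \<noteq> \<zero>\<^bsub>M\<^esub>" using co_b[OF i i] by force
  then show "carrier M \<noteq> {\<zero>\<^bsub>M\<^esub>}" using b[OF i] by auto
qed (rule N_trivial)

end

subsection \<open>Subalgebras\<close>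

context calg
begin

lemma alg_span_subalgebra:
  assumes S: "S \<subseteq> carrier A"
  shows "subring (alg_span A S) A" "submodule (alg_span A S) complex_alg A"
proof -
  let ?F = "{B. subring B A \<and> submodule B complex_alg A \<and> S \<subseteq> B}"
  have c: "carrier A \<in> ?F" using carrier_is_subring submodule_carrier S by simp
  have sub: "\<And>B. B \<in> ?F \<Longrightarrow> subring B A" "\<And>B. B \<in> ?F \<Longrightarrow> submodule B complex_alg A" by simp_all
  show "subring (alg_span A S) A"
  proof (rule subringI)
    show "alg_span A S \<subseteq> carrier A" unfolding alg_span_def using c by (rule Inter_lower)
    fix x y assume "x \<in> alg_span A S" and "y \<in> alg_span A S"
    note xy = this[unfolded alg_span_def, THEN InterD]
    show "\<ominus> x \<in> alg_span A S"
      unfolding alg_span_def by (rule InterI) (rule subringE(5)[OF sub(1) xy(1)])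
    show "x \<otimes> y \<in> alg_span A S"
      unfolding alg_span_def by (rule InterI) (rule subringE(6)[OF sub(1) xy])
    show "x \<oplus> y \<in> alg_span A S"
      unfolding alg_span_def by (rule InterI) (rule subringE(7)[OF sub(1) xy])
  next
    show "\<one> \<in> alg_span A S"
      unfolding alg_span_def by (rule InterI) (rule subringE(3)[OF sub(1)])
  qed
  have m: "\<zero> \<in> B \<and> (\<forall>a\<in>B. \<forall>b\<in>B. a \<oplus> b \<in> B) \<and> (\<forall>c. \<forall>a\<in>B. c \<odot> a \<in> B)" if "B \<in> ?F" for B
    using sub(2)[OF that, unfolded submodule_iff] by (rule conjunct2)
  show "submodule (alg_span A S) complex_alg A"
    unfolding alg_span_def
  proof (rule submodule_iff[THEN iffD2], intro conjI ballI allI)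
    show "\<Inter>?F \<subseteq> carrier A" by (rule Inter_lower[OF c])
    show "\<zero> \<in> \<Inter>?F" by (rule InterI) (rule conjunct1[OF m])
  next
    fix s x assume x: "x \<in> \<Inter>?F"
    show "s \<odot> x \<in> \<Inter>?F"
      by (rule InterI) (rule bspec[OF spec[OF conjunct2[OF conjunct2[OF m]]] InterD[OF x]])
  next
    fix x y assume x: "x \<in> \<Inter>?F" and y: "y \<in> \<Inter>?F"
    show "x \<oplus> y \<in> \<Inter>?F"
      by (rule InterI)
        (rule bspec[OF bspec[OF conjunct1[OF conjunct2[OF m]] InterD[OF x]] InterD[OF y]])
  qed
qed

lemma alg_span_superset: "S \<subseteq> alg_span A S"
  unfolding alg_span_def by (rule Inter_greatest) simp

lemma subalgebra_calg:
  assumes "subring B A" "submodule B complex_alg A"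
  shows "calg (A\<lparr>carrier := B\<rparr>)"
proof -
  note s = subringE[OF assms(1)]
  note c = subsetD[OF s(1)]
  show ?thesis
    by (rule calgI[OF submodule_cvs[OF assms(2)]])
      (use s(3,6) c in \<open>simp_all add: m_assoc l_distr r_distr smult_mult_left smult_mult_right\<close>)
qed

end

text \<open>A finite sum is defined relative to the carrier of its record, so sums formed in a
  subspace have to be identified with those of the ambient space.\<close>

lemma finsum_submodule:
  assumes "cvs V" "submodule N complex_alg V" "f \<in> I \<rightarrow> N"
  shows "finsum (V\<lparr>carrier := N\<rparr>) f I = finsum V f I"
proof -
  interpret V: cvs V by fact
  interpret N: cvs "V\<lparr>carrier := N\<rparr>" by (rule V.submodule_cvs[OF assms(2)])
  have c: "N \<subseteq> carrier V" using assms(2)[unfolded V.submodule_iff] by (elim conjE)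
  show ?thesis using assms(3)
  proof (induct I rule: infinite_finite_induct)
    case (insert x F)
    then have f: "f \<in> F \<rightarrow> N" "f x \<in> N" by auto
    then have "f \<in> F \<rightarrow> carrier V" "f x \<in> carrier V" using c by auto
    then show ?case
      using insert f N.finsum_insert[of F x f] V.finsum_insert[of F x f] by simp
  qed simp_all
qed

subsection \<open>The quantum plane\<close>

lemma End2_carrier:
  "f \<in> carrier End2 \<longleftrightarrow> (\<forall>p r. f (p + r) = f p + f r) \<and> (\<forall>c p. f (scale2 c p) = scale2 c (f p))"
  by (simp add: End2_def Vector_Spaces.linear_iff vector_space_scale2)

lemma End2_simps [simp]:
  "monoid.mult End2 = (\<circ>)" "one End2 = id" "ring.zero End2 = (\<lambda>_. 0)"
  "add End2 = (\<lambda>f g p. f p + g p)" "smult End2 = (\<lambda>c f p. scale2 c (f p))"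
  by (simp_all add: End2_def)

lemma End2_calg: "calg End2"
proof (rule calgI)
  have "abelian_group End2"
  proof (rule abelian_groupI)
    fix f assume f: "f \<in> carrier End2"
    have "(\<lambda>p. scale2 (- 1) (f p)) \<in> carrier End2"
      using f by (simp add: End2_carrier scale2_simps mult.commute)
    moreover have "(\<lambda>p. scale2 (- 1) (f p) + f p) = (\<lambda>_. 0)"
      using scale2_simps(2)[of "- 1" 1] by (simp add: scale2_simps(4,5) fun_eq_iff)
    ultimately show "\<exists>g\<in>carrier End2. g \<oplus>\<^bsub>End2\<^esub> f = \<zero>\<^bsub>End2\<^esub>"
      by (intro bexI[of _ "\<lambda>p. scale2 (- 1) (f p)"]) simp_all
  qed (auto simp: End2_carrier scale2_simps fun_eq_iff algebra_simps)
  then show "cvs End2"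
    unfolding cvs_def cvs_axioms_def
    by (auto simp: End2_carrier scale2_simps fun_eq_iff mult.commute)
qed (auto simp: End2_carrier fun_eq_iff)

interpretation End2: calg End2
  by (rule End2_calg)

lemma xi_eta_End2: "\<xi>h h \<in> carrier End2" "\<eta>h h \<in> carrier End2"
  by (simp_all add: End2_carrier \<xi>h_def \<eta>h_def exp_sigma_linear scale2_simps distrib_left)

lemma plane_simps [simp]:
  "monoid.mult (plane h) = (\<circ>)" "one (plane h) = id" "ring.zero (plane h) = (\<lambda>_. 0)"
  "add (plane h) = (\<lambda>f g p. f p + g p)" "smult (plane h) = (\<lambda>c f p. scale2 c (f p))"
  by (simp_all add: plane_def)

lemma plane_carrier: "carrier (plane h) = alg_span End2 {\<xi>h h, \<eta>h h}"
  by (simp add: plane_def)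

lemma plane_calg: "calg (plane h)"
  unfolding plane_def
  by (intro End2.subalgebra_calg End2.alg_span_subalgebra) (simp_all add: xi_eta_End2)

interpretation PL: slh_alg_tensor "plane h" h for h
  by (simp add: slh_alg_tensor_def plane_calg)

lemma xi_eta_plane: "\<xi>h h \<in> carrier (plane h)" "\<eta>h h \<in> carrier (plane h)"
  using End2.alg_span_superset[of "{\<xi>h h, \<eta>h h}"] by (simp_all add: plane_carrier)

text \<open>The unnormalised \<open>\<Phi>t\<close> for \<open>j = n/2\<close> and
  \<open>m = n/2 - a\<close>. The default zero for \<open>a > n\<close> keeps the family inside the
  plane algebra at all indices, as \<open>plane_expansion\<close> requires.\<close>

definition Zop :: "complex \<Rightarrow> nat \<Rightarrow> nat \<Rightarrow> poly2 \<Rightarrow> poly2" where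
  "Zop h n a p = (if a \<le> n then var_xi ^ (n - a) * var_eta ^ a * exp_\<sigma> h ((real n - 2 * real a) / 2) p else 0)"

lemma Zop_0: "Zop h 0 0 = id"
  by (simp add: fun_eq_iff Zop_def exp_sigma_0)

lemma Zop_xi:
  assumes "a \<le> n"
  shows "Zop h n a \<circ> \<xi>h h = Zop h (Suc n) a"
proof
  fix p
  define t where "t = (real n - 2 * real a) / 2"
  have e: "t + 1 / 2 = (real (Suc n) - 2 * real a) / 2" by (simp add: t_def)
  have "(Zop h n a \<circ> \<xi>h h) p = var_xi ^ (n - a) * var_eta ^ a * (var_xi * exp_\<sigma> h (t + 1 / 2) p)"
    using assms by (simp add: Zop_def \<xi>h_def exp_sigma_xi exp_sigma_add flip: t_def)
  then show "(Zop h n a \<circ> \<xi>h h) p = Zop h (Suc n) a p"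
    unfolding e using assms by (simp add: Zop_def Suc_diff_le mult_ac del: of_nat_Suc)
qed

lemma Zop_eta:
  assumes "a \<le> n"
  shows "Zop h n a \<circ> \<eta>h h = (\<lambda>p. Zop h (Suc n) (Suc a) p + scale2 (kap h n a) (Zop h (Suc n) a p))"
proof
  fix p
  define t where "t = (real n - 2 * real a) / 2"
  have e: "t + - 1 / 2 = (real (Suc n) - 2 * real (Suc a)) / 2"
    "t + 1 + - 1 / 2 = (real (Suc n) - 2 * real a) / 2" by (simp_all add: t_def field_simps)
  have k: "2 * h * complex_of_real t = kap h n a" by (simp add: t_def kap_def)
  have "(Zop h n a \<circ> \<eta>h h) p = var_xi ^ (n - a) * var_eta ^ a *
     (var_eta * exp_\<sigma> h (t + - 1 / 2) p + scale2 (kap h n a) (var_xi * exp_\<sigma> h (t + 1 + - 1 / 2) p))"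
    using assms by (simp add: Zop_def \<eta>h_def exp_sigma_eta exp_sigma_add k flip: t_def)
  also have "\<dots> = Zop h (Suc n) (Suc a) p + scale2 (kap h n a) (Zop h (Suc n) a p)"
    unfolding e using assms
    by (simp add: Zop_def scale2_simps Suc_diff_le distrib_left mult_ac del: of_nat_Suc)
  finally show "(Zop h n a \<circ> \<eta>h h) p = Zop h (Suc n) (Suc a) p + scale2 (kap h n a) (Zop h (Suc n) a p)" .
qed

text \<open>The exponentials are not given as elements of the algebra generated by
  \<open>\<xi>h\<close> and \<open>\<eta>h\<close>. Membership is read off from the rules
  \<open>Zop_xi\<close> and \<open>Zop_eta\<close>, the second one solved for its leading
  term.\<close>

lemma Zop_plane: "Zop h n a \<in> carrier (plane h)"
proof (induct n arbitrary: a)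
  case 0
  show ?case
  proof (cases "a = 0")
    case True
    show ?thesis using PL.one_closed[of h] unfolding True Zop_0 plane_simps .
  next
    case False
    then have "Zop h 0 a = (\<lambda>_. 0)" by (simp add: Zop_def fun_eq_iff)
    then show ?thesis using PL.zero_closed by simp
  qed
next
  case (Suc n)
  show ?case
  proof (cases a)
    case 0
    then show ?thesis
      using PL.m_closed[OF Suc[of 0] xi_eta_plane(1)] by (simp add: Zop_xi)
  next
    case (Suc b)
    show ?thesis
    proof (cases "b \<le> n")
      case True
      have "Zop h (Suc n) (Suc b) = (\<lambda>p. (Zop h n b \<circ> \<eta>h h) p + scale2 (- kap h n b) ((Zop h n b \<circ> \<xi>h h) p))"
        unfolding Zop_eta[OF True] Zop_xi[OF True]
        using scale2_simps(2)[of "kap h n b" "- kap h n b"] by (simp add: fun_eq_iff add.assoc scale2_simps(5))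
      also have "\<dots> \<in> carrier (plane h)"
        using PL.a_closed[OF PL.m_closed[OF Suc.hyps[of b] xi_eta_plane(2)]
            PL.smult_closed[OF PL.m_closed[OF Suc.hyps[of b] xi_eta_plane(1)], of "- kap h n b"]]
        by simp
      finally show ?thesis by (simp add: Suc)
    next
      case False
      then have "Zop h (Suc n) a = (\<lambda>_. 0)" by (simp add: Suc Zop_def fun_eq_iff)
      then show ?thesis using PL.zero_closed by simp
    qed
  qed
qed

text \<open>Since \<open>Z 1 0 = X\<close>, \<open>Z 1 1 = Y\<close> and
  \<open>kap h 1 0 = h\<close>, the rule for \<open>Z 1 0 \<otimes> Y\<close> is the plane relation
  itself.\<close>

lemma (in plane_expansion) XY: "X \<otimes> Y = Y \<otimes> X \<oplus> h \<odot> (X \<otimes> X)"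
proof -
  have X1: "X = Z 1 0" and Y1: "Y = Z 1 1"
    using ZX[of 0 0] ZY[of 0 0] by (simp_all add: Z_zero kap_def)
  have "Z 1 0 \<otimes> Y = Z 2 1 \<oplus> h \<odot> Z 2 0" "Z 1 1 \<otimes> X = Z 2 1" "Z 1 0 \<otimes> X = Z 2 0"
    using ZY[of 0 1] ZX[of 1 1] ZX[of 0 1] by (simp_all add: kap_def numeral_2_eq_2)
  then show ?thesis by (simp only: X1[symmetric] Y1[symmetric])
qed

sublocale plane_expansion \<subseteq> P: h_plane A h X Y
  by unfold_locales (simp_all add: XY)

lemma (in plane_expansion) W_eq_Z: "a \<le> n \<Longrightarrow> P.W n a = Z n a"
proof (induct n arbitrary: a)
  case 0
  then show ?case by (simp add: P.W_zero Z_zero)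
next
  case (Suc n)
  show ?case
  proof (cases a)
    case 0
    then show ?thesis by (simp add: P.W_Suc_0 Suc.hyps ZX)
  next
    case (Suc b)
    then have b: "b \<le> n" using Suc.prems by simp
    have "kap h n b \<odot> Z (Suc n) b \<oplus> (- kap h n b) \<odot> Z (Suc n) b = \<zero>"
      by (simp flip: smult_l_distr)
    then show ?thesis
      by (simp add: Suc P.W_Suc_Suc[OF b] Suc.hyps[OF b] ZX[OF b] ZY[OF b] a_assoc)
  qed
qed

interpretation PE: plane_expansion "plane h" h "\<xi>h h" "\<eta>h h" "Zop h" for h
  by unfold_locales (simp_all add: xi_eta_plane Zop_plane Zop_0 Zop_xi Zop_eta)

subsection \<open>Weights\<close>

lemma spinsE:
  assumes "j \<in> spins"
  obtains n :: nat where "j = real n / 2"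
  using assms by (auto simp: spins_def)

locale spin =
  fixes h :: complex and j :: real and n :: nat
  assumes j: "j = real n / 2"
begin

text \<open>The index \<open>a\<close> counts the factors \<open>\<eta>\<close>, so it runs against
  the weight: \<open>a = 0\<close> is the highest weight \<open>j\<close>.\<close>

definition wt :: "nat \<Rightarrow> real" where
  "wt a = j - real a"

lemma nat_of_wt:
  "a \<le> n \<Longrightarrow> nat_of (j - wt a) = a" "a \<le> n \<Longrightarrow> nat_of (j + wt a) = n - a"
proof -
  show "nat_of (j - wt a) = a" by (simp add: wt_def)
  assume "a \<le> n"
  then have "j + wt a = real (n - a)" unfolding wt_def by (simp add: j of_nat_diff)
  then show "nat_of (j + wt a) = n - a" by simp
qed

lemma wt_inj: "inj_on wt A"
  by (simp add: inj_on_def wt_def)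

lemma weights_eq: "weights j = wt ` {..n}"
proof
  show "weights j \<subseteq> wt ` {..n}"
  proof
    fix m assume "m \<in> weights j"
    then obtain i where i: "m = - j + real i" "- j + real i \<le> j" by (auto simp: weights_def)
    then have "i \<le> n" by (simp add: j)
    then have "m = wt (n - i)" using i(1) unfolding wt_def by (simp add: j of_nat_diff)
    then show "m \<in> wt ` {..n}" by simp
  qed
  show "wt ` {..n} \<subseteq> weights j"
  proof
    fix m assume "m \<in> wt ` {..n}"
    then obtain a where a: "a \<le> n" "m = wt a" by auto
    then have "m = - j + real (n - a)" "- j + real (n - a) \<le> j" unfolding wt_def by (simp_all add: j of_nat_diff)
    then show "m \<in> weights j" unfolding weights_def by blast
  qed
qed

lemma wt_bij: "bij_betw wt {..n} (weights j)"
  by (simp add: bij_betw_def wt_inj weights_eq)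

lemma weights_finite: "finite (weights j)"
  by (simp add: weights_eq)

lemma finsum_weights:
  assumes "cvs V" "\<And>k. k \<in> weights j \<Longrightarrow> f k \<in> carrier V"
  shows "finsum V f (weights j) = (\<Oplus>\<^bsub>V\<^esub>a\<in>{..n}. f (wt a))"
proof -
  interpret cvs V by fact
  show ?thesis
    unfolding weights_eq by (rule finsum_reindex) (use assms weights_eq in \<open>auto intro: wt_inj\<close>)
qed

section \<open>Normalised elements and d-functions of spin j\<close>

abbreviation "cc \<equiv> c_coeff j"

lemma cc_nonzero [simp]: "cc m \<noteq> 0"
  by (simp add: c_coeff_def)

lemma Phi_t_eq:
  assumes "a \<le> n"
  shows "\<Phi>t h j (wt a) = (\<lambda>p. scale2 (cc (wt a)) (Zop h n a p))"
proof
  fix p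
  have "(real n - 2 * real a) / 2 = wt a" unfolding wt_def by (simp add: j)
  then show "\<Phi>t h j (wt a) p = scale2 (cc (wt a)) (Zop h n a p)"
    using assms by (simp add: \<Phi>t_def \<Phi>_def nat_of_wt Zop_def scale2_simps)
qed

lemma Phi_t_plane: "k \<in> weights j \<Longrightarrow> \<Phi>t h j k \<in> carrier (plane h)"
  using PL.smult_closed[OF Zop_plane] by (auto simp: weights_eq Phi_t_eq)

text \<open>In the left form the constants are \<open>(i - (n - a)) h\<close>, because
  \<open>j + m = n - a\<close>. Carrying the \<open>n - a\<close> copies of \<open>X\<close> to the
  right end adds \<open>(n - a) h\<close> to each constant and leaves \<open>i h\<close>, the
  constants of the right form.\<close>

lemma (in h_plane) ordered_products:
  assumes j: "j = real n / 2" and a: "a \<le> n"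
  shows "\<Phi>t_right h j (spin.wt j a) A X Y = c_coeff j (spin.wt j a) \<odot> W n a"
    "\<Phi>t_left h j (spin.wt j a) A X Y = c_coeff j (spin.wt j a) \<odot> W n a"
proof -
  interpret s: spin h j n by unfold_locales (rule j)
  have m: "j + s.wt a = real (n - a)" using a unfolding s.wt_def by (simp add: j of_nat_diff)
  show "\<Phi>t_right h j (s.wt a) A X Y = c_coeff j (s.wt a) \<odot> W n a"
    by (simp add: \<Phi>t_right_def s.nat_of_wt[OF a] W_def L_def fac_def)
  have f: "Y \<oplus> - (h * complex_of_real (j + s.wt a - real i)) \<odot> X = fac ((of_nat i - of_nat (n - a)) * h)" for i
    unfolding m fac_def by (simp add: algebra_simps)
  have g: "(of_nat i - of_nat (n - a)) * h + of_nat (n - a) * h = of_nat i * h" for i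
    by (simp add: algebra_simps)
  show "\<Phi>t_left h j (s.wt a) A X Y = c_coeff j (s.wt a) \<odot> W n a"
    unfolding \<Phi>t_left_def s.nat_of_wt[OF a] f Xpow_list_prod g W_def L_def ..
qed

text \<open>The quotient of normalising constants passes from the monomials \<open>Zop\<close> to
  the elements \<open>\<Phi>t\<close>; in the coproduct the constant of the intermediate index
  cancels.\<close>

definition dd :: "real \<Rightarrow> real \<Rightarrow> free_poly set" where
  "dd k m = slq h (pm_scale (cc m / cc k) (dmat h n (nat_of (j - m)) (nat_of (j - k))))"

lemma dd_wt: "a \<le> n \<Longrightarrow> k \<le> n \<Longrightarrow> dd (wt k) (wt a) = slq h (pm_scale (cc (wt a) / cc (wt k)) (dmat h n a k))"
  by (simp add: dd_def nat_of_wt)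

lemma plane_formulas:
  assumes "m \<in> weights j"
  shows "\<Phi>t h j m = \<Phi>t_left h j m (plane h) (\<xi>h h) (\<eta>h h)"
    "\<Phi>t h j m = \<Phi>t_right h j m (plane h) (\<xi>h h) (\<eta>h h)"
proof -
  obtain a where a: "a \<le> n" "m = wt a" using assms by (auto simp: weights_eq)
  show "\<Phi>t h j m = \<Phi>t_left h j m (plane h) (\<xi>h h) (\<eta>h h)"
    "\<Phi>t h j m = \<Phi>t_right h j m (plane h) (\<xi>h h) (\<eta>h h)"
    unfolding a(2) PE.P.ordered_products[OF j a(1)] PE.W_eq_Z[OF a(1)]
    by (simp_all add: Phi_t_eq[OF a(1)])
qed

lemma primed_eq: "\<xi>h' h = PE.X' h" "\<eta>h' h = PE.Y' h"
  by (simp_all add: \<xi>h'_def \<eta>h'_def PE.X'_def PE.Y'_def PL.tq_def plane_SLh_def sl_eq gen_T)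

lemma primed_formulas:
  assumes "m \<in> weights j"
  shows "\<Phi>t_left h j m (plane_SLh h) (\<xi>h' h) (\<eta>h' h) =
      (\<Oplus>\<^bsub>plane_SLh h\<^esub>k\<in>weights j. ten (plane h) (SLh h) (\<Phi>t h j k) (dd k m))" (is "?l = ?s")
    and "\<Phi>t_right h j m (plane_SLh h) (\<xi>h' h) (\<eta>h' h) =
      (\<Oplus>\<^bsub>plane_SLh h\<^esub>k\<in>weights j. ten (plane h) (SLh h) (\<Phi>t h j k) (dd k m))" (is "?r = _")
proof -
  let ?T = "plane_SLh h"
  obtain a where a: "a \<le> n" "m = wt a" using assms by (auto simp: weights_eq)
  have T: "cvs ?T" unfolding plane_SLh_def by (rule PL.VH.T.cvs_axioms)
  interpret T: cvs ?T by (rule T)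
  have tqc: "PL.tq h (Zop h n k) p \<in> carrier ?T" for k p
    unfolding plane_SLh_def by (simp add: Zop_plane)
  have "?s = (\<Oplus>\<^bsub>?T\<^esub>k\<in>{..n}. ten (plane h) (SLh h) (\<Phi>t h j (wt k)) (dd (wt k) (wt a)))"
    unfolding a(2) by (rule finsum_weights[OF T])
      (simp add: plane_SLh_def Phi_t_plane dd_def PL.VH.ten_closed)
  also have "\<dots> = (\<Oplus>\<^bsub>?T\<^esub>k\<in>{..n}. cc (wt a) \<odot>\<^bsub>?T\<^esub> PL.tq h (Zop h n k) (dmat h n a k))"
  proof (rule finsum_cong_simp[OF T refl])
    fix k assume "k \<in> {..n}"
    then have k: "k \<le> n" by simp
    have "ten (plane h) (SLh h) (\<Phi>t h j (wt k)) (dd (wt k) (wt a)) =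
      PL.tq h (cc (wt k) \<odot>\<^bsub>plane h\<^esub> Zop h n k) (pm_scale (cc (wt a) / cc (wt k)) (dmat h n a k))"
      by (simp add: PL.tq_def dd_wt[OF a(1) k] Phi_t_eq[OF k])
    also have "\<dots> = cc (wt k) \<odot>\<^bsub>?T\<^esub> ((cc (wt a) / cc (wt k)) \<odot>\<^bsub>?T\<^esub> PL.tq h (Zop h n k) (dmat h n a k))"
      unfolding plane_SLh_def by (simp only: PL.tq_smult_left PL.tq_scale Zop_plane)
    also have "\<dots> = cc (wt a) \<odot>\<^bsub>?T\<^esub> PL.tq h (Zop h n k) (dmat h n a k)"
      using tqc by (simp flip: T.smult_assoc1)
    finally show "ten (plane h) (SLh h) (\<Phi>t h j (wt k)) (dd (wt k) (wt a)) =
      cc (wt a) \<odot>\<^bsub>?T\<^esub> PL.tq h (Zop h n k) (dmat h n a k)" .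
  qed (use tqc in simp)
  also have "\<dots> = cc (wt a) \<odot>\<^bsub>?T\<^esub> (\<Oplus>\<^bsub>?T\<^esub>k\<in>{..n}. PL.tq h (Zop h n k) (dmat h n a k))"
    by (rule T.smult_finsum[symmetric]) (use tqc in auto)
  also have "\<dots> = cc (wt a) \<odot>\<^bsub>?T\<^esub> PE.P'.W h n a"
    unfolding plane_SLh_def PE.W'_expansion[OF a(1)] ..
  finally have s: "?s = cc (wt a) \<odot>\<^bsub>?T\<^esub> PE.P'.W h n a" .
  show "?l = ?s" "?r = ?s"
    unfolding s unfolding primed_eq a(2) plane_SLh_def
    by (rule PE.P'.ordered_products[OF j a(1)])+
qed

lemma dd_comult:
  assumes "k \<in> weights j" "m \<in> weights j"
  shows "sl_comult h (dd k m) = (\<Oplus>\<^bsub>SLh2 h\<^esub>l\<in>weights j. ten (SLh h) (SLh h) (dd k l) (dd l m))"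
proof -
  obtain a b where ab: "a \<le> n" "m = wt a" "b \<le> n" "k = wt b" using assms by (auto simp: weights_eq)
  have "(\<Oplus>\<^bsub>SLh2 h\<^esub>l\<in>weights j. ten (SLh h) (SLh h) (dd k l) (dd l m)) =
     (\<Oplus>\<^bsub>SLh2 h\<^esub>l\<in>{..n}. ten (SLh h) (SLh h) (dd k (wt l)) (dd (wt l) m))"
    by (rule finsum_weights[OF HH.VH.T.cvs_axioms]) (simp add: dd_def HH.VH.ten_closed)
  also have "\<dots> = (\<Oplus>\<^bsub>SLh2 h\<^esub>l\<in>{..n}. (cc m / cc k) \<odot>\<^bsub>SLh2 h\<^esub> qq h (dmat h n l b) (dmat h n a l))"
  proof (rule finsum_cong_simp[OF HH.VH.T.cvs_axioms refl])
    fix l assume "l \<in> {..n}"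
    then have l: "l \<le> n" by simp
    have "ten (SLh h) (SLh h) (dd k (wt l)) (dd (wt l) m) =
      qq h (pm_scale (cc (wt l) / cc k) (dmat h n l b)) (pm_scale (cc m / cc (wt l)) (dmat h n a l))"
      by (simp add: HH.tq_def ab dd_wt l)
    also have "\<dots> = (cc m / cc k) \<odot>\<^bsub>SLh2 h\<^esub> qq h (dmat h n l b) (dmat h n a l)"
      by (simp add: slq_scale HH.tq_smult_left HH.tq_scale flip: HH.VH.T.smult_assoc1)
    finally show "ten (SLh h) (SLh h) (dd k (wt l)) (dd (wt l) m) =
       (cc m / cc k) \<odot>\<^bsub>SLh2 h\<^esub> qq h (dmat h n l b) (dmat h n a l)" .
  qed simp
  also have "\<dots> = (cc m / cc k) \<odot>\<^bsub>SLh2 h\<^esub> (\<Oplus>\<^bsub>SLh2 h\<^esub>l\<in>{..n}. qq h (dmat h n l b) (dmat h n a l))"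
    by (rule HH.VH.T.smult_finsum[symmetric]) simp
  also have "\<dots> = sl_comult h (dd k m)"
    by (simp add: ab dd_wt sl_comult_slq DE.eval_scale DEv_dmat)
  finally show ?thesis ..
qed

lemma dd_counit:
  assumes "k \<in> weights j" "m \<in> weights j"
  shows "sl_counit (dd k m) = (if k = m then 1 else 0)"
proof -
  obtain a b where ab: "a \<le> n" "m = wt a" "b \<le> n" "k = wt b" using assms by (auto simp: weights_eq)
  have "wt b = wt a \<longleftrightarrow> b = a" by (simp add: wt_def)
  then show ?thesis by (auto simp: ab dd_wt sl_counit_slq CEv_simps CEv_dmat)
qed

subsection \<open>The comodule\<close>

text \<open>The operator is applied to the constant polynomial \<open>1\<close>, which every
  \<open>exp_\<sigma>\<close> fixes. This recovers the undeformed monomial, so the deformed elements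
  inherit linear independence from ordinary monomials.\<close>

definition coord :: "nat \<Rightarrow> (poly2 \<Rightarrow> poly2) \<Rightarrow> complex" where
  "coord a f = Polynomial.coeff (Polynomial.coeff (f 1) a) (n - a)"

lemma coord_linear: "coord a (\<lambda>p. f p + g p) = coord a f + coord a g"
  "coord a (\<lambda>p. scale2 c (f p)) = c * coord a f"
  by (simp_all add: coord_def scale2_def)

lemma coord_Zop:
  assumes "b \<le> n" "a \<le> n"
  shows "coord a (Zop h n b) = (if a = b then 1 else 0)"
proof -
  have e: "var_eta ^ b = Polynomial.monom 1 b" by (simp add: var_eta_def monom_altdef)
  have x: "var_xi ^ k = [:Polynomial.monom 1 k:]" for k
  proof (induct k)
    case (Suc k)
    then show ?case by (simp add: var_xi_def monom_Suc)
  qed (simp add: one_pCons)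
  show ?thesis
    using assms by (auto simp: coord_def Zop_def exp_sigma_1 e x)
qed

abbreviation "M \<equiv> \<Phi>t_space h j"

lemma M_eq: "M = (plane h)\<lparr>carrier := lin_span (plane h) (\<Phi>t h j ` weights j)\<rparr>"
  by (simp add: \<Phi>t_space_def)

lemma M_simps [simp]:
  "add M = (\<lambda>f g p. f p + g p)" "smult M = (\<lambda>c f p. scale2 c (f p))"
  by (simp_all add: M_eq)

lemma M_sub: "submodule (carrier M) complex_alg (plane h)"
  unfolding M_eq by (simp, rule PL.lin_span_submodule) (auto simp: Phi_t_plane)

lemma M_cvs: "cvs M"
  using PL.submodule_cvs[OF M_sub] by (simp add: M_eq)

lemma Phi_t_M: "k \<in> weights j \<Longrightarrow> \<Phi>t h j k \<in> carrier M"
  unfolding M_eq using lin_span_superset[of "\<Phi>t h j ` weights j" "plane h"] by auto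

definition co :: "real \<Rightarrow> (poly2 \<Rightarrow> poly2) \<Rightarrow> complex" where
  "co k v = coord (nat_of (j - k)) v / cc k"

lemma co_Phi_t:
  assumes "i \<in> weights j" "k \<in> weights j"
  shows "co i (\<Phi>t h j k) = (if i = k then 1 else 0)"
proof -
  obtain a b where ab: "a \<le> n" "i = wt a" "b \<le> n" "k = wt b" using assms by (auto simp: weights_eq)
  have "wt a = wt b \<longleftrightarrow> a = b" by (simp add: wt_def)
  then show ?thesis by (simp add: ab co_def nat_of_wt Phi_t_eq coord_linear coord_Zop)
qed

lemma co_linear: "linear_map V complex_alg (co k)" if "add V = add (plane h)" "smult V = smult (plane h)"
  by (rule linear_mapI) (simp_all add: that co_def coord_linear add_divide_distrib)

text \<open>The right side depends linearly on \<open>v\<close> and fixes every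
  \<open>\<Phi>t h j k\<close>, hence the whole span. The argument takes place in
  \<open>plane h\<close>, and the sum is moved to the subspace at the end.\<close>

lemma M_expand:
  assumes v: "v \<in> carrier M"
  shows "v = (\<Oplus>\<^bsub>M\<^esub>i\<in>weights j. co i v \<odot>\<^bsub>M\<^esub> \<Phi>t h j i)"
proof -
  have pl: "cvs (plane h)" by (rule PL.cvs_axioms)
  have S: "\<Phi>t h j ` weights j \<subseteq> carrier (plane h)" by (auto simp: Phi_t_plane)
  have lin: "linear_map (plane h) (plane h) (\<lambda>v. \<Oplus>\<^bsub>plane h\<^esub>i\<in>weights j. co i v \<odot>\<^bsub>plane h\<^esub> \<Phi>t h j i)"
    by (intro linear_map_finsum_pointwise linear_map_smult_fixed pl co_linear Phi_t_plane refl)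
  have "v = (\<Oplus>\<^bsub>plane h\<^esub>i\<in>weights j. co i v \<odot>\<^bsub>plane h\<^esub> \<Phi>t h j i)"
  proof (rule linear_map_eq_on_span[OF pl pl linear_map_id lin S])
    show "v \<in> lin_span (plane h) (\<Phi>t h j ` weights j)" using v by (simp add: M_eq)
    fix s assume "s \<in> \<Phi>t h j ` weights j"
    then obtain k where k: "k \<in> weights j" "s = \<Phi>t h j k" by auto
    have "(\<Oplus>\<^bsub>plane h\<^esub>i\<in>weights j. co i s \<odot>\<^bsub>plane h\<^esub> \<Phi>t h j i) = co k s \<odot>\<^bsub>plane h\<^esub> \<Phi>t h j k"
      by (rule PL.finsum_single_index[OF weights_finite k(1)])
        (use k co_Phi_t Phi_t_plane PL.smult_closed[OF Phi_t_plane] in \<open>auto simp: scale2_simps\<close>)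
    then show "s = (\<Oplus>\<^bsub>plane h\<^esub>i\<in>weights j. co i s \<odot>\<^bsub>plane h\<^esub> \<Phi>t h j i)"
      using k co_Phi_t[OF k(1) k(1)] by (simp add: scale2_simps)
  qed
  also have "\<dots> = (\<Oplus>\<^bsub>M\<^esub>i\<in>weights j. co i v \<odot>\<^bsub>M\<^esub> \<Phi>t h j i)"
    using finsum_submodule[OF pl M_sub, of "\<lambda>i. co i v \<odot>\<^bsub>M\<^esub> \<Phi>t h j i" "weights j"]
      cvs.smult_closed[OF M_cvs Phi_t_M]
    by (simp add: M_eq Pi_iff)
  finally show ?thesis .
qed

lemma dd_functional:
  assumes "linear_map (SLh h) complex_alg g" "a \<le> n" "k \<le> n"
  shows "g (dd (wt k) (wt a)) = cc (wt a) / cc (wt k) * g (slq h (dmat h n a k))"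
  using linear_mapD(3)[OF assms(1) slq_closed] by (simp add: dd_wt assms(2,3) slq_scale)

text \<open>The normalising quotients are nonzero, so the triangular patterns of
  \<open>raising_dmat\<close> and \<open>lowering_dmat\<close> carry over to \<open>dd\<close>: up
  to these quotients the entries next to the diagonal are \<open>k + 1\<close> and
  \<open>n - k\<close>, both nonzero for \<open>k < n\<close>.\<close>

sublocale comod: matrix_comodule_hessenberg M h "weights j" "\<Phi>t h j" co dd n wt RE.hfun "LO.hfun h"
proof (intro matrix_comodule_hessenberg.intro matrix_comodule.intro matrix_comodule_axioms.intro
    matrix_comodule_hessenberg_axioms.intro M_cvs weights_finite Phi_t_M co_Phi_t M_expand
    dd_comult dd_counit wt_bij RE.hfun_linear LO.hfun_linear)
  show "linear_map M complex_alg (co i)" for i by (rule co_linear) (simp_all add: M_eq)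
  show "dd i k \<in> carrier (SLh h)" for i k by (simp add: dd_def)
qed (simp_all add: dd_functional RE.hfun_linear LO.hfun_linear RE.hfun_slq LO.hfun_slq
    raising_dmat lowering_dmat del: of_nat_Suc)

end

theorem proposition7p2:
  fixes h :: complex and j :: real
  assumes j: "j \<in> spins"
  shows
    "(\<forall>m\<in>weights j.
        \<Phi>t h j m \<in> carrier (plane h) \<and>
        \<Phi>t h j m = \<Phi>t_left h j m (plane h) (\<xi>h h) (\<eta>h h) \<and>
        \<Phi>t h j m = \<Phi>t_right h j m (plane h) (\<xi>h h) (\<eta>h h)) \<and>
     (\<exists>d :: real \<Rightarrow> real \<Rightarrow> free_poly set.
        (\<forall>k\<in>weights j. \<forall>m\<in>weights j. d k m \<in> carrier (SLh h)) \<and>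
        (\<forall>m\<in>weights j.
           \<Phi>t_left h j m (plane_SLh h) (\<xi>h' h) (\<eta>h' h) =
             (\<Oplus>\<^bsub>plane_SLh h\<^esub>k\<in>weights j. ten (plane h) (SLh h) (\<Phi>t h j k) (d k m)) \<and>
           \<Phi>t_right h j m (plane_SLh h) (\<xi>h' h) (\<eta>h' h) =
             (\<Oplus>\<^bsub>plane_SLh h\<^esub>k\<in>weights j. ten (plane h) (SLh h) (\<Phi>t h j k) (d k m))) \<and>
        (\<forall>k\<in>weights j. \<forall>m\<in>weights j.
           sl_comult h (d k m) =
             (\<Oplus>\<^bsub>tensor (SLh h) (SLh h)\<^esub>n\<in>weights j. ten (SLh h) (SLh h) (d k n) (d n m)) \<and>
           sl_counit (d k m) = (if k = m then 1 else 0)) \<and>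
        is_basis (\<Phi>t_space h j) (weights j) (\<Phi>t h j) \<and>
        (\<exists>\<rho>. irreducible_right_comodule (SLh h) (sl_comult h) sl_counit (\<Phi>t_space h j) \<rho> \<and>
             (\<forall>m\<in>weights j.
                \<rho> (\<Phi>t h j m) =
                  (\<Oplus>\<^bsub>tensor (\<Phi>t_space h j) (SLh h)\<^esub>k\<in>weights j.
                     ten (\<Phi>t_space h j) (SLh h) (\<Phi>t h j k) (d k m)))))"
proof -
  obtain n where n: "j = real n / 2" using j by (rule spinsE)
  interpret spin h j n by unfold_locales (rule n)
  show ?thesis
    by (intro conjI ballI exI[of _ dd] exI[of _ comod.\<rho>] Phi_t_plane plane_formulas primed_formulas
        dd_comult dd_counit comod.basis comod.irreducible comod.rho_b comod.d)
qed

end
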